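(* (Case $(n,n')=(2,1)$.) There exists a constant $C>0$ such that for all $\lambda\in(i\mathbb{R})^2$ and $\nu\in i\mathbb{R}$ with $\lambda_1+\lambda_2=\nu=0$ and all $s\in\frac12+i\mathbb{R}$, $$|G_{\lambda,\nu}(s)|=C\cdot\big|\ell^{\mathrm{mod}}_{\lambda,\nu,s}(\phi_\lambda\otimes\psi_\nu)\big|.$$
   Context: Let $G=\mathrm{GL}(2,\mathbb{R})$, $K_G=\mathrm{O}(2)$, $H=\mathrm{GL}(1,\mathbb{R})$ embedded in $G$ as $h\mapsto\mathrm{diag}(h,1)$, $K_H=\{\pm1\}\subseteq H$; $K_G,K_H$ carry Haar measures of total mass $1$. Representations. For $\lambda\in\mathbb{C}^2$ let $I_\lambda$ be the space of $u\in C^\infty(G)$ with $u\big(\begin{pmatrix}a&b\\0&d\end{pmatrix}g\big)=|a|^{\lambda_1+\frac12}|d|^{\lambda_2-\frac12}u(g)$ for all $a,d\in\mathbb{R}^\times$, $b\in\mathbb{R}$, $g\in G$; $\phi_\lambda\in I_\lambda$ is the unique right $K_G$-invariant element with $\phi_\lambda(e)=1$. For $\nu\in\mathbb{C}$ let $J_\nu=\mathbb{C}\,\psi_\nu\subseteq C^\infty(\mathbb{R}^\times)$ with $\psi_\nu(h)=|h|^\nu$. Model period. For $\lambda\in\mathbb{C}^2$, $\nu,s\in\mathbb{C}$ let $$\ell^{\mathrm{mod}}_{\lambda,\nu,s}(v\otimes w)=\int_{K_G\times K_H}K_{\lambda,\nu,s}(g,h)v(g)w(h)\,d(g,h)\qquad(v\in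 I_\lambda,\ w\in J_\nu),$$ where, with $x=gh^{-1}$, $$K_{\lambda,\nu,s}(g,h)=|x_{21}|^{\lambda_1+\nu+s-1}\,|\det x|^{-\lambda_1+\frac12}\,|x_{22}|^{-\lambda_2-\nu-s}.$$ The integral is an ordinary integral when the exponents of $|x_{21}|$ and $|x_{22}|$ have real part $\ge0$, and is defined in general by meromorphic continuation in $(\lambda,\nu,s)$. Archimedean factor. For $z\in G$ written (Iwasawa decomposition) as $z=\begin{pmatrix}1&x\\0&1\end{pmatrix}\begin{pmatrix}y&0\\0&1\end{pmatrix}ck$ with $x\in\mathbb{R}$, $y>0$, $c\in\mathbb{R}^\times$ (scalar matrix), $k\in\mathrm{O}(2)$, and $\alpha\in\mathbb{C}$, put $I_\alpha(z)=y^\alpha$. Jacquet's Whittaker function is $$W_J(z;\alpha,\psi)=\int_{\mathbb{R}}I_\alpha\Big(\begin{pmatrix}0&1\\1&0\end{pmatrix}\begin{pmatrix}1&t\\0&1\end{pmatrix}z\Big)e^{-2\pi\sqrt{-1}\,t}\,dt$$ for $\mathrm{Re}\,\alpha>\frac12$, extended holomorphically to $\alpha\in\mathbb{C}$ (the Whittaker function for $\mathrm{GL}(1)$ is the constant $1$). For $\lambda_1+\lambda_2=\nu=0$ put $\alpha=\frac12(\lambda_1-\lambda_2+1)$ and $$G_{\lambda,\nu}(s)=\int_0^\infty W_J\Big(\begin{pmatrix}y&0\\0&1\end{pmatrix};\alpha,\psi\Big)\,y^{s-\frac12}\,\frac{dy}{y}.$$ *)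

theory Defs
  imports "HOL-Probability.Probability" "HOL-Complex_Analysis.Complex_Analysis"
begin

no_notation fps_nth (infixl "$" 75)

section \<open>Holomorphic and meromorphic functions of several complex variables\<close>

definition holomorphic_Cn :: "(complex ^ 'n \<Rightarrow> complex) \<Rightarrow> (complex ^ 'n) set \<Rightarrow> bool" where
  "holomorphic_Cn f U \<longleftrightarrow>
     (\<forall>p\<in>U. \<exists>D. (f has_derivative D) (at p) \<and> (\<forall>c v. D (c *s v) = c * D v))"

text \<open>A meromorphic function is locally a quotient of holomorphic functions whose denominator
  vanishes identically on no nonempty open set. It is represented by a total function; its values
  where a local denominator vanishes are not constrained.\<close>

definition meromorphic_Cn :: "(complex ^ 'n \<Rightarrow> complex) \<Rightarrow> bool" where
  "meromorphic_Cn f \<longleftrightarrow>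
     (\<forall>p. \<exists>U P Q. open U \<and> p \<in> U \<and> holomorphic_Cn P U \<and> holomorphic_Cn Q U \<and>
        (\<forall>V. open V \<and> V \<noteq> {} \<and> V \<subseteq> U \<longrightarrow> (\<exists>q\<in>V. Q q \<noteq> 0)) \<and>
        (\<forall>q\<in>U. Q q \<noteq> 0 \<longrightarrow> f q = P q / Q q))"

text \<open>The value at \<open>p\<close> of the meromorphic continuation of \<open>f\<close> from \<open>R\<close> (a set with nonempty
  interior), for \<open>p\<close> outside the polar locus of the continuation: asking the representative
  \<open>F\<close> to be holomorphic near \<open>p\<close> makes \<open>F p\<close> independent of the representative.\<close>

definition meromorphic_continuation ::
    "(complex ^ 'n \<Rightarrow> complex) \<Rightarrow> (complex ^ 'n) set \<Rightarrow> complex ^ 'n \<Rightarrow> complex" where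
  "meromorphic_continuation f R p =
     (THE c. \<exists>F U. meromorphic_Cn F \<and> (\<forall>q\<in>R. F q = f q) \<and>
        open U \<and> p \<in> U \<and> holomorphic_Cn F U \<and> c = F p)"

section \<open>Smooth functions\<close>

primrec Ck_on ::
    "nat \<Rightarrow> ('a::real_normed_vector \<Rightarrow> 'b::real_normed_vector) \<Rightarrow> 'a set \<Rightarrow> bool" where
  "Ck_on 0 f S \<longleftrightarrow> continuous_on S f"
| "Ck_on (Suc k) f S \<longleftrightarrow>
     f differentiable_on S \<and> (\<forall>v. Ck_on k (\<lambda>x. frechet_derivative f (at x) v) S)"

text \<open>Intended for open subsets of finite-dimensional spaces.\<close>

definition smooth_on ::
    "('a::real_normed_vector \<Rightarrow> 'b::real_normed_vector) \<Rightarrow> 'a set \<Rightarrow> bool" where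
  "smooth_on f S \<longleftrightarrow> (\<forall>k. Ck_on k f S)"

section \<open>The groups\<close>

definition mat22 :: "real \<Rightarrow> real \<Rightarrow> real \<Rightarrow> real \<Rightarrow> real ^ 2 ^ 2" where
  "mat22 a b c d = vector [vector [a, b], vector [c, d]]"

definition GL2 :: "(real ^ 2 ^ 2) set" where
  "GL2 = {g. invertible g}"

definition O2 :: "(real ^ 2 ^ 2) set" where
  "O2 = {k. orthogonal_matrix k}"

definition GL1_embed :: "real \<Rightarrow> real ^ 2 ^ 2" where
  "GL1_embed h = mat22 h 0 0 1"

definition K_H :: "real set" where
  "K_H = {-1, 1}"

text \<open>Haar measure of total mass 1 on a compact group \<open>K\<close> with multiplication \<open>m\<close>.\<close>

definition haar_measure :: "('a::topological_space \<Rightarrow> 'a \<Rightarrow> 'a) \<Rightarrow> 'a set \<Rightarrow> 'a measure" where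
  "haar_measure m K =
     (THE M. prob_space M \<and> sets M = sets (restrict_space borel K) \<and>
        (\<forall>k\<in>K. distr M M (m k) = M))"

section \<open>The representations\<close>

text \<open>Functions on \<open>GL2\<close> are total functions on matrices, equal to \<open>undefined\<close> off \<open>GL2\<close>, so
  that equality in \<open>I_rep\<close> is equality of functions on the group.\<close>

definition I_rep :: "complex ^ 2 \<Rightarrow> (real ^ 2 ^ 2 \<Rightarrow> complex) set" where
  "I_rep l = {u \<in> extensional GL2. smooth_on u GL2 \<and>
     (\<forall>a b d. \<forall>g\<in>GL2. a \<noteq> 0 \<longrightarrow> d \<noteq> 0 \<longrightarrow>
        u (mat22 a b 0 d ** g) =
          of_real \<bar>a\<bar> powr (l $ 1 + 1/2) * of_real \<bar>d\<bar> powr (l $ 2 - 1/2) * u g)}"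

definition phi :: "complex ^ 2 \<Rightarrow> real ^ 2 ^ 2 \<Rightarrow> complex" where
  "phi l = (THE u. u \<in> I_rep l \<and> (\<forall>g\<in>GL2. \<forall>k\<in>O2. u (g ** k) = u g) \<and> u (mat 1) = 1)"

definition psi :: "complex \<Rightarrow> real \<Rightarrow> complex" where
  "psi n h = of_real \<bar>h\<bar> powr n"

section \<open>The model period\<close>

definition period_kernel ::
    "complex ^ 2 \<Rightarrow> complex \<Rightarrow> complex \<Rightarrow> real ^ 2 ^ 2 \<Rightarrow> real \<Rightarrow> complex" where
  "period_kernel l n s g h =
     (let x = g ** GL1_embed (inverse h) in
        of_real \<bar>x $ 2 $ 1\<bar> powr (l $ 1 + n + s - 1) *
        of_real \<bar>det x\<bar> powr (- l $ 1 + 1/2) *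
        of_real \<bar>x $ 2 $ 2\<bar> powr (- l $ 2 - n - s))"

definition period_integral ::
    "complex ^ 2 \<Rightarrow> complex \<Rightarrow> complex \<Rightarrow> (real ^ 2 ^ 2 \<Rightarrow> complex) \<Rightarrow> (real \<Rightarrow> complex) \<Rightarrow> complex"
  where
  "period_integral l n s v w =
     (\<integral>(g, h). period_kernel l n s g h * v g * w h
        \<partial>(haar_measure (**) O2 \<Otimes>\<^sub>M haar_measure (*) K_H))"

text \<open>The parameters \<open>(l, n, s)\<close> are packed into a vector \<open>p\<close> of four complex numbers.
  The integral involves only the restrictions of \<open>v\<close> and \<open>w\<close> to the compact groups. Keeping
  \<open>v\<close> and \<open>w\<close> fixed while the parameters vary is thus continuation along flat sections, that is,
  along vectors of the varying representations with constant restriction to the compact groups.\<close>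

definition convergence_region :: "(complex ^ 4) set" where
  "convergence_region =
     {p. Re (p $ 1 + p $ 3 + p $ 4 - 1) \<ge> 0 \<and> Re (- p $ 2 - p $ 3 - p $ 4) \<ge> 0}"

definition ell_mod ::
    "complex ^ 2 \<Rightarrow> complex \<Rightarrow> complex \<Rightarrow> (real ^ 2 ^ 2 \<Rightarrow> complex) \<Rightarrow> (real \<Rightarrow> complex) \<Rightarrow> complex"
  where
  "ell_mod l n s v w =
     meromorphic_continuation
       (\<lambda>p. period_integral (vector [p $ 1, p $ 2]) (p $ 3) (p $ 4) v w)
       convergence_region
       (vector [l $ 1, l $ 2, n, s])"

section \<open>The Whittaker function and the archimedean factor\<close>

definition iwasawa_y :: "real ^ 2 ^ 2 \<Rightarrow> real" where
  "iwasawa_y z =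
     (THE y. y > 0 \<and> (\<exists>x c. \<exists>k\<in>O2. c \<noteq> 0 \<and>
        z = mat22 1 x 0 1 ** mat22 y 0 0 1 ** mat c ** k))"

definition I_fun :: "complex \<Rightarrow> real ^ 2 ^ 2 \<Rightarrow> complex" where
  "I_fun \<alpha> z = of_real (iwasawa_y z) powr \<alpha>"

definition jacquet_integral :: "real ^ 2 ^ 2 \<Rightarrow> complex \<Rightarrow> complex" where
  "jacquet_integral z \<alpha> =
     (\<integral>t. I_fun \<alpha> (mat22 0 1 1 0 ** mat22 1 t 0 1 ** z) * exp (- 2 * of_real pi * \<i> * of_real t)
        \<partial>lborel)"

definition W_J :: "real ^ 2 ^ 2 \<Rightarrow> complex \<Rightarrow> complex" where
  "W_J z = (THE F. F holomorphic_on UNIV \<and> (\<forall>\<alpha>. Re \<alpha> > 1/2 \<longrightarrow> F \<alpha> = jacquet_integral z \<alpha>))"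

text \<open>Only meaningful for \<open>l $ 1 + l $ 2 = 0\<close> and \<open>n = 0\<close>; the Whittaker function of the
  one-dimensional group, which would carry the dependence on \<open>n\<close>, is the constant 1.\<close>

definition G_factor :: "complex ^ 2 \<Rightarrow> complex \<Rightarrow> complex \<Rightarrow> complex" where
  "G_factor l n s =
     (LINT y:{0<..}|lborel.
        W_J (mat22 y 0 0 1) ((l $ 1 - l $ 2 + 1) / 2) * of_real y powr (s - 1/2) / of_real y)"

end

(* Both sides are quotients of Gamma factors. The Haar measure of O(2) is the image of a Gaussian
measure on the plane, which turns the model period, where it converges, into a Beta integral
  Gamma(A) Gamma(B) / (pi Gamma(A + B)),  A = (l1 + n + s)/2,  B = (1 - l2 - n - s)/2;
this expression is meromorphic, hence gives the continuation by the identity theorem. On the other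
side, writing 1/(y^2 + t^2)^alpha as a Gamma integral over a Gaussian gives
  W_J(diag(y,1)) = (1/Gamma(alpha)) y^alpha sqrt(pi)
                   times the integral of x^(alpha - 3/2) exp(- x y^2 - pi^2/x) over x > 0,
which is entire in alpha, and its Mellin transform in y is, up to a power of pi,
Gamma((l1 + s)/2) Gamma((s - l1)/2) / (2 Gamma(alpha)). For purely imaginary l1 and Re s = 1/2 the
numbers s - l1 and 1 + l1 - s are complex conjugates, so the absolute values agree with C = pi/2. *)

theory Submission
  imports Defs
begin

section \<open>Mellin transforms of exponentials\<close>

text \<open>The two exponents in \<open>period_kernel\<close> add up to
  \<open>l $ 1 - l $ 2 - n - s + (n + s) - 1\<close>, that is \<open>l $ 1 - l $ 2 - 1\<close>, with
  real part -1 for imaginary \<open>l\<close>: no choice of \<open>n\<close> and \<open>s\<close>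
  puts such an \<open>l\<close> into \<open>convergence_region\<close>. The continuation must
  therefore move \<open>l\<close> as well, which calls for an identity theorem for meromorphic
  functions of several variables whose values at zeros of a denominator are arbitrary. Freezing the
  vectors meanwhile is harmless, since \<open>phi m\<close> and \<open>psi k\<close> equal 1 on the
  compact groups for all \<open>m\<close> and \<open>k\<close>.

  Haar measures, \<open>phi\<close>, the Iwasawa coordinate, \<open>W_J\<close> and the continuation
  are definite descriptions, so each needs existence and uniqueness before it can be computed. The
  Gaussian is convenient because its invariance is that of Lebesgue measure and of the norm: the
  circle is never parametrised.

  In C = pi/2, the pi is the normalisation of the Gaussian density and the 1/2 comes from the Mellin
  transform of exp(-x y^2) in y. The sqrt(pi) of the Fourier transform cancels against the power of
  pi left by the x-integral.\<close>

abbreviation pos_lborel :: "real measure" where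
  "pos_lborel \<equiv> restrict_space lborel {0<..}"

lemma space_pos_lborel [simp]: "space pos_lborel = {0<..}"
  by (simp add: space_restrict_space)

lemma sigma_finite_pos_lborel: "sigma_finite_measure pos_lborel"
  by (intro sigma_finite_measure_restrict_space sigma_finite_lborel) auto

lemma measurable_pos_lborel:
  "f \<in> borel_measurable borel \<Longrightarrow> f \<in> borel_measurable pos_lborel"
  by (intro measurable_restrict_space1) auto

lemma id_measurable_pos_lborel: "(\<lambda>x. x) \<in> pos_lborel \<rightarrow>\<^sub>M borel"
  by (intro measurable_restrict_space1) auto

lemma borel_measurable_of_real_powr [measurable]:
  fixes z :: complex
  assumes [measurable]: "f \<in> borel_measurable M"
  shows "(\<lambda>x. complex_of_real (f x) powr z) \<in> borel_measurable M"
  unfolding powr_def by measurable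

lemma of_real_powr_eq_exp:
  "x > 0 \<Longrightarrow> complex_of_real x powr z = exp (z * of_real (ln x))"
  by (simp add: powr_def Ln_of_real)

text \<open>Bridge between two integrals: the Gamma integral and the change of variables are used in
  gauge-integral form, Fubini in Bochner form. Borel measurability allows passing between
  \<open>lborel\<close> and its completion.\<close>

lemma has_bochner_integral_pos_lborel_iff:
  fixes f :: "real \<Rightarrow> complex"
  assumes [measurable]: "f \<in> borel_measurable borel"
  shows "has_bochner_integral pos_lborel f I \<longleftrightarrow>
    f absolutely_integrable_on {0<..} \<and> integral {0<..} f = I"
proof -
  have eq: "integrable pos_lborel f \<longleftrightarrow> f absolutely_integrable_on {0<..}"
  proof -
    have "(\<lambda>x. indicator {0<..} x *\<^sub>R f x) \<in> borel_measurable lborel"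
      unfolding measurable_lborel1 by measurable
    from integrable_completion[OF this] show ?thesis
      by (subst integrable_restrict_space) (simp_all add: set_integrable_def)
  qed
  have "integral\<^sup>L pos_lborel f = integral {0<..} f" if "f absolutely_integrable_on {0<..}"
  proof -
    have "integral\<^sup>L pos_lborel f = (LINT x:{0<..}|lebesgue. f x)"
    proof -
      have "(\<lambda>x. indicator {0<..} x *\<^sub>R f x) \<in> borel_measurable lborel"
      unfolding measurable_lborel1 by measurable
      from integral_completion[OF this] show ?thesis
        by (subst integral_restrict_space) (simp_all add: set_lebesgue_integral_def)
    qed
    with that show ?thesis by (simp add: set_lebesgue_integral_eq_integral)
  qed
  with eq show ?thesis
    by (metis has_bochner_integral_iff)
qed

text \<open>The map x -> c x^p is a bijection of the half-line also for negative \<open>p\<close>;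
  the case \<open>p = -1\<close> is needed later for exponentials in 1/x.\<close>

lemma has_bochner_integral_pos_lborel_power_subst:
  fixes f :: "real \<Rightarrow> complex" and c p :: real
  assumes [measurable]: "f \<in> borel_measurable borel" and "c > 0" "p \<noteq> 0"
  shows "has_bochner_integral pos_lborel (\<lambda>x. (\<bar>p\<bar> * c * x powr (p - 1)) *\<^sub>R f (c * x powr p)) I
    \<longleftrightarrow> has_bochner_integral pos_lborel f I"
proof -
  let ?g = "\<lambda>x. c * x powr p"
  have der: "(?g has_field_derivative c * p * x powr (p - 1)) (at x within {0<..})" if "x \<in> {0<..}" for x
    using that by (auto intro!: derivative_eq_intros simp: powr_diff)
  have inj: "inj_on ?g {0<..}"
  proof (rule inj_onI)
    fix x y :: real assume xy: "x \<in> {0<..}" "y \<in> {0<..}" "?g x = ?g y"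
    then have "(x powr p) powr (1/p) = (y powr p) powr (1/p)" using assms by simp
    then show "x = y" using xy assms by (simp add: powr_powr)
  qed
  have img: "?g ` {0<..} = {0<..}"
  proof safe
    fix x assume "0 < (x::real)"
    then have "x = ?g ((x / c) powr (1/p))"
      using assms by (simp add: powr_powr)
    then show "x \<in> ?g ` {0<..}" using \<open>0 < x\<close> assms by (metis image_eqI greaterThan_iff divide_pos_pos powr_gt_zero less_irrefl)
  next
    fix x :: real assume "0 < x" then show "0 < ?g x" using assms by simp
  qed
  have eq: "(\<lambda>x. \<bar>c * p * x powr (p - 1)\<bar> *\<^sub>R f (?g x)) = (\<lambda>x. (\<bar>p\<bar> * c * x powr (p - 1)) *\<^sub>R f (?g x))"
    using assms by (auto simp: abs_mult mult_ac)
  show ?thesis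
    using has_absolute_integral_change_of_variables_real[where b=I and S="{0<..}" and g="?g" and h="\<lambda>x. c * p * x powr (p - 1)" and f=f]
      der inj unfolding img eq
    by (subst (1 2) has_bochner_integral_pos_lborel_iff) auto
qed

lemma has_bochner_integral_Gamma:
  assumes "Re z > 0"
  shows "has_bochner_integral pos_lborel (\<lambda>x. of_real x powr (z - 1) * of_real (exp (- x))) (Gamma z)"
proof -
  have "(\<lambda>x. of_real x powr (z - 1) / complex_of_real (exp x)) = (\<lambda>x. of_real x powr (z - 1) * of_real (exp (- x)))"
    by (auto simp: exp_minus field_simps)
  then show ?thesis
    using absolutely_integrable_Gamma_integral'[OF assms] Gamma_integral_complex'[OF assms]
    by (subst has_bochner_integral_pos_lborel_iff) (auto simp: integral_unique)
qed

text \<open>Euler's integral for Gamma(z/p) under t = c x^p. It serves with \<open>p = 1\<close>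
  (Laplace transform of a power), \<open>p = 2\<close> (Gaussian moments) and \<open>p = -1\<close>
  (exponentials in 1/x), hence the convergence condition on the quotient
  \<open>Re z / p\<close>.\<close>

lemma has_bochner_integral_powr_exp:
  fixes c p :: real
  assumes "c > 0" "p \<noteq> 0" "Re z / p > 0"
  shows "has_bochner_integral pos_lborel (\<lambda>x. of_real x powr (z - 1) * of_real (exp (- c * x powr p)))
    (Gamma (z / of_real p) * of_real c powr (- z / of_real p) / of_real \<bar>p\<bar>)"
proof -
  let ?w = "z / of_real p"
  have "Re ?w > 0" using assms by (simp add: Re_divide_of_real)
  from has_bochner_integral_Gamma[OF this]
  have "has_bochner_integral pos_lborel (\<lambda>x. (\<bar>p\<bar> * c * x powr (p - 1)) *\<^sub>R
      (of_real (c * x powr p) powr (?w - 1) * of_real (exp (- (c * x powr p))))) (Gamma ?w)"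
    using assms by (subst has_bochner_integral_pos_lborel_power_subst) auto
  then have "has_bochner_integral pos_lborel (\<lambda>x. ((\<bar>p\<bar> * c * x powr (p - 1)) *\<^sub>R
      (of_real (c * x powr p) powr (?w - 1) * of_real (exp (- (c * x powr p))))) *
      (of_real c powr (- z / of_real p) / of_real \<bar>p\<bar>))
      (Gamma ?w * (of_real c powr (- z / of_real p) / of_real \<bar>p\<bar>))"
    by (intro has_bochner_integral_mult_left)
  moreover have "((\<bar>p\<bar> * c * x powr (p - 1)) *\<^sub>R
      (of_real (c * x powr p) powr (?w - 1) * of_real (exp (- (c * x powr p))))) *
      (of_real c powr (- z / of_real p) / of_real \<bar>p\<bar>)
     = of_real x powr (z - 1) * of_real (exp (- c * x powr p))" if "x > 0" for x
  proof -
    \<comment> \<open>All powers have positive bases, so each is written as an exponential of a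
      logarithm and only the exponents need comparing.\<close>
    have e: "complex_of_real c * complex_of_real (x powr (p - 1)) * of_real (c * x powr p) powr (?w - 1) * of_real c powr (- z / of_real p)
      = of_real x powr (z - 1)"
    proof -
      have 1: "complex_of_real c = exp (of_real (ln c))"
        using assms by (metis exp_ln exp_of_real)
      have 2: "complex_of_real (x powr (p - 1)) = exp (of_real ((p - 1) * ln x))"
        using that by (subst exp_of_real) (simp add: powr_def)
      have 3: "of_real (c * x powr p) powr (?w - 1) = exp ((?w - 1) * of_real (ln c + p * ln x))"
        using that assms by (subst of_real_powr_eq_exp) (auto simp: ln_mult ln_powr)
      have 4: "of_real c powr (- z / of_real p) = exp ((- z / of_real p) * of_real (ln c))"
        using assms by (subst of_real_powr_eq_exp) auto
      have 5: "of_real x powr (z - 1) = exp ((z - 1) * of_real (ln x))"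
        using that by (subst of_real_powr_eq_exp) auto
      have 6: "of_real (ln c) + of_real ((p - 1) * ln x) + (?w - 1) * of_real (ln c + p * ln x)
          + (- z / of_real p) * of_real (ln c) = (z - 1) * complex_of_real (ln x)"
        using assms by (simp add: field_simps)
      show ?thesis
        unfolding 2 3 4 5 by (subst 1) (simp only: exp_add[symmetric] 6)
    qed
    show ?thesis
      by (subst e[symmetric]) (use assms in \<open>simp add: scaleR_conv_of_real field_simps\<close>)
  qed
  ultimately show ?thesis
    by (subst (asm) has_bochner_integral_cong[OF refl _ refl]) auto
qed

text \<open>The real part of the complex formula at real exponents; it evaluates the integrals of
  norms that Fubini requires.\<close>

lemma has_bochner_integral_powr_exp_real:
  fixes c p a :: real
  assumes "c > 0" "p \<noteq> 0" "a / p > 0"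
  shows "has_bochner_integral pos_lborel (\<lambda>x. x powr (a - 1) * exp (- c * x powr p))
    (Gamma (a / p) * c powr (- a / p) / \<bar>p\<bar>)"
proof -
  have "has_bochner_integral pos_lborel
     (\<lambda>x. Re (of_real x powr (of_real a - 1) * of_real (exp (- c * x powr p))))
    (Re (Gamma (of_real a / of_real p) * of_real c powr (- of_real a / of_real p) / of_real \<bar>p\<bar>))"
    using has_bochner_integral_powr_exp[of c p "of_real a"] assms
    by (intro has_bochner_integral_Re) auto
  moreover have "Re (Gamma (of_real a / of_real p) * of_real c powr (- of_real a / of_real p) / of_real \<bar>p\<bar>)
     = Gamma (a / p) * c powr (- a / p) / \<bar>p\<bar>"
  proof -
    have "Gamma (of_real a / of_real p) * of_real c powr (- of_real a / of_real p) / of_real \<bar>p\<bar>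
      = complex_of_real (Gamma (a / p) * c powr (- a / p) / \<bar>p\<bar>)"
      using assms powr_of_real[of c "- (a / p)"] Gamma_complex_of_real[of "a / p"] by simp
    then show ?thesis by (metis Re_complex_of_real)
  qed
  moreover have "Re (of_real x powr (of_real a - 1) * of_real (exp (- c * x powr p))) = x powr (a - 1) * exp (- c * x powr p)"
    if "x > 0" for x
    using powr_of_real[of x "a - 1"] that by (simp add: powr_def)
  ultimately show ?thesis
    by (subst (asm) has_bochner_integral_cong[OF refl _ refl]) auto
qed

section \<open>Haar measures\<close>

text \<open>Integrate the indicator of \<open>X\<close> at \<open>m x y\<close> over both variables, in either order.\<close>

lemma haar_measure_unique:
  assumes "prob_space M" "prob_space N"
    and sM: "sets M = sets A" and sN: "sets N = sets A"
    and m: "(\<lambda>(x, y). m x y) \<in> A \<Otimes>\<^sub>M A \<rightarrow>\<^sub>M A"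
    and left: "\<And>k. k \<in> space A \<Longrightarrow> distr M M (m k) = M"
    and right: "\<And>k. k \<in> space A \<Longrightarrow> distr N N (\<lambda>x. m x k) = N"
  shows "M = N"
proof (rule measure_eqI)
  interpret M: prob_space M by fact
  interpret N: prob_space N by fact
  interpret NM: pair_sigma_finite N M ..
  note [measurable_cong] = sM sN
  note [measurable] = m
  have [simp]: "space M = space A" "space N = space A"
    using sM sN sets_eq_imp_space_eq by blast+
  show "sets M = sets N" using sM sN by simp
  fix X assume "X \<in> sets M"
  then have [measurable]: "X \<in> sets A" using sM by simp
  have mm [measurable]: "(\<lambda>y. m x y) \<in> A \<rightarrow>\<^sub>M A" "(\<lambda>y. m y x) \<in> A \<rightarrow>\<^sub>M A" if "x \<in> space A" for x
    using measurable_compose[OF measurable_Pair1' m] measurable_compose[OF measurable_Pair2' m] that by simp_all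
  have "emeasure M X = (\<integral>\<^sup>+x. emeasure M X \<partial>N)"
    by (simp add: N.emeasure_space_1[simplified])
  also have "\<dots> = (\<integral>\<^sup>+x. (\<integral>\<^sup>+y. indicator X (m x y) \<partial>M) \<partial>N)"
  proof (rule nn_integral_cong)
    fix x assume x: "x \<in> space N"
    have mx: "m x \<in> M \<rightarrow>\<^sub>M M" using mm(1)[of x] x by (simp add: measurable_cong_sets[OF sM sM])
    have "emeasure M X = (\<integral>\<^sup>+y. indicator X y \<partial>distr M M (m x))"
      using left[of x] x by simp
    also have "\<dots> = (\<integral>\<^sup>+y. indicator X (m x y) \<partial>M)"
      using mx by (subst nn_integral_distr) auto
    finally show "emeasure M X = (\<integral>\<^sup>+y. indicator X (m x y) \<partial>M)" .
  qed
  also have "\<dots> = (\<integral>\<^sup>+y. (\<integral>\<^sup>+x. indicator X (m x y) \<partial>N) \<partial>M)"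
    by (rule NM.Fubini'[symmetric]) measurable
  also have "\<dots> = (\<integral>\<^sup>+y. emeasure N X \<partial>M)"
  proof (rule nn_integral_cong)
    fix y assume y: "y \<in> space M"
    have my: "(\<lambda>x. m x y) \<in> N \<rightarrow>\<^sub>M N" using mm(2)[of y] y by (simp add: measurable_cong_sets[OF sN sN])
    have "emeasure N X = (\<integral>\<^sup>+x. indicator X x \<partial>distr N N (\<lambda>x. m x y))"
      using right[of y] y by simp
    also have "\<dots> = (\<integral>\<^sup>+x. indicator X (m x y) \<partial>N)"
      using my by (subst nn_integral_distr) auto
    finally show "(\<integral>\<^sup>+x. indicator X (m x y) \<partial>N) = emeasure N X" ..
  qed
  also have "\<dots> = emeasure N X"
    by (simp add: M.emeasure_space_1[simplified])
  finally show "emeasure M X = emeasure N X" .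
qed

text \<open>If \<open>N\<close> is right-invariant, its image under the inversion \<open>i\<close> is left-invariant,
  hence equal to \<open>N\<close>.\<close>

lemma haar_measure_eqI:
  assumes "prob_space N" and sN: "sets N = sets (restrict_space borel K)"
    and m: "(\<lambda>(x, y). m x y) \<in> restrict_space borel K \<Otimes>\<^sub>M restrict_space borel K \<rightarrow>\<^sub>M restrict_space borel K"
    and i: "i \<in> restrict_space borel K \<rightarrow>\<^sub>M restrict_space borel K"
    and inv: "\<And>k x. k \<in> K \<Longrightarrow> x \<in> K \<Longrightarrow> m k (i x) = i (m x (i k))"
    and ii: "\<And>x. x \<in> K \<Longrightarrow> i (i x) = x"
    and right: "\<And>k. k \<in> K \<Longrightarrow> distr N N (\<lambda>x. m x k) = N"
  shows "haar_measure m K = N"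
proof -
  let ?A = "restrict_space borel K"
  note [measurable_cong] = sN
  note [measurable] = m i
  interpret N: prob_space N by fact
  have [simp]: "space N = K" using sets_eq_imp_space_eq[OF sN] by (simp add: space_restrict_space)
  have iN [measurable]: "i \<in> N \<rightarrow>\<^sub>M N" using i by measurable
  have spA: "space ?A = K" by (simp add: space_restrict_space)
  have mm: "(\<lambda>y. m x y) \<in> ?A \<rightarrow>\<^sub>M ?A" "(\<lambda>y. m y x) \<in> ?A \<rightarrow>\<^sub>M ?A" if "x \<in> K" for x
    using measurable_compose[OF measurable_Pair1' m] measurable_compose[OF measurable_Pair2' m] that 
    by (simp_all add: spA)
  have iK: "i k \<in> K" if "k \<in> K" for k
    using measurable_space[OF i] that by (simp add: spA)
  define N' where "N' = distr N N i"
  have N': "prob_space N'" "sets N' = sets ?A"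
    unfolding N'_def using N.prob_space_distr[OF iN] sN by auto
  have left': "distr N' N' (m k) = N'" if k: "k \<in> K" for k
  proof -
    have 1: "m k \<in> N \<rightarrow>\<^sub>M N" using mm(1)[OF k] by measurable
    have 2: "(\<lambda>x. m x (i k)) \<in> N \<rightarrow>\<^sub>M N" using mm(2)[OF iK[OF k]] by measurable
    have "distr N' N' (m k) = distr N' N (m k)"
      by (rule distr_cong) (auto simp: N'_def)
    also have "\<dots> = distr N N (m k \<circ> i)"
      unfolding N'_def using 1 iN by (subst distr_distr) auto
    also have "\<dots> = distr N N (i \<circ> (\<lambda>x. m x (i k)))"
      by (rule distr_cong) (simp_all only: comp_apply \<open>space N = K\<close> inv[OF k])
    also have "\<dots> = distr (distr N N (\<lambda>x. m x (i k))) N i"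
      using 2 iN by (subst distr_distr) auto
    also have "\<dots> = N'" unfolding right[OF iK[OF k]] N'_def ..
    finally show ?thesis .
  qed
  have "N' = N"
    by (rule haar_measure_unique[OF N'(1) assms(1) N'(2) sN m]) (use left' right in \<open>auto simp: spA\<close>)
  then have left: "distr N N (m k) = N" if "k \<in> K" for k
    using left'[OF that] by simp
  show ?thesis
    unfolding haar_measure_def
  proof (rule the_equality)
    fix M assume "prob_space M \<and> sets M = sets ?A \<and> (\<forall>k\<in>K. distr M M (m k) = M)"
    then show "M = N"
      using haar_measure_unique[of M N ?A m] assms(1) sN m right by (auto simp: spA)
  qed (use assms(1) sN left in auto)
qed

section \<open>The Haar measure of the group of signs\<close>

lemma sets_restrict_borel_K_H: "sets (restrict_space borel K_H) = Pow K_H"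
proof
  show "Pow K_H \<subseteq> sets (restrict_space borel K_H)"
  proof
    fix X assume "X \<in> Pow K_H"
    then have "finite X" "X \<subseteq> K_H" by (auto simp: K_H_def intro: finite_subset)
    moreover have "K_H \<inter> X = X" using \<open>X \<subseteq> K_H\<close> by blast
    ultimately show "X \<in> sets (restrict_space borel K_H)"
      using finite_imp_closed[of X] unfolding sets_restrict_space by (metis borel_closed image_eqI)
  qed
qed (auto simp: sets_restrict_space)

lemma distr_uniform_count_measure_K_H:
  assumes "k \<in> K_H"
  shows "distr (uniform_count_measure K_H) (uniform_count_measure K_H) (\<lambda>x. x * k) = uniform_count_measure K_H"
    (is "distr ?E ?E _ = _")
proof (rule measure_eqI)
  have k: "x * k \<in> K_H \<longleftrightarrow> x \<in> K_H" for x
    using assms by (auto simp: K_H_def)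
  have [measurable]: "(\<lambda>x. x * k) \<in> ?E \<rightarrow>\<^sub>M ?E"
    by (auto simp: measurable_def sets_uniform_count_measure space_uniform_count_measure k)
  fix X assume "X \<in> sets (distr ?E ?E (\<lambda>x. x * k))"
  then have X: "X \<subseteq> K_H" by (simp add: sets_uniform_count_measure)
  have kk: "x * k * k = x" for x using assms by (auto simp: K_H_def)
  have "(\<lambda>x. x * k) -` X \<inter> K_H = (\<lambda>x. x * k) ` X"
    using X k kk by (auto simp: image_iff) (metis kk)+
  moreover have "card ((\<lambda>x. x * k) ` X) = card X"
    by (rule card_image) (metis inj_onI kk)
  moreover have "(\<lambda>x. x * k) ` X \<subseteq> K_H" using X k by auto
  moreover have "finite K_H" by (simp add: K_H_def)
  ultimately show "emeasure (distr ?E ?E (\<lambda>x. x * k)) X = emeasure ?E X"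
    using X by (subst emeasure_distr)
      (auto simp: sets_uniform_count_measure space_uniform_count_measure emeasure_uniform_count_measure)
qed simp

text \<open>Every sign is its own inverse, so the identity can play the role of the
  inversion.\<close>

lemma haar_measure_K_H: "haar_measure (*) K_H = uniform_count_measure K_H"
proof (rule haar_measure_eqI[where i="\<lambda>x. x"])
  have fin: "finite K_H" "K_H \<noteq> {}" by (auto simp: K_H_def)
  show "prob_space (uniform_count_measure K_H)"
    using fin by (rule prob_space_uniform_count_measure)
  show "sets (uniform_count_measure K_H) = sets (restrict_space borel K_H)"
    by (simp add: sets_restrict_borel_K_H sets_uniform_count_measure)
  show "(\<lambda>(x, y). x * y) \<in> restrict_space borel K_H \<Otimes>\<^sub>M restrict_space borel K_H \<rightarrow>\<^sub>M restrict_space borel K_H"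
  proof (rule measurable_restrict_space2)
    show "(\<lambda>(x, y). x * y) \<in> space (restrict_space borel K_H \<Otimes>\<^sub>M restrict_space borel K_H) \<rightarrow> K_H"
      by (auto simp: space_pair_measure space_restrict_space K_H_def)
    have "(\<lambda>x::real. x) \<in> restrict_space borel K_H \<rightarrow>\<^sub>M borel"
      by (intro measurable_restrict_space1) auto
    note [measurable] = measurable_compose[OF measurable_fst this] measurable_compose[OF measurable_snd this]
    show "(\<lambda>(x, y). x * y) \<in> restrict_space borel K_H \<Otimes>\<^sub>M restrict_space borel K_H \<rightarrow>\<^sub>M borel"
      by measurable
  qed
  fix k assume "k \<in> K_H"
  then show "distr (uniform_count_measure K_H) (uniform_count_measure K_H) (\<lambda>x. x * k) = uniform_count_measure K_H"
    by (rule distr_uniform_count_measure_K_H)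
qed (auto simp: K_H_def uniform_count_measure_def measurable_def sets_restrict_borel_K_H[unfolded K_H_def])

section \<open>Two-by-two matrices and the group O(2)\<close>

lemma mat22_nth [simp]:
  "mat22 a b c d $ 1 $ 1 = a" "mat22 a b c d $ 1 $ 2 = b"
  "mat22 a b c d $ 2 $ 1 = c" "mat22 a b c d $ 2 $ 2 = d"
  by (simp_all add: mat22_def)

lemma mat22_eq_iff: "g = mat22 a b c d \<longleftrightarrow> g $ 1 $ 1 = a \<and> g $ 1 $ 2 = b \<and> g $ 2 $ 1 = c \<and> g $ 2 $ 2 = d"
  by (auto simp: vec_eq_iff forall_2)

lemma mat22_eta: "mat22 (g $ 1 $ 1) (g $ 1 $ 2) (g $ 2 $ 1) (g $ 2 $ 2) = g"
  by (metis mat22_eq_iff)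

lemma mat22_mult:
  "mat22 a b c d ** mat22 a' b' c' d' = mat22 (a*a' + b*c') (a*b' + b*d') (c*a' + d*c') (c*b' + d*d')"
  unfolding mat22_eq_iff by (simp add: matrix_matrix_mult_def sum_2)

lemma mat22_transpose: "transpose (mat22 a b c d) = mat22 a c b d"
  unfolding mat22_eq_iff by (simp add: transpose_def)

lemma mat_eq_mat22: "mat r = mat22 r 0 0 r"
  unfolding mat22_eq_iff by (simp add: mat_def)

lemma det_mat22: "det (mat22 a b c d) = a * d - b * c"
  by (simp add: det_2)

lemma mat22_eq_mat22_iff [simp]: "mat22 a b c d = mat22 a' b' c' d' \<longleftrightarrow> a = a' \<and> b = b' \<and> c = c' \<and> d = d'"
  by (simp add: mat22_eq_iff)

lemma mat22_in_O2_iff: "mat22 a b c d \<in> O2 \<longleftrightarrow> a\<^sup>2 + c\<^sup>2 = 1 \<and> b\<^sup>2 + d\<^sup>2 = 1 \<and> a * b + c * d = 0"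
proof -
  have "mat22 a b c d \<in> O2 \<longleftrightarrow> a * a + c * c = 1 \<and> a * b + c * d = 0 \<and> b * a + d * c = 0 \<and> b * b + d * d = 1"
    unfolding O2_def mem_Collect_eq orthogonal_matrix mat22_transpose mat22_mult mat_eq_mat22 mat22_eq_mat22_iff ..
  then show ?thesis unfolding power2_eq_square mult.commute[of b a] mult.commute[of d c] by blast
qed

text \<open>A unit vector orthogonal to the first column is its rotation by a right angle up to
  sign, and that sign is the determinant. Both components of O(2) are thus treated at once.\<close>

lemma O2_cases:
  assumes "k \<in> O2"
  obtains a c e where "k = mat22 a (- e * c) c (e * a)" "a\<^sup>2 + c\<^sup>2 = 1" "e \<in> K_H" "det k = e"
proof -
  obtain a b c d where k: "k = mat22 a b c d" by (metis mat22_eta)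
  have 1: "a\<^sup>2 + c\<^sup>2 = 1" "b\<^sup>2 + d\<^sup>2 = 1" "a * b + c * d = 0" using assms unfolding k mat22_in_O2_iff by auto
  define e where "e = a * d - b * c"
  have "e = 1 \<or> e = -1"
    using det_orthogonal_matrix[of k] assms by (simp add: O2_def k det_mat22 e_def)
  moreover have "d = e * a"
  proof -
    have "d = d * (a\<^sup>2 + c\<^sup>2) - c * (a * b + c * d)" using 1 by simp
    also have "\<dots> = e * a" by (simp add: e_def power2_eq_square algebra_simps)
    finally show ?thesis .
  qed
  moreover have "b = - e * c"
  proof -
    have "b = b * (a\<^sup>2 + c\<^sup>2) - a * (a * b + c * d)" using 1 by simp
    also have "\<dots> = - e * c" by (simp add: e_def power2_eq_square algebra_simps)
    finally show ?thesis .
  qed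
  moreover have "det k = e" by (simp add: k det_mat22 e_def)
  ultimately show thesis
    using that[of a e c] 1(1) k by (auto simp: K_H_def)
qed

lemma continuous_on_matrix_mult [continuous_intros]:
  fixes f :: "'a::topological_space \<Rightarrow> real ^ 'n ^ 'm" and g :: "'a \<Rightarrow> real ^ 'p ^ 'n"
  assumes "continuous_on S f" "continuous_on S g"
  shows "continuous_on S (\<lambda>x. f x ** g x)"
  unfolding matrix_matrix_mult_def by (intro continuous_intros assms)

lemma continuous_on_transpose [continuous_intros]:
  fixes f :: "'a::topological_space \<Rightarrow> real ^ 'n ^ 'm"
  assumes "continuous_on S f"
  shows "continuous_on S (\<lambda>x. transpose (f x))"
  unfolding transpose_def by (intro continuous_intros assms)

lemma borel_measurable_mat22 [measurable]:
  assumes [measurable]: "a \<in> borel_measurable M" "b \<in> borel_measurable M" "c \<in> borel_measurable M" "d \<in> borel_measurable M"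
  shows "(\<lambda>x. mat22 (a x) (b x) (c x) (d x)) \<in> borel_measurable M"
proof -
  have "mat22 a b c d = a *\<^sub>R mat22 1 0 0 0 + b *\<^sub>R mat22 0 1 0 0 + c *\<^sub>R mat22 0 0 1 0 + d *\<^sub>R mat22 0 0 0 1" for a b c d
    by (rule sym) (simp add: mat22_eq_iff)
  note eq = this
  show ?thesis by (subst eq) measurable
qed

lemma borel_measurable_vec_nth [measurable]:
  fixes f :: "'a \<Rightarrow> 'b::real_normed_vector ^ 'n"
  assumes "f \<in> borel_measurable M"
  shows "(\<lambda>x. f x $ i) \<in> borel_measurable M"
proof -
  have "(\<lambda>x::'b ^ 'n. x $ i) \<in> borel \<rightarrow>\<^sub>M borel"
    by (intro borel_measurable_continuous_onI continuous_intros)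
  from measurable_compose[OF assms this] show ?thesis .
qed

lemma measurable_O2_matrix_mult:
  "(\<lambda>(x, y). x ** y) \<in> restrict_space borel O2 \<Otimes>\<^sub>M restrict_space borel O2 \<rightarrow>\<^sub>M restrict_space borel O2"
proof (rule measurable_restrict_space2)
  show "(\<lambda>(x, y). x ** y) \<in> space (restrict_space borel O2 \<Otimes>\<^sub>M restrict_space borel O2) \<rightarrow> O2"
    by (auto simp: space_pair_measure space_restrict_space O2_def intro: orthogonal_matrix_mul)
  have 1: "(\<lambda>x::real^2^2. x) \<in> restrict_space borel O2 \<rightarrow>\<^sub>M borel"
    by (intro measurable_restrict_space1) auto
  have "(\<lambda>p. (fst p, snd p)) \<in> restrict_space borel O2 \<Otimes>\<^sub>M restrict_space borel O2 \<rightarrow>\<^sub>M (borel :: (real^2^2) measure) \<Otimes>\<^sub>M (borel :: (real^2^2) measure)"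
    using measurable_compose[OF measurable_fst 1] measurable_compose[OF measurable_snd 1]
    by (rule measurable_Pair)
  moreover have "(\<lambda>(x::real^2^2, y::real^2^2). x ** y) \<in> borel \<Otimes>\<^sub>M borel \<rightarrow>\<^sub>M borel"
    unfolding borel_prod case_prod_beta by (intro borel_measurable_continuous_onI continuous_intros)
  ultimately show "(\<lambda>(x::real^2^2, y). x ** y) \<in> restrict_space borel O2 \<Otimes>\<^sub>M restrict_space borel O2 \<rightarrow>\<^sub>M borel"
    by (auto dest: measurable_compose)
qed

lemma measurable_O2_transpose: "transpose \<in> restrict_space borel O2 \<rightarrow>\<^sub>M restrict_space borel O2"
proof (rule measurable_restrict_space2)
  show "transpose \<in> space (restrict_space borel O2) \<rightarrow> O2"
    by (auto simp: space_restrict_space O2_def)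
  show "transpose \<in> restrict_space borel O2 \<rightarrow>\<^sub>M borel"
    by (intro measurable_restrict_space1 borel_measurable_continuous_onI continuous_intros)
qed

section \<open>Lebesgue and Gaussian measure on the plane\<close>

lemma measurable_vector2: "(\<lambda>(x, y). vector [x, y] :: real ^ 2) \<in> lborel \<Otimes>\<^sub>M lborel \<rightarrow>\<^sub>M borel"
proof -
  have eq: "vector [x, y] = x *\<^sub>R axis 1 1 + y *\<^sub>R (axis 2 1 :: real ^ 2)" for x y :: real
    by (simp add: vec_eq_iff forall_2 axis_def)
  show ?thesis unfolding eq by measurable
qed

text \<open>Matrices act on \<open>real ^ 2\<close>, iterated integrals live on the product;
  Lebesgue measure is determined by its values on boxes, where the two agree.\<close>

lemma distr_lborel_pair_vector:
  "distr (lborel \<Otimes>\<^sub>M lborel) borel (\<lambda>(x, y). vector [x, y] :: real ^ 2) = lborel"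
proof (rule lborel_eqI[symmetric])
  note [measurable] = measurable_vector2
  fix l u :: "real ^ 2" assume lu: "\<And>b. b \<in> Basis \<Longrightarrow> l \<bullet> b \<le> u \<bullet> b"
  have lui: "l $ i \<le> u $ i" for i
    using lu[of "axis i 1"] by (simp add: inner_axis)
  have "(\<lambda>(x, y). vector [x, y] :: real ^ 2) -` box l u \<inter> space (lborel \<Otimes>\<^sub>M lborel) = {l $ 1<..<u $ 1} \<times> {l $ 2<..<u $ 2}"
    by (auto simp: mem_box_cart forall_2 space_pair_measure)
  then have "emeasure (distr (lborel \<Otimes>\<^sub>M lborel) borel (\<lambda>(x, y). vector [x, y])) (box l u)
      = emeasure (lborel \<Otimes>\<^sub>M lborel) ({l $ 1<..<u $ 1} \<times> {l $ 2<..<u $ 2})"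
    by (subst emeasure_distr) auto
  also have "\<dots> = ennreal (u $ 1 - l $ 1) * ennreal (u $ 2 - l $ 2)"
    using lui by (subst lborel.emeasure_pair_measure_Times) auto
  also have "\<dots> = ennreal (\<Prod>b\<in>Basis. (u - l) \<bullet> b)"
  proof -
    have B: "(Basis :: (real ^ 2) set) = {axis 1 1, axis 2 1}"
      unfolding Basis_vec_def by (auto simp: UNIV_2)
    have "axis 1 1 \<noteq> (axis 2 1 :: real ^ 2)" by (simp add: axis_eq_axis)
    then show ?thesis using lui unfolding B by (simp add: inner_axis ennreal_mult)
  qed
  finally show "emeasure (distr (lborel \<Otimes>\<^sub>M lborel) borel (\<lambda>(x, y). vector [x, y])) (box l u) = \<dots>" .
qed simp

text \<open>The preimage of a box under \<open>Q\<close> is its image under the inverse matrix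
  \<open>transpose Q\<close>, and orthogonal images preserve volume.\<close>

lemma distr_lborel_orthogonal:
  fixes Q :: "real ^ 'n::{finite,wellorder} ^ 'n::_"
  assumes "orthogonal_matrix Q"
  shows "distr lborel borel ((*v) Q) = lborel"
proof (rule lborel_eqI[symmetric])
  have Q: "transpose Q ** Q = mat 1" "Q ** transpose Q = mat 1"
    using assms by (auto simp: orthogonal_matrix_def)
  have T: "orthogonal_transformation ((*v) (transpose Q))"
    using assms orthogonal_transformation_matrix[of "(*v) (transpose Q)"] by (simp add: matrix_of_matrix_vector_mul)
  have [measurable]: "(*v) Q \<in> borel_measurable borel"
    by (intro borel_measurable_continuous_onI linear_continuous_on) (simp add: linear_conv_bounded_linear[symmetric])
  fix l u :: "real ^ 'n::_" assume lu: "\<And>b. b \<in> Basis \<Longrightarrow> l \<bullet> b \<le> u \<bullet> b"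
  have vi: "(*v) Q -` box l u = (*v) (transpose Q) ` box l u"
  proof safe
    fix x assume "Q *v x \<in> box l u"
    moreover have "x = transpose Q *v (Q *v x)" by (simp add: matrix_vector_mul_assoc Q)
    ultimately show "x \<in> (*v) (transpose Q) ` box l u" by blast
  qed (simp add: matrix_vector_mul_assoc Q del: transpose_matrix_vector)
  have bx: "box l u \<in> lmeasurable" by simp
  have "emeasure (distr lborel borel ((*v) Q)) (box l u) = emeasure lborel ((*v) Q -` box l u)"
    by (subst emeasure_distr) auto
  also have "\<dots> = emeasure lebesgue ((*v) (transpose Q) ` box l u)"
    unfolding vi[symmetric] using measurable_sets[of "(*v) Q" borel borel "box l u"] by simp
  also have "\<dots> = emeasure lebesgue (box l u)"
    using measurable_orthogonal_image[OF T bx] measure_orthogonal_image[OF T bx] bx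
    by (simp only: emeasure_eq_measure2)
  also have "\<dots> = ennreal (\<Prod>b\<in>Basis. (u - l) \<bullet> b)"
    using lu by (simp add: emeasure_lborel_box)
  finally show "emeasure (distr lborel borel ((*v) Q)) (box l u) = ennreal (\<Prod>b\<in>Basis. (u - l) \<bullet> b)" .
qed simp

text \<open>Each coordinate has variance 1/2, so the exponent is exactly minus the squared norm;
  1/pi gives total mass 1 and ends up as the 1/pi in \<open>model_period\<close>.\<close>

definition gauss2 :: "(real ^ 2) measure" where
  "gauss2 = density lborel (\<lambda>v. ennreal (exp (- (norm v)\<^sup>2) / pi))"

text \<open>The orthogonal matrix with determinant \<open>e\<close> and second row \<open>v / norm v\<close>. Right
  multiplication by \<open>k\<close> turns \<open>v\<close> into \<open>transpose k *v v\<close>, which preserves the Gaussian measure.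
  The value at \<open>v = 0\<close> only keeps the function inside \<open>O2\<close>.\<close>

definition O2_of :: "real \<times> (real ^ 2) \<Rightarrow> real ^ 2 ^ 2" where
  "O2_of = (\<lambda>(e, v). if v = 0 then mat 1 else
     mat22 (e * v $ 2 / norm v) (- e * v $ 1 / norm v) (v $ 1 / norm v) (v $ 2 / norm v))"

lemma sets_gauss2 [simp, measurable_cong]: "sets gauss2 = sets borel"
  by (simp add: gauss2_def)

lemma space_gauss2 [simp]: "space gauss2 = UNIV"
  by (simp add: gauss2_def)

lemma norm_vec2: "(norm (v :: real ^ 2))\<^sup>2 = (v $ 1)\<^sup>2 + (v $ 2)\<^sup>2"
  by (simp add: norm_vec_def L2_set_def sum_2)

lemma nn_integral_gaussian:
  assumes "c > 0"
  shows "(\<integral>\<^sup>+x. ennreal (exp (- c * x\<^sup>2)) \<partial>lborel) = ennreal (sqrt (pi / c))"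
proof -
  \<comment> \<open>The standard deviation for which the normal density is proportional to exp(-c
    x^2).\<close>
  let ?s = "sqrt (1 / (2 * c))"
  have s: "?s > 0" using assms by simp
  have eq: "exp (- c * x\<^sup>2) = sqrt (pi / c) * normal_density 0 ?s x" for x
  proof -
    have s2: "?s\<^sup>2 = 1 / (2 * c)" using assms by simp
    have "sqrt (pi / c) / sqrt (2 * pi * (1 / (2 * c))) = 1" using assms by simp
    then show ?thesis unfolding normal_density_def s2 using assms by simp
  qed
  have "(\<integral>\<^sup>+x. ennreal (exp (- c * x\<^sup>2)) \<partial>lborel) = ennreal (sqrt (pi / c)) * (\<integral>\<^sup>+x. ennreal (normal_density 0 ?s x) \<partial>lborel)"
    unfolding eq using assms by (subst nn_integral_cmult[symmetric]) (auto simp: ennreal_mult)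
  also have "(\<integral>\<^sup>+x. ennreal (normal_density 0 ?s x) \<partial>lborel) = 1"
    using prob_space.emeasure_space_1[OF prob_space_normal_density[OF s, of 0]]
    by (subst (asm) emeasure_density) auto
  finally show ?thesis by simp
qed

lemma prob_space_gauss2: "prob_space gauss2"
proof
  have eq: "ennreal (exp (- (norm (vector [x, y] :: real ^ 2))\<^sup>2) / pi) = ennreal (exp (- x\<^sup>2)) * (ennreal (exp (- y\<^sup>2)) * ennreal (1 / pi))" for x y
    by (simp add: norm_vec2 exp_add[symmetric] flip: ennreal_mult)
  have m: "(\<lambda>(x, y). vector [x, y] :: real ^ 2) \<in> lborel \<Otimes>\<^sub>M lborel \<rightarrow>\<^sub>M borel"
    by (rule measurable_vector2)
  have "emeasure gauss2 (space gauss2) = (\<integral>\<^sup>+v. ennreal (exp (- (norm v)\<^sup>2) / pi) \<partial>distr (lborel \<Otimes>\<^sub>M lborel) borel (\<lambda>(x, y). vector [x, y] :: real ^ 2))"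
    unfolding distr_lborel_pair_vector by (simp add: gauss2_def emeasure_density)
  also have "\<dots> = (\<integral>\<^sup>+p. ennreal (exp (- (norm (vector [fst p, snd p] :: real ^ 2))\<^sup>2) / pi) \<partial>(lborel \<Otimes>\<^sub>M lborel))"
    using m by (subst nn_integral_distr) (auto simp: case_prod_beta)
  also have "\<dots> = (\<integral>\<^sup>+x. (\<integral>\<^sup>+y. ennreal (exp (- x\<^sup>2)) * (ennreal (exp (- y\<^sup>2)) * ennreal (1 / pi)) \<partial>lborel) \<partial>lborel)"
    unfolding eq by (subst lborel.nn_integral_fst[symmetric]) auto
  also have "\<dots> = 1"
  proof -
    have g: "(\<integral>\<^sup>+x. ennreal (exp (- x\<^sup>2)) \<partial>lborel) = ennreal (sqrt pi)"
      using nn_integral_gaussian[of 1] by simp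
    have "(\<integral>\<^sup>+x. (\<integral>\<^sup>+y. ennreal (exp (- x\<^sup>2)) * (ennreal (exp (- y\<^sup>2)) * ennreal (1 / pi)) \<partial>lborel) \<partial>lborel)
      = ennreal (sqrt pi) * (ennreal (sqrt pi) * ennreal (1 / pi))"
      by (subst nn_integral_cmult, measurable, subst nn_integral_multc, measurable, subst nn_integral_multc, measurable)
        (simp only: g)
    also have "\<dots> = 1" by (simp flip: ennreal_mult)
    finally show ?thesis .
  qed
  finally show "emeasure gauss2 (space gauss2) = 1" .
qed

lemma distr_gauss2_orthogonal:
  assumes "orthogonal_matrix Q"
  shows "distr gauss2 gauss2 ((*v) Q) = gauss2"
proof (rule measure_eqI)
  have [measurable]: "(*v) Q \<in> borel_measurable borel"
    by (intro borel_measurable_continuous_onI linear_continuous_on) (simp add: linear_conv_bounded_linear[symmetric])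
  have T: "orthogonal_transformation ((*v) Q)"
    using assms orthogonal_transformation_matrix[of "(*v) Q"] by (simp add: matrix_of_matrix_vector_mul)
  fix X assume "X \<in> sets (distr gauss2 gauss2 ((*v) Q))"
  then have [measurable]: "X \<in> sets borel" by simp
  have "emeasure gauss2 X = (\<integral>\<^sup>+v. ennreal (exp (- (norm v)\<^sup>2) / pi) * indicator X v \<partial>distr lborel borel ((*v) Q))"
    unfolding distr_lborel_orthogonal[OF assms] by (simp add: gauss2_def emeasure_density)
  also have "\<dots> = (\<integral>\<^sup>+v. ennreal (exp (- (norm v)\<^sup>2) / pi) * indicator ((*v) Q -` X) v \<partial>lborel)"
    using orthogonal_transformation_norm[OF T]
    by (subst nn_integral_distr) (auto simp: indicator_def intro!: nn_integral_cong)
  also have "\<dots> = emeasure gauss2 ((*v) Q -` X)"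
    using measurable_sets[of "(*v) Q" borel borel X] by (simp add: gauss2_def emeasure_density)
  also have "\<dots> = emeasure (distr gauss2 gauss2 ((*v) Q)) X"
    by (subst emeasure_distr) auto
  finally show "emeasure (distr gauss2 gauss2 ((*v) Q)) X = emeasure gauss2 X" ..
qed simp

lemma AE_gauss2_nonzero: "AE v in gauss2. v \<noteq> 0"
  unfolding gauss2_def using AE_lborel_singleton[of "0 :: real ^ 2"] by (subst AE_density) auto

lemma O2_of_in_O2: "e \<in> K_H \<Longrightarrow> O2_of (e, v) \<in> O2"
proof -
  assume "e \<in> K_H"
  then have e: "e\<^sup>2 = 1" "e * e = 1" by (auto simp: K_H_def)
  have "v \<noteq> 0 \<Longrightarrow> (v $ 1 / norm v)\<^sup>2 + (v $ 2 / norm v)\<^sup>2 = 1"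
    by (simp add: power_divide flip: add_divide_distrib norm_vec2)
  then show ?thesis using e
    by (auto simp: O2_of_def mat_eq_mat22 mat22_in_O2_iff power_mult_distrib power_divide algebra_simps)
qed

lemma measurable_O2_of:
  "O2_of \<in> uniform_count_measure K_H \<Otimes>\<^sub>M gauss2 \<rightarrow>\<^sub>M restrict_space borel O2"
proof (rule measurable_restrict_space2)
  show "O2_of \<in> space (uniform_count_measure K_H \<Otimes>\<^sub>M gauss2) \<rightarrow> O2"
    by (auto simp: space_pair_measure space_uniform_count_measure O2_of_in_O2)
  have "(\<lambda>e::real. e) \<in> uniform_count_measure K_H \<rightarrow>\<^sub>M borel"
    by (simp add: measurable_def sets_uniform_count_measure space_uniform_count_measure)
  note [measurable] = measurable_compose[OF measurable_fst this]
  have [measurable]: "snd \<in> uniform_count_measure K_H \<Otimes>\<^sub>M gauss2 \<rightarrow>\<^sub>M borel"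
    using measurable_snd[of "uniform_count_measure K_H" gauss2] by (simp add: measurable_cong_sets[OF refl sets_gauss2])
  have [measurable]: "(\<lambda>p. norm (snd p)) \<in> borel_measurable (uniform_count_measure K_H \<Otimes>\<^sub>M gauss2)"
    by measurable
  have [measurable]: "Measurable.pred (uniform_count_measure K_H \<Otimes>\<^sub>M gauss2) (\<lambda>p. snd p = 0)"
    by measurable
  show "O2_of \<in> uniform_count_measure K_H \<Otimes>\<^sub>M gauss2 \<rightarrow>\<^sub>M borel"
    unfolding O2_of_def case_prod_beta by measurable
qed

text \<open>The sign is the determinant, so uniform signs give the two components of O(2) equal
  weight; within a component the direction of the Gaussian vector is uniform.\<close>

definition O2_haar :: "(real ^ 2 ^ 2) measure" where
  "O2_haar = distr (uniform_count_measure K_H \<Otimes>\<^sub>M gauss2) (restrict_space borel O2) O2_of"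

lemma O2_of_mult:
  assumes "k \<in> O2" "v \<noteq> 0"
  shows "O2_of (e, v) ** k = O2_of (e * det k, transpose k *v v)"
proof -
  obtain a c d where k: "k = mat22 a (- d * c) c (d * a)" "a\<^sup>2 + c\<^sup>2 = 1" "d \<in> K_H" "det k = d"
    using O2_cases[OF assms(1)] by blast
  have tr: "transpose k = mat22 a c (- d * c) (d * a)" by (simp add: k(1) mat22_transpose)
  have w: "(transpose k *v v) $ 1 = a * v $ 1 + c * v $ 2" "(transpose k *v v) $ 2 = - d * c * v $ 1 + d * a * v $ 2"
    unfolding tr by (simp_all add: matrix_vector_mult_def sum_2 del: transpose_matrix_vector)
  have "orthogonal_matrix (transpose k)" using assms(1) by (simp add: O2_def)
  then have "orthogonal_transformation ((*v) (transpose k))"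
    using orthogonal_transformation_matrix[of "(*v) (transpose k)"] by (simp add: matrix_of_matrix_vector_mul del: transpose_matrix_vector)
  then have n: "norm (transpose k *v v) = norm v" by (rule orthogonal_transformation_norm)
  then have nz: "transpose k *v v \<noteq> 0" using assms(2) by (metis norm_eq_zero)
  have d: "d * d = 1" using k(3) by (auto simp: K_H_def)
  have d': "d * (d * x) = x" for x using d by (simp flip: mult.assoc)
  have "O2_of (e * det k, transpose k *v v) = mat22 (e * d * (- d * c * v $ 1 + d * a * v $ 2) / norm v)
     (- (e * d) * (a * v $ 1 + c * v $ 2) / norm v) ((a * v $ 1 + c * v $ 2) / norm v) ((- d * c * v $ 1 + d * a * v $ 2) / norm v)"
    unfolding O2_of_def case_prod_conv if_not_P[OF nz] w n k(4) ..
  also have "\<dots> = mat22 (e * v $ 2 / norm v) (- e * v $ 1 / norm v) (v $ 1 / norm v) (v $ 2 / norm v) ** mat22 a (- d * c) c (d * a)"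
    unfolding mat22_mult mat22_eq_mat22_iff using assms(2) by (simp add: field_simps d')
  also have "\<dots> = O2_of (e, v) ** k"
    unfolding O2_of_def case_prod_conv if_not_P[OF assms(2)] k(1) ..
  finally show ?thesis ..
qed

lemma prob_space_K_H: "prob_space (uniform_count_measure K_H)"
  by (rule prob_space_uniform_count_measure) (auto simp: K_H_def)

lemma haar_measure_O2: "haar_measure (**) O2 = O2_haar"
proof (rule haar_measure_eqI[where i=transpose])
  let ?E = "uniform_count_measure K_H" and ?A = "restrict_space borel O2"
  let ?P = "?E \<Otimes>\<^sub>M gauss2"
  interpret E: prob_space ?E by (rule prob_space_K_H)
  interpret G: prob_space gauss2 by (rule prob_space_gauss2)
  interpret P: pair_prob_space ?E gauss2 ..
  note [measurable] = measurable_O2_of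
  show "prob_space O2_haar" unfolding O2_haar_def by (rule P.prob_space_distr) measurable
  show "sets O2_haar = sets ?A" by (simp add: O2_haar_def)
  show "(\<lambda>(x, y). x ** y) \<in> ?A \<Otimes>\<^sub>M ?A \<rightarrow>\<^sub>M ?A" by (rule measurable_O2_matrix_mult)
  show "transpose \<in> ?A \<rightarrow>\<^sub>M ?A" by (rule measurable_O2_transpose)
  fix k :: "real ^ 2 ^ 2" assume k: "k \<in> O2"
  show "k ** transpose x = transpose (x ** transpose k)" for x
    by (simp add: matrix_transpose_mul)
  have dk: "det k \<in> K_H" using O2_cases[OF k] by metis
  have mk: "(\<lambda>x. x ** k) \<in> ?A \<rightarrow>\<^sub>M ?A"
    using measurable_compose[OF measurable_Pair2' measurable_O2_matrix_mult, of k] k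
    by (simp add: space_restrict_space)
  have ok: "orthogonal_matrix (transpose k)" using k by (simp add: O2_def)
  define T where "T = (\<lambda>(e, v). (e * det k, transpose k *v v))"
  have m1: "(\<lambda>e. e * det k) \<in> ?E \<rightarrow>\<^sub>M ?E"
    using dk by (auto simp: measurable_def sets_uniform_count_measure space_uniform_count_measure K_H_def)
  have m2: "(*v) (transpose k) \<in> gauss2 \<rightarrow>\<^sub>M gauss2"
    unfolding measurable_cong_sets[OF sets_gauss2 sets_gauss2]
    by (intro borel_measurable_continuous_onI linear_continuous_on) (simp add: linear_conv_bounded_linear[symmetric])
  have mT: "T \<in> ?P \<rightarrow>\<^sub>M ?P"
    unfolding T_def case_prod_beta using m1 m2
    by (intro measurable_Pair measurable_compose[OF measurable_fst m1] measurable_compose[OF measurable_snd m2])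
  \<comment> \<open>\<open>T\<close> acts on the two factors separately: multiplication by a sign
    preserves the counting measure, an orthogonal matrix preserves the Gaussian.\<close>
  have T: "distr ?P ?P T = ?P"
  proof -
    have "distr gauss2 gauss2 ((*v) (transpose k)) = gauss2" by (rule distr_gauss2_orthogonal[OF ok])
    moreover have "distr ?E ?E (\<lambda>e. e * det k) = ?E" by (rule distr_uniform_count_measure_K_H[OF dk])
    ultimately show ?thesis
      using pair_measure_distr[OF m1 m2] G.sigma_finite_measure_axioms unfolding T_def by metis
  qed
  \<comment> \<open>At the default value for \<open>v = 0\<close> this relation can fail, but that
    point is null for the Gaussian.\<close>
  have AE: "AE p in ?P. O2_of p ** k = O2_of (T p)"
  proof -
    have nz: "AE p in ?P. snd p \<noteq> 0"
    proof (rule P.AE_pair_measure)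
      have "{p \<in> space ?P. snd p \<noteq> 0} = space ?E \<times> (- {0})" by (auto simp: space_pair_measure)
      also have "\<dots> \<in> sets ?P" by (intro pair_measureI) auto
      finally show "{p \<in> space ?P. snd p \<noteq> 0} \<in> sets ?P" .
      show "AE x in ?E. AE y in gauss2. snd (x, y) \<noteq> 0" using AE_gauss2_nonzero by simp
    qed
    show ?thesis
      by (rule AE_mp[OF nz], rule AE_I2) (auto simp: T_def O2_of_mult[OF k] simp del: transpose_matrix_vector)
  qed
  have "distr O2_haar O2_haar (\<lambda>x. x ** k) = distr O2_haar ?A (\<lambda>x. x ** k)"
    by (rule distr_cong) (simp_all add: O2_haar_def)
  also have "\<dots> = distr ?P ?A ((\<lambda>x. x ** k) \<circ> O2_of)"
    unfolding O2_haar_def using mk measurable_O2_of by (rule distr_distr)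
  also have "\<dots> = distr ?P ?A (O2_of \<circ> T)"
  proof (rule distr_cong_AE)
    show "AE x in ?P. ((\<lambda>x. x ** k) \<circ> O2_of) x = (O2_of \<circ> T) x" using AE by simp
  qed (use mk mT measurable_O2_of in \<open>auto intro: measurable_comp\<close>)
  also have "\<dots> = distr (distr ?P ?P T) ?A O2_of"
    using measurable_O2_of mT by (rule distr_distr[symmetric])
  also have "\<dots> = O2_haar" unfolding T O2_haar_def ..
  finally show "distr O2_haar O2_haar (\<lambda>x. x ** k) = O2_haar" .
qed simp

section \<open>The Beta integral on the orthogonal group\<close>

text \<open>Sum of the integral over the half-line and its reflection. The value at 0 is lost in
  both halves, so the comparison holds only almost everywhere.\<close>

lemma has_bochner_integral_abs:
  fixes f :: "real \<Rightarrow> 'a::{banach, second_countable_topology}"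
  assumes "has_bochner_integral pos_lborel f I" and [measurable]: "f \<in> borel_measurable borel"
  shows "has_bochner_integral lborel (\<lambda>x. f \<bar>x\<bar>) (2 *\<^sub>R I)"
proof -
  let ?g = "\<lambda>x. indicator {0<..} x *\<^sub>R f x"
  have 1: "has_bochner_integral lborel ?g I"
    using assms(1) by (simp add: has_bochner_integral_iff integrable_restrict_space integral_restrict_space)
  have 2: "has_bochner_integral lborel (\<lambda>x. ?g (0 + (-1) * x)) (I /\<^sub>R \<bar>-1\<bar>)"
    using 1 by (subst lborel_has_bochner_integral_real_affine_iff[symmetric]) auto
  have 3: "has_bochner_integral lborel (\<lambda>x. ?g x + ?g (0 + (-1) * x)) (I + I /\<^sub>R \<bar>-1\<bar>)"
    by (rule has_bochner_integral_add[OF 1 2])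
  have "has_bochner_integral lborel (\<lambda>x. f \<bar>x\<bar>) (I + I /\<^sub>R \<bar>-1\<bar>)"
  proof (rule has_bochner_integralI_AE[OF 3])
    show "AE x in lborel. ?g x + ?g (0 + (-1) * x) = f \<bar>x\<bar>"
      using AE_lborel_singleton[of "0::real"] by eventually_elim (auto simp: indicator_def)
  qed measurable
  then show ?thesis by (simp add: scaleR_2)
qed

text \<open>The factor 2 from the two half-lines cancels the 1/2 produced by
  \<open>p = 2\<close>.\<close>

lemma has_bochner_integral_abs_powr_gaussian:
  assumes "c > 0" "Re z > -1"
  shows "has_bochner_integral lborel (\<lambda>y. of_real \<bar>y\<bar> powr z * of_real (exp (- c * y\<^sup>2)))
    (Gamma ((z + 1) / 2) * of_real c powr (- (z + 1) / 2))"
proof -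
  have "has_bochner_integral pos_lborel (\<lambda>x. of_real x powr (z + 1 - 1) * of_real (exp (- c * x powr 2)))
    (Gamma ((z + 1) / of_real 2) * of_real c powr (- (z + 1) / of_real 2) / of_real \<bar>2\<bar>)"
    using assms by (intro has_bochner_integral_powr_exp) auto
  from has_bochner_integral_abs[OF this] show ?thesis
    by (simp add: scaleR_conv_of_real cong: has_bochner_integral_cong)
qed

lemma has_bochner_integral_abs_powr_gaussian_real:
  fixes c a :: real
  assumes "c > 0" "a > -1"
  shows "has_bochner_integral lborel (\<lambda>y. \<bar>y\<bar> powr a * exp (- c * y\<^sup>2))
    (Gamma ((a + 1) / 2) * c powr (- (a + 1) / 2))"
proof -
  have "has_bochner_integral pos_lborel (\<lambda>x. x powr (a + 1 - 1) * exp (- c * x powr 2))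
    (Gamma ((a + 1) / 2) * c powr (- (a + 1) / 2) / \<bar>2\<bar>)"
    using assms by (intro has_bochner_integral_powr_exp_real) auto
  from has_bochner_integral_abs[OF this] show ?thesis
    by (simp cong: has_bochner_integral_cong)
qed

lemma norm_of_real_powr: "x \<ge> 0 \<Longrightarrow> norm (complex_of_real x powr z) = x powr Re z"
  by (simp add: norm_powr_real_powr)

lemma norm_of_real_powr_le_1:
  assumes "0 \<le> x" "x \<le> 1" "Re z \<ge> 0"
  shows "norm (complex_of_real x powr z) \<le> 1"
  using assms powr_mono2[of "Re z" x 1] by (simp add: norm_of_real_powr)

text \<open>Substitute \<open>x = y * u\<close>. The integral over \<open>u\<close> does not depend on \<open>w\<close>, so that comparing
  \<open>w = 0\<close> with \<open>w = (a + b) / 2\<close> evaluates it.\<close>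

lemma integral_radial:
  fixes a b w :: complex
  assumes a: "Re a \<ge> 0" and b: "Re b \<ge> 0" and w: "Re w \<ge> 0"
  defines "h \<equiv> \<lambda>x y. complex_of_real (\<bar>x\<bar> / sqrt (x\<^sup>2 + y\<^sup>2)) powr a * complex_of_real (\<bar>y\<bar> / sqrt (x\<^sup>2 + y\<^sup>2)) powr b"
  shows "(\<integral>y. (\<integral>x. h x y * of_real (x\<^sup>2 + y\<^sup>2) powr w * of_real (exp (- (x\<^sup>2 + y\<^sup>2))) \<partial>lborel) \<partial>lborel)
    = Gamma (w + 1) * (\<integral>u. h u 1 / of_real (1 + u\<^sup>2) \<partial>lborel)"
proof -
  define F where "F = (\<lambda>u y. of_real \<bar>y\<bar> powr (2 * w + 1) * of_real (exp (- (1 + u\<^sup>2) * y\<^sup>2)) * (h u 1 * of_real (1 + u\<^sup>2) powr w))"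
  have pos: "1 + u\<^sup>2 > 0" for u :: real by (simp add: add_pos_nonneg)
  have hm [measurable]: "(\<lambda>u. h u 1) \<in> borel_measurable borel"
    unfolding h_def by measurable
  have Fm [measurable]: "(\<lambda>(u, y). F u y) \<in> borel_measurable (lborel \<Otimes>\<^sub>M lborel)"
    unfolding F_def h_def by measurable
  have h1: "norm (h u 1) \<le> 1" for u
  proof -
    have le: "\<bar>u\<bar> \<le> sqrt (u\<^sup>2 + 1\<^sup>2)" "\<bar>1\<bar> \<le> sqrt (u\<^sup>2 + 1\<^sup>2)" "0 < sqrt (u\<^sup>2 + 1\<^sup>2)"
      using pos[of u] by (auto intro: real_le_rsqrt simp: add.commute)
    have "\<bar>u\<bar> / sqrt (u\<^sup>2 + 1\<^sup>2) \<le> 1" "\<bar>1\<bar> / sqrt (u\<^sup>2 + 1\<^sup>2) \<le> 1"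
      unfolding divide_le_eq_1_pos[OF le(3)] using le(1,2) .
    then have "norm (complex_of_real (\<bar>u\<bar> / sqrt (u\<^sup>2 + 1\<^sup>2)) powr a) \<le> 1" "norm (complex_of_real (\<bar>1\<bar> / sqrt (u\<^sup>2 + 1\<^sup>2)) powr b) \<le> 1"
      using a b le(3) by (auto intro!: norm_of_real_powr_le_1 simp del: of_real_divide)
    then show ?thesis unfolding h_def norm_mult by (intro mult_le_one) auto
  qed
  have inner: "(\<integral>x. h x y * of_real (x\<^sup>2 + y\<^sup>2) powr w * of_real (exp (- (x\<^sup>2 + y\<^sup>2))) \<partial>lborel) = (\<integral>u. F u y \<partial>lborel)" for y
  proof (cases "y = 0")
    \<comment> \<open>Here both integrands vanish because \<open>0 powr z = 0\<close> for every
      \<open>z\<close>, even for \<open>z = 0\<close>; the line \<open>y = 0\<close> is null, so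
      this convention does not affect the integral.\<close>
    case True
    then show ?thesis by (simp add: h_def F_def)
  next
    case False
    have "\<bar>y\<bar> *\<^sub>R (h (0 + y * u) y * of_real ((0 + y * u)\<^sup>2 + y\<^sup>2) powr w * of_real (exp (- ((0 + y * u)\<^sup>2 + y\<^sup>2)))) = F u y" for u
    proof -
      have r: "(0 + y * u)\<^sup>2 + y\<^sup>2 = \<bar>y\<bar>\<^sup>2 * (1 + u\<^sup>2)" by (simp add: algebra_simps power_mult_distrib)
      have sq: "sqrt ((0 + y * u)\<^sup>2 + y\<^sup>2) = \<bar>y\<bar> * sqrt (u\<^sup>2 + 1\<^sup>2)" unfolding r by (simp add: real_sqrt_mult add.commute)
      have h: "h (0 + y * u) y = h u 1"
        using False unfolding h_def sq by (simp add: abs_mult)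
      have A: "complex_of_real (\<bar>y\<bar>\<^sup>2 * (1 + u\<^sup>2)) powr w = of_real (\<bar>y\<bar>\<^sup>2) powr w * of_real (1 + u\<^sup>2) powr w"
        using pos[of u] by (subst of_real_mult, subst powr_times_real) (auto simp del: of_real_power of_real_add)
      have B: "\<bar>y\<bar> * (of_real (\<bar>y\<bar>\<^sup>2) powr w) = complex_of_real \<bar>y\<bar> powr (2 * w + 1)"
      proof -
        have y: "\<bar>y\<bar> > 0" using False by simp
        have 1: "complex_of_real \<bar>y\<bar> = exp (of_real (ln \<bar>y\<bar>))" using y by (metis exp_of_real exp_ln)
        have "ln (\<bar>y\<bar>\<^sup>2) = 2 * ln \<bar>y\<bar>" using ln_realpow[of "\<bar>y\<bar>" 2] by simp
        then have 2: "of_real (\<bar>y\<bar>\<^sup>2) powr w = exp (w * of_real (2 * ln \<bar>y\<bar>))"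
          using y by (subst of_real_powr_eq_exp) (simp_all only: zero_less_power)
        have 3: "of_real (ln \<bar>y\<bar>) + w * of_real (2 * ln \<bar>y\<bar>) = (2 * w + 1) * complex_of_real (ln \<bar>y\<bar>)"
          by (simp add: algebra_simps)
        show ?thesis
          unfolding of_real_powr_eq_exp[OF y] 2 by (subst 1) (simp only: exp_add[symmetric] 3)
      qed
      have C: "- (\<bar>y\<bar>\<^sup>2 * (1 + u\<^sup>2)) = - (1 + u\<^sup>2) * y\<^sup>2" by (simp add: algebra_simps)
      show ?thesis
        unfolding h r F_def scaleR_conv_of_real A B[symmetric] C by (simp only: mult_ac)
    qed
    then show ?thesis
      by (subst lborel_integral_real_affine[where c=y and t=0]) (use False in \<open>simp_all flip: integral_scaleR_right\<close>)
  qed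
  \<comment> \<open>The Gaussian moment in \<open>y\<close> contributes (1 + u^2)^(-w-1). Against
    the factor (1 + u^2)^w in \<open>F\<close>, all dependence on \<open>w\<close> cancels except
    for Gamma(w+1).\<close>
  have dy: "has_bochner_integral lborel (F u) (Gamma (w + 1) * (h u 1 / of_real (1 + u\<^sup>2)))" for u
  proof -
    have "has_bochner_integral lborel (F u) (Gamma ((2 * w + 1 + 1) / 2) * of_real (1 + u\<^sup>2) powr (- (2 * w + 1 + 1) / 2) * (h u 1 * of_real (1 + u\<^sup>2) powr w))"
      unfolding F_def using w pos[of u]
      by (intro has_bochner_integral_mult_left has_bochner_integral_abs_powr_gaussian) auto
    moreover have "of_real (1 + u\<^sup>2) powr (- (2 * w + 1 + 1) / 2) * of_real (1 + u\<^sup>2) powr w = 1 / complex_of_real (1 + u\<^sup>2)"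
    proof -
      have nz: "complex_of_real (1 + u\<^sup>2) \<noteq> 0" using pos[of u] by (simp only: of_real_eq_0_iff)
      have "- (2 * w + 1 + 1) / 2 + w = - 1" by (simp add: field_simps)
      then have "of_real (1 + u\<^sup>2) powr (- (2 * w + 1 + 1) / 2) * of_real (1 + u\<^sup>2) powr w = complex_of_real (1 + u\<^sup>2) powr (-1)"
        by (metis powr_add)
      also have "\<dots> = 1 / complex_of_real (1 + u\<^sup>2)" using nz by (subst powr_minus) (simp add: divide_inverse powr_to_1 del: of_real_add)
      finally show ?thesis .
    qed
    moreover have "(2 * w + 1 + 1) / 2 = w + 1" by (simp add: field_simps)
    ultimately show ?thesis by (simp only: mult_ac divide_inverse mult_1_left mult_1_right)
  qed
  \<comment> \<open>The same computation at \<open>Re w\<close>; together with the bound 1 on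
    \<open>h u 1\<close> it leaves the integrable majorant 1/(1 + u^2) for Fubini.\<close>
  have dyn: "has_bochner_integral lborel (\<lambda>y. norm (F u y)) (Gamma (Re w + 1) * (norm (h u 1) / (1 + u\<^sup>2)))" for u
  proof -
    have "(\<lambda>y. norm (F u y)) = (\<lambda>y. \<bar>y\<bar> powr (2 * Re w + 1) * exp (- (1 + u\<^sup>2) * y\<^sup>2) * (norm (h u 1) * (1 + u\<^sup>2) powr Re w))"
      unfolding F_def norm_mult using pos[of u] by (subst (1 2) norm_of_real_powr) auto
    moreover have "has_bochner_integral lborel (\<lambda>y. \<bar>y\<bar> powr (2 * Re w + 1) * exp (- (1 + u\<^sup>2) * y\<^sup>2) * (norm (h u 1) * (1 + u\<^sup>2) powr Re w))
      (Gamma ((2 * Re w + 1 + 1) / 2) * (1 + u\<^sup>2) powr (- (2 * Re w + 1 + 1) / 2) * (norm (h u 1) * (1 + u\<^sup>2) powr Re w))"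
      using w pos[of u] by (intro has_bochner_integral_mult_left has_bochner_integral_abs_powr_gaussian_real) auto
    moreover have "(1 + u\<^sup>2) powr (- (2 * Re w + 1 + 1) / 2) * (1 + u\<^sup>2) powr Re w = 1 / (1 + u\<^sup>2)"
      using pos[of u] by (subst powr_add[symmetric]) (simp add: field_simps powr_minus)
    moreover have "(2 * Re w + 1 + 1) / 2 = Re w + 1" by (simp add: field_simps)
    ultimately show ?thesis by (simp only: mult_ac divide_inverse mult_1_left mult_1_right)
  qed
  have int: "integrable (lborel \<Otimes>\<^sub>M lborel) (\<lambda>(u, y). F u y)"
  proof (rule lborel_pair.Fubini_integrable[OF Fm])
    have i: "integrable lborel (\<lambda>u::real. inverse (1 + u\<^sup>2))"
      using integrable_inverse_1_plus_square by (simp add: set_integrable_def)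
    have "integrable lborel (\<lambda>u. Gamma (Re w + 1) * (norm (h u 1) / (1 + u\<^sup>2)))"
    proof (rule Bochner_Integration.integrable_bound[OF integrable_mult_right[OF i, of "Gamma (Re w + 1)"]])
      show "AE u in lborel. norm (Gamma (Re w + 1) * (norm (h u 1) / (1 + u\<^sup>2))) \<le> norm (Gamma (Re w + 1) * inverse (1 + u\<^sup>2))"
      proof (rule AE_I2)
        fix u
        have "norm (h u 1) / (1 + u\<^sup>2) \<le> inverse (1 + u\<^sup>2)"
          using divide_right_mono[OF h1[of u], of "1 + u\<^sup>2"] pos[of u] by (simp add: inverse_eq_divide)
        moreover have "norm (h u 1) / (1 + u\<^sup>2) \<ge> 0" using pos[of u] by simp
        ultimately show "norm (Gamma (Re w + 1) * (norm (h u 1) / (1 + u\<^sup>2))) \<le> norm (Gamma (Re w + 1) * inverse (1 + u\<^sup>2))"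
          unfolding norm_mult by (intro mult_left_mono) auto
      qed
    qed measurable
    then show "integrable lborel (\<lambda>u. \<integral>y. norm (case (u, y) of (u, y) \<Rightarrow> F u y) \<partial>lborel)"
      using dyn by (simp add: has_bochner_integral_iff)
    show "AE u in lborel. integrable lborel (\<lambda>y. case (u, y) of (u, y) \<Rightarrow> F u y)"
      using dy by (simp add: has_bochner_integral_iff)
  qed
  have "(\<integral>y. (\<integral>u. F u y \<partial>lborel) \<partial>lborel) = (\<integral>u. (\<integral>y. F u y \<partial>lborel) \<partial>lborel)"
    by (rule lborel_pair.Fubini_integral[OF int])
  also have "\<dots> = (\<integral>u. Gamma (w + 1) * (h u 1 / of_real (1 + u\<^sup>2)) \<partial>lborel)"
    using dy by (simp add: has_bochner_integral_iff)
  finally show ?thesis unfolding inner by (simp only: integral_mult_right_zero)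
qed

lemma Re_nonpos_Ints: "(z :: complex) \<in> \<int>\<^sub>\<le>\<^sub>0 \<Longrightarrow> Re z \<le> 0"
  by (auto elim!: nonpos_Ints_cases)

text \<open>At \<open>w = (a + b) / 2\<close> the radial power cancels the denominators in
  \<open>h\<close>, and the double integral splits into two one-dimensional Gaussian moments. This
  evaluates the \<open>u\<close>-integral, and \<open>w = 0\<close> then gives the claim.\<close>

lemma gaussian_abs_powr_integral:
  fixes a b :: complex
  assumes a: "Re a \<ge> 0" and b: "Re b \<ge> 0"
  defines "h \<equiv> \<lambda>x y. complex_of_real (\<bar>x\<bar> / sqrt (x\<^sup>2 + y\<^sup>2)) powr a * complex_of_real (\<bar>y\<bar> / sqrt (x\<^sup>2 + y\<^sup>2)) powr b"
  shows "(\<integral>y. (\<integral>x. h x y * of_real (exp (- (x\<^sup>2 + y\<^sup>2))) \<partial>lborel) \<partial>lborel)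
    = Gamma ((a + 1) / 2) * Gamma ((b + 1) / 2) * rGamma ((a + b + 2) / 2)"
proof -
  let ?U = "\<integral>u. h u 1 / of_real (1 + u\<^sup>2) \<partial>lborel"
  have split: "h x y * of_real (x\<^sup>2 + y\<^sup>2) powr ((a + b) / 2) = of_real \<bar>x\<bar> powr a * of_real \<bar>y\<bar> powr b" for x y
  proof (cases "x = 0 \<and> y = 0")
    case False
    then have p: "x\<^sup>2 + y\<^sup>2 > 0" by (simp add: sum_power2_gt_zero_iff)
    let ?r = "sqrt (x\<^sup>2 + y\<^sup>2)"
    have r: "?r > 0" using p by simp
    have "complex_of_real (x\<^sup>2 + y\<^sup>2) powr ((a + b) / 2) = of_real ?r powr a * of_real ?r powr b"
    proof -
      have "complex_of_real (x\<^sup>2 + y\<^sup>2) powr ((a + b) / 2) = exp ((a + b) / 2 * of_real (ln (x\<^sup>2 + y\<^sup>2)))"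
        using p by (rule of_real_powr_eq_exp)
      also have "(a + b) / 2 * of_real (ln (x\<^sup>2 + y\<^sup>2)) = a * of_real (ln ?r) + b * of_real (ln ?r)"
        using p by (simp add: ln_sqrt algebra_simps)
      finally show ?thesis unfolding exp_add of_real_powr_eq_exp[OF r] .
    qed
    moreover have "of_real (t / ?r) powr z * of_real ?r powr z = complex_of_real t powr z" if "t \<ge> 0" for t z
    proof -
      have "complex_of_real t powr z = (of_real (t / ?r) * of_real ?r) powr z"
      proof -
        have "?r \<noteq> 0" using r by linarith
        then have "t / ?r * ?r = t" by (metis nonzero_eq_divide_eq)
        then show ?thesis by (simp only: of_real_mult[symmetric])
      qed
      also have "\<dots> = of_real (t / ?r) powr z * of_real ?r powr z"
        using that r by (intro powr_times_real) auto
      finally show ?thesis ..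
    qed
    ultimately show ?thesis unfolding h_def by (simp add: algebra_simps) 
  qed (simp add: h_def)
  have "(\<integral>y. (\<integral>x. h x y * of_real (x\<^sup>2 + y\<^sup>2) powr ((a + b) / 2) * of_real (exp (- (x\<^sup>2 + y\<^sup>2))) \<partial>lborel) \<partial>lborel)
    = (\<integral>y. (\<integral>x. (of_real \<bar>x\<bar> powr a * of_real (exp (- 1 * x\<^sup>2))) * (of_real \<bar>y\<bar> powr b * of_real (exp (- 1 * y\<^sup>2))) \<partial>lborel) \<partial>lborel)"
    unfolding split by (intro Bochner_Integration.integral_cong refl) (simp add: exp_diff exp_minus field_simps)
  also have "\<dots> = Gamma ((a + 1) / 2) * Gamma ((b + 1) / 2)"
  proof -
    have "has_bochner_integral lborel (\<lambda>y. of_real \<bar>y\<bar> powr z * of_real (exp (- 1 * y\<^sup>2))) (Gamma ((z + 1) / 2))" if "Re z \<ge> 0" for z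
      using has_bochner_integral_abs_powr_gaussian[of 1 z] that by simp
    from this[OF a] this[OF b] show ?thesis by (simp add: has_bochner_integral_iff)
  qed
  finally have K: "Gamma ((a + 1) / 2) * Gamma ((b + 1) / 2) = Gamma ((a + b) / 2 + 1) * ?U"
    using integral_radial[OF a b, of "(a + b) / 2"] a b unfolding h_def by simp
  have "(\<integral>y. (\<integral>x. h x y * of_real (exp (- (x\<^sup>2 + y\<^sup>2))) \<partial>lborel) \<partial>lborel)
     = (\<integral>y. (\<integral>x. h x y * of_real (x\<^sup>2 + y\<^sup>2) powr 0 * of_real (exp (- (x\<^sup>2 + y\<^sup>2))) \<partial>lborel) \<partial>lborel)"
  proof -
    \<comment> \<open>The power with exponent 0 is 1 away from the origin and 0 at the origin; for
      \<open>x = 0\<close> the factor \<open>h\<close> vanishes anyway.\<close>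
    have "h x y * of_real (x\<^sup>2 + y\<^sup>2) powr 0 = h x y" for x y
    proof (cases "x = 0")
      case False
      then have "complex_of_real (x\<^sup>2 + y\<^sup>2) \<noteq> 0" by (simp only: of_real_eq_0_iff) (simp add: sum_power2_eq_zero_iff)
      then have "complex_of_real (x\<^sup>2 + y\<^sup>2) powr 0 = 1" by (auto simp: powr_def)
      then show ?thesis by simp
    qed (simp add: h_def)
    then show ?thesis by (simp only:)
  qed
  also have "\<dots> = ?U"
    using integral_radial[OF a b, of 0] unfolding h_def by simp
  also have "?U = Gamma ((a + 1) / 2) * Gamma ((b + 1) / 2) * rGamma ((a + b) / 2 + 1)"
  proof -
    have "(a + b) / 2 + 1 \<notin> \<int>\<^sub>\<le>\<^sub>0"
      using a b Re_nonpos_Ints[of "(a + b) / 2 + 1"] by (auto simp: field_simps)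
    then have "Gamma ((a + b) / 2 + 1) \<noteq> 0" by (simp add: Gamma_eq_zero_iff)
    then show ?thesis unfolding K rGamma_inverse_Gamma by simp
  qed
  also have "(a + b) / 2 + 1 = (a + b + 2) / 2" by (simp add: field_simps)
  finally show ?thesis .
qed

text \<open>Only the second row enters, so the sign coordinate integrates out and the Gaussian
  integral of a function of the direction remains. The exponents have nonnegative real part, which
  bounds the integrand by 1 and makes it integrable over probability spaces.\<close>

lemma O2_beta_integral:
  fixes a b :: complex
  assumes a: "Re a \<ge> 0" and b: "Re b \<ge> 0"
  shows "(\<integral>g. of_real \<bar>g $ 2 $ 1\<bar> powr a * of_real \<bar>g $ 2 $ 2\<bar> powr b \<partial>O2_haar)
    = Gamma ((a + 1) / 2) * Gamma ((b + 1) / 2) * rGamma ((a + b + 2) / 2) / of_real pi"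
proof -
  let ?E = "uniform_count_measure K_H"
  interpret E: prob_space ?E by (rule prob_space_K_H)
  interpret G: prob_space gauss2 by (rule prob_space_gauss2)
  interpret P: pair_prob_space ?E gauss2 ..
  define f where "f = (\<lambda>g :: real ^ 2 ^ 2. complex_of_real \<bar>g $ 2 $ 1\<bar> powr a * of_real \<bar>g $ 2 $ 2\<bar> powr b)"
  define k where "k = (\<lambda>v :: real ^ 2. complex_of_real (\<bar>v $ 1\<bar> / norm v) powr a * complex_of_real (\<bar>v $ 2\<bar> / norm v) powr b)"
  define h where "h = (\<lambda>x y. complex_of_real (\<bar>x\<bar> / sqrt (x\<^sup>2 + y\<^sup>2)) powr a * complex_of_real (\<bar>y\<bar> / sqrt (x\<^sup>2 + y\<^sup>2)) powr b)"
  have fm0: "f \<in> borel_measurable borel" unfolding f_def by measurable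
  then have fm: "f \<in> borel_measurable (restrict_space borel O2)" by (rule measurable_restrict_space1)
  have km [measurable]: "k \<in> borel_measurable borel" unfolding k_def by measurable
  have hm [measurable]: "(\<lambda>(x, y). h x y) \<in> borel_measurable (lborel \<Otimes>\<^sub>M lborel)" unfolding h_def by measurable
  have kv: "k (vector [x, y]) = h x y" for x y
  proof -
    have "norm (vector [x, y] :: real ^ 2) = sqrt (x\<^sup>2 + y\<^sup>2)"
      by (simp add: norm_vec_def L2_set_def sum_2)
    then show ?thesis by (simp add: k_def h_def)
  qed
  have fk: "f (O2_of (e, v)) = k v" if "v \<noteq> 0" for e v
    using that by (simp add: f_def O2_of_def k_def)
  have k1: "norm (k v) \<le> 1" for v
  proof -
    have "norm (complex_of_real (\<bar>v $ i\<bar> / norm v) powr z) \<le> 1" if "Re z \<ge> 0" for i z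
      using that component_le_norm_cart[of v i] by (intro norm_of_real_powr_le_1) (auto simp: divide_le_eq_1)
    then show ?thesis using a b unfolding k_def norm_mult by (intro mult_le_one) auto
  qed
  have "(\<integral>g. f g \<partial>O2_haar) = (\<integral>p. f (O2_of p) \<partial>(?E \<Otimes>\<^sub>M gauss2))"
    unfolding O2_haar_def using measurable_O2_of fm by (rule integral_distr)
  also have "\<dots> = (\<integral>p. k (snd p) \<partial>(?E \<Otimes>\<^sub>M gauss2))"
  proof (rule integral_cong_AE)
    have nz: "AE p in ?E \<Otimes>\<^sub>M gauss2. snd p \<noteq> 0"
    proof (rule P.AE_pair_measure)
      have "{p \<in> space (?E \<Otimes>\<^sub>M gauss2). snd p \<noteq> 0} = space ?E \<times> (- {0})" by (auto simp: space_pair_measure)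
      also have "\<dots> \<in> sets (?E \<Otimes>\<^sub>M gauss2)" by (intro pair_measureI) auto
      finally show "{p \<in> space (?E \<Otimes>\<^sub>M gauss2). snd p \<noteq> 0} \<in> sets (?E \<Otimes>\<^sub>M gauss2)" .
      show "AE x in ?E. AE y in gauss2. snd (x, y) \<noteq> 0" using AE_gauss2_nonzero by simp
    qed
    then show "AE p in ?E \<Otimes>\<^sub>M gauss2. f (O2_of p) = k (snd p)"
      by eventually_elim (auto simp: fk)
    show "(\<lambda>p. f (O2_of p)) \<in> borel_measurable (?E \<Otimes>\<^sub>M gauss2)"
      using measurable_O2_of fm by (rule measurable_compose)
    show "(\<lambda>p. k (snd p)) \<in> borel_measurable (?E \<Otimes>\<^sub>M gauss2)"
      using measurable_snd by (rule measurable_compose) simp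
  qed
  also have "\<dots> = (\<integral>e. (\<integral>v. k v \<partial>gauss2) \<partial>?E)"
  proof -
    have "integrable (?E \<Otimes>\<^sub>M gauss2) (\<lambda>(e, v). k v)"
    proof (rule P.integrable_const_bound[where B=1])
      show "(\<lambda>(e, v). k v) \<in> borel_measurable (?E \<Otimes>\<^sub>M gauss2)"
        unfolding case_prod_beta using measurable_snd by (rule measurable_compose) simp
    qed (use k1 in auto)
    from P.integral_fst[OF this] show ?thesis unfolding case_prod_beta by simp
  qed
  also have "\<dots> = (\<integral>v. k v \<partial>gauss2)"
    by (simp add: E.prob_space)
  also have "\<dots> = (\<integral>v. (exp (- (norm v)\<^sup>2) / pi) *\<^sub>R k v \<partial>lborel)"
    unfolding gauss2_def by (rule integral_density) auto
  also have "\<dots> = (\<integral>v. (exp (- (norm v)\<^sup>2) / pi) *\<^sub>R k v \<partial>distr (lborel \<Otimes>\<^sub>M lborel) borel (\<lambda>(x, y). vector [x, y]))"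
    unfolding distr_lborel_pair_vector ..
  also have "\<dots> = (\<integral>p. (exp (- ((fst p)\<^sup>2 + (snd p)\<^sup>2)) / pi) *\<^sub>R h (fst p) (snd p) \<partial>(lborel \<Otimes>\<^sub>M lborel))"
    using measurable_vector2 by (subst integral_distr) (auto simp: case_prod_beta kv norm_vec2)
  also have "\<dots> = (\<integral>y. (\<integral>x. (exp (- (x\<^sup>2 + y\<^sup>2)) / pi) *\<^sub>R h x y \<partial>lborel) \<partial>lborel)"
  proof -
    have "integrable gauss2 k"
      using k1 by (intro G.integrable_const_bound[where B=1]) auto
    then have "integrable lborel (\<lambda>v. (exp (- (norm v)\<^sup>2) / pi) *\<^sub>R k v)"
      unfolding gauss2_def by (subst (asm) integrable_density) auto
    then have "integrable (distr (lborel \<Otimes>\<^sub>M lborel) borel (\<lambda>(x, y). vector [x, y])) (\<lambda>v. (exp (- (norm v)\<^sup>2) / pi) *\<^sub>R k v)"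
      unfolding distr_lborel_pair_vector .
    then have "integrable (lborel \<Otimes>\<^sub>M lborel) (\<lambda>(x, y). (exp (- (x\<^sup>2 + y\<^sup>2)) / pi) *\<^sub>R h x y)"
      using measurable_vector2 unfolding case_prod_beta by (subst (asm) integrable_distr_eq) (auto simp: kv norm_vec2)
    from lborel_pair.integral_snd[OF this] show ?thesis unfolding case_prod_beta by simp
  qed
  also have "\<dots> = (\<integral>y. (\<integral>x. h x y * of_real (exp (- (x\<^sup>2 + y\<^sup>2))) / of_real pi \<partial>lborel) \<partial>lborel)"
    by (intro Bochner_Integration.integral_cong refl) (simp add: scaleR_conv_of_real)
  also have "\<dots> = (\<integral>y. (\<integral>x. h x y * of_real (exp (- (x\<^sup>2 + y\<^sup>2))) \<partial>lborel) \<partial>lborel) / of_real pi"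
    by simp
  also have "\<dots> = Gamma ((a + 1) / 2) * Gamma ((b + 1) / 2) * rGamma ((a + b + 2) / 2) / of_real pi"
    unfolding h_def gaussian_abs_powr_integral[OF a b] ..
  finally show ?thesis unfolding f_def .
qed

section \<open>The spherical vector\<close>

lemma open_GL2: "open GL2"
proof -
  have "GL2 = {g. det g \<noteq> 0}" by (simp add: GL2_def invertible_det_nz)
  also have "open \<dots>" unfolding det_2 by (intro open_Collect_neq continuous_intros)
  finally show ?thesis .
qed

lemma GL2_iff: "g \<in> GL2 \<longleftrightarrow> det g \<noteq> 0"
  by (simp add: GL2_def invertible_det_nz)

text \<open>Invariant under right multiplication by O(2) and scaled by d^2 under an upper triangular
  matrix from the left. With the determinant it recovers the absolute values of the diagonal Iwasawa
  coordinates.\<close>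

definition row_norm2 :: "real ^ 2 ^ 2 \<Rightarrow> real" where
  "row_norm2 g = (g $ 2 $ 1)\<^sup>2 + (g $ 2 $ 2)\<^sup>2"

lemma row_norm2_pos: "g \<in> GL2 \<Longrightarrow> row_norm2 g > 0"
  unfolding GL2_iff det_2 row_norm2_def by (auto simp: sum_power2_gt_zero_iff)

text \<open>The function |det|^(2a) times \<open>row_norm2\<close> to the power b. Squaring the
  determinant keeps the logarithm smooth on both components of the group, without absolute
  values.\<close>

definition spherical :: "complex \<Rightarrow> complex \<Rightarrow> real ^ 2 ^ 2 \<Rightarrow> complex" where
  "spherical a b g = exp (a * of_real (ln ((det g)\<^sup>2)) + b * of_real (ln (row_norm2 g)))"

text \<open>Smoothness of \<open>spherical a b\<close> follows because all its iterated directional derivatives stay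
  in the following class.\<close>

inductive deriv_class :: "complex \<Rightarrow> complex \<Rightarrow> (real ^ 2 ^ 2 \<Rightarrow> complex) \<Rightarrow> bool" for a b where
  const: "deriv_class a b (\<lambda>g. c)"
| entry: "deriv_class a b (\<lambda>g. of_real (g $ i $ j))"
| add: "deriv_class a b f \<Longrightarrow> deriv_class a b f' \<Longrightarrow> deriv_class a b (\<lambda>g. f g + f' g)"
| mult: "deriv_class a b f \<Longrightarrow> deriv_class a b f' \<Longrightarrow> deriv_class a b (\<lambda>g. f g * f' g)"
| inverse: "deriv_class a b f \<Longrightarrow> (\<And>g. g \<in> GL2 \<Longrightarrow> f g \<noteq> 0) \<Longrightarrow> deriv_class a b (\<lambda>g. inverse (f g))"
| spherical: "deriv_class a b (spherical a b)"

lemma deriv_class_det: "deriv_class a b (\<lambda>g. of_real (det g))"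
proof -
  have "deriv_class a b (\<lambda>g. of_real (g $ 1 $ 1) * of_real (g $ 2 $ 2) + (- 1) * (of_real (g $ 1 $ 2) * of_real (g $ 2 $ 1)))"
    by (intro deriv_class.intros)
  then show ?thesis by (simp add: det_2)
qed

lemma deriv_class_row_norm2: "deriv_class a b (\<lambda>g. of_real (row_norm2 g))"
proof -
  have "deriv_class a b (\<lambda>g. of_real (g $ 2 $ 1) * of_real (g $ 2 $ 1) + of_real (g $ 2 $ 2) * of_real (g $ 2 $ 2))"
    by (intro deriv_class.intros)
  then show ?thesis by (simp add: row_norm2_def power2_eq_square)
qed

text \<open>Sum, product and quotient rules preserve the class. The one new ingredient is that the
  logarithmic derivative of \<open>spherical a b\<close> is rational in the entries, with
  denominators that vanish nowhere on \<open>GL2\<close>.\<close>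

lemma deriv_class_derivative:
  assumes "deriv_class a b f"
  obtains f' where "\<And>g. g \<in> GL2 \<Longrightarrow> (f has_derivative f' g) (at g)" "\<And>v. deriv_class a b (\<lambda>g. f' g v)"
proof -
  have "\<exists>f'. (\<forall>g\<in>GL2. (f has_derivative f' g) (at g)) \<and> (\<forall>v. deriv_class a b (\<lambda>g. f' g v))"
    using assms
  proof induction
    case (const c)
    show ?case
      by (rule exI[of _ "\<lambda>g v. 0"]) (auto intro: deriv_class.const)
  next
    case (entry i j)
    have "bounded_linear (\<lambda>v :: real ^ 2 ^ 2. complex_of_real (v $ i $ j))"
      by (intro bounded_linear_compose[OF bounded_linear_of_real] bounded_linear_compose[OF bounded_linear_vec_nth] bounded_linear_vec_nth)
    then have "((\<lambda>g :: real ^ 2 ^ 2. complex_of_real (g $ i $ j)) has_derivative (\<lambda>v. of_real (v $ i $ j))) (at g)" for g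
      by (rule bounded_linear_imp_has_derivative)
    then show ?case
      by (intro exI[of _ "\<lambda>g v. of_real (v $ i $ j)"]) (auto intro: deriv_class.const)
  next
    case (add f h)
    then obtain f' h' where d: "\<forall>g\<in>GL2. (f has_derivative f' g) (at g)" "\<forall>v. deriv_class a b (\<lambda>g. f' g v)"
      "\<forall>g\<in>GL2. (h has_derivative h' g) (at g)" "\<forall>v. deriv_class a b (\<lambda>g. h' g v)" by blast
    show ?case
      by (rule exI[of _ "\<lambda>g v. f' g v + h' g v"]) (use d in \<open>auto intro!: deriv_class.add has_derivative_add\<close>)
  next
    case (mult f h)
    then obtain f' h' where d: "\<forall>g\<in>GL2. (f has_derivative f' g) (at g)" "\<forall>v. deriv_class a b (\<lambda>g. f' g v)"
      "\<forall>g\<in>GL2. (h has_derivative h' g) (at g)" "\<forall>v. deriv_class a b (\<lambda>g. h' g v)" by blast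
    show ?case
      by (rule exI[of _ "\<lambda>g v. f g * h' g v + f' g v * h g"])
        (use d mult.hyps in \<open>auto intro!: deriv_class.add deriv_class.mult has_derivative_mult\<close>)
  next
    case (inverse f)
    then obtain f' where d: "\<forall>g\<in>GL2. (f has_derivative f' g) (at g)" "\<forall>v. deriv_class a b (\<lambda>g. f' g v)" by blast
    show ?case
    proof (rule exI[of _ "\<lambda>g v. (- 1) * (inverse (f g) * f' g v * inverse (f g))"], intro conjI ballI allI)
      fix g assume g: "g \<in> GL2"
      show "((\<lambda>g. inverse (f g)) has_derivative (\<lambda>v. (- 1) * (inverse (f g) * f' g v * inverse (f g)))) (at g)"
        using has_derivative_inverse[where f=f and x=g and f'="f' g" and S=UNIV] d(1) g inverse.hyps by simp
    qed (use d inverse.hyps in \<open>intro deriv_class.mult deriv_class.const deriv_class.inverse; simp\<close>)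
  next
    case spherical
    have "\<exists>D. (det has_derivative D) (at g) \<and> (\<forall>v. D v = g $ 1 $ 1 * v $ 2 $ 2 + v $ 1 $ 1 * g $ 2 $ 2 - (g $ 1 $ 2 * v $ 2 $ 1 + v $ 1 $ 2 * g $ 2 $ 1))"
      for g :: "real ^ 2 ^ 2"
      unfolding det_2[abs_def]
      by (intro exI conjI) (auto intro!: derivative_eq_intros bounded_linear_imp_has_derivative
        bounded_linear_compose[OF bounded_linear_vec_nth] bounded_linear_vec_nth)
    then obtain D where D: "\<And>g :: real ^ 2 ^ 2. (det has_derivative D g) (at g)"
      "\<And>g v :: real ^ 2 ^ 2. D g v = g $ 1 $ 1 * v $ 2 $ 2 + v $ 1 $ 1 * g $ 2 $ 2 - (g $ 1 $ 2 * v $ 2 $ 1 + v $ 1 $ 2 * g $ 2 $ 1)"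
      by metis
    have "\<exists>R. (row_norm2 has_derivative R) (at g) \<and> (\<forall>v. R v = 2 * (g $ 2 $ 1 * v $ 2 $ 1 + g $ 2 $ 2 * v $ 2 $ 2))"
      for g :: "real ^ 2 ^ 2"
      unfolding row_norm2_def[abs_def]
      by (intro exI conjI) (auto intro!: derivative_eq_intros bounded_linear_imp_has_derivative
        bounded_linear_compose[OF bounded_linear_vec_nth] bounded_linear_vec_nth)
    then obtain R where R: "\<And>g :: real ^ 2 ^ 2. (row_norm2 has_derivative R g) (at g)"
      "\<And>g v :: real ^ 2 ^ 2. R g v = 2 * (g $ 2 $ 1 * v $ 2 $ 1 + g $ 2 $ 2 * v $ 2 $ 2)"
      by metis
    \<comment> \<open>\<open>spherical\<close> times its logarithmic derivative; the factor 2 comes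
      from the squared determinant.\<close>
    let ?S = "\<lambda>g v. spherical a b g * (a * (2 * of_real (D g v) * inverse (of_real (det g))) + b * (of_real (R g v) * inverse (of_real (row_norm2 g))))"
    show ?case
    proof (rule exI[of _ ?S], intro conjI ballI allI)
      fix g :: "real ^ 2 ^ 2" assume g: "g \<in> GL2"
      then have nz: "det g \<noteq> 0" "row_norm2 g > 0" by (auto simp: GL2_iff row_norm2_pos)
      have d1: "((\<lambda>g. ln ((det g)\<^sup>2)) has_derivative (\<lambda>v. 2 * D g v * inverse (det g))) (at g)"
      proof -
        have "(det g)\<^sup>2 > 0" using nz by simp
        then show ?thesis
          using nz by (auto intro!: derivative_eq_intros D(1) simp: divide_simps power2_eq_square)
      qed
      have d2: "((\<lambda>g. ln (row_norm2 g)) has_derivative (\<lambda>v. R g v * inverse (row_norm2 g))) (at g)"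
        using nz by (auto intro!: derivative_eq_intros R(1) simp: field_simps)
      have d3: "((\<lambda>g. a * of_real (ln ((det g)\<^sup>2)) + b * of_real (ln (row_norm2 g))) has_derivative
        (\<lambda>v. a * of_real (2 * D g v * inverse (det g)) + b * of_real (R g v * inverse (row_norm2 g)))) (at g)"
        by (intro has_derivative_add has_derivative_mult_right has_derivative_of_real d1 d2)
      have "(exp has_derivative (*) (spherical a b g)) (at (a * of_real (ln ((det g)\<^sup>2)) + b * of_real (ln (row_norm2 g))))"
        using DERIV_exp[of "a * of_real (ln ((det g)\<^sup>2)) + b * of_real (ln (row_norm2 g))"]
        by (simp add: has_field_derivative_def spherical_def)
      from has_derivative_compose[OF d3 this]
      show "(spherical a b has_derivative ?S g) (at g)"
        by (simp add: spherical_def[abs_def])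
    next
      fix v :: "real ^ 2 ^ 2"
      have "deriv_class a b (\<lambda>g. of_real (g $ 1 $ 1) * of_real (v $ 2 $ 2) + of_real (v $ 1 $ 1) * of_real (g $ 2 $ 2)
          + (- 1) * (of_real (g $ 1 $ 2) * of_real (v $ 2 $ 1) + of_real (v $ 1 $ 2) * of_real (g $ 2 $ 1)))"
        by (intro deriv_class.intros)
      then have dD: "deriv_class a b (\<lambda>g. of_real (D g v))" by (simp add: D(2) algebra_simps)
      have "deriv_class a b (\<lambda>g. 2 * (of_real (g $ 2 $ 1) * of_real (v $ 2 $ 1) + of_real (g $ 2 $ 2) * of_real (v $ 2 $ 2)))"
        by (intro deriv_class.intros)
      then have dR: "deriv_class a b (\<lambda>g. of_real (R g v))" by (simp add: R(2))
      have di: "deriv_class a b (\<lambda>g. inverse (of_real (det g)))"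
        by (rule deriv_class.inverse[OF deriv_class_det]) (simp add: GL2_iff)
      have dj: "deriv_class a b (\<lambda>g. inverse (of_real (row_norm2 g)))"
        by (rule deriv_class.inverse[OF deriv_class_row_norm2]) (use row_norm2_pos in force)
      show "deriv_class a b (\<lambda>g. ?S g v)"
        by (intro deriv_class.mult[OF deriv_class.spherical] deriv_class.add deriv_class.mult[OF deriv_class.const]
          deriv_class.mult[OF dR dj] deriv_class.mult[OF _ di] dD)
    qed
  qed
  then show thesis using that by blast
qed

text \<open>On an open set derivatives depend only on values inside it. This permits replacing a
  Frechet derivative by an explicit formula, and \<open>spherical\<close> by its restriction, which
  is \<open>undefined\<close> off \<open>GL2\<close>.\<close>

lemma Ck_on_cong:
  assumes "open S" "Ck_on k f S" "\<And>x. x \<in> S \<Longrightarrow> f x = g x"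
  shows "Ck_on k g S"
  using assms(2,3)
proof (induction k arbitrary: f g)
  case 0
  then show ?case using continuous_on_cong[of S S f g] by auto
next
  case (Suc k)
  have tr: "(g has_derivative D) (at x)" if "x \<in> S" "(f has_derivative D) (at x)" for x D
    using has_derivative_transform_within_open[OF that(2) assms(1) that(1)] Suc.prems(2) by blast
  have fd: "frechet_derivative f (at x) = frechet_derivative g (at x)" if "x \<in> S" for x
  proof -
    have "f differentiable at x"
      using Suc.prems(1) that at_within_open[OF that assms(1)] by (metis Ck_on.simps(2) differentiable_on_def)
    then have "(f has_derivative frechet_derivative f (at x)) (at x)" by (simp add: frechet_derivative_works)
    from frechet_derivative_at[OF tr[OF that this]] show ?thesis .
  qed
  have "g differentiable_on S"
    unfolding differentiable_on_def
  proof
    fix x assume x: "x \<in> S"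
    then have "(f has_derivative frechet_derivative f (at x)) (at x)"
      using Suc.prems(1) at_within_open[OF x assms(1)] by (metis Ck_on.simps(2) differentiable_on_def frechet_derivative_works)
    from tr[OF x this] show "g differentiable at x within S"
      using differentiableI differentiable_at_withinI by blast
  qed
  moreover have "Ck_on k (\<lambda>x. frechet_derivative g (at x) v) S" for v
    by (rule Suc.IH[of "\<lambda>x. frechet_derivative f (at x) v"]) (use Suc.prems fd in auto)
  ultimately show ?case by simp
qed

lemma smooth_on_deriv_class: "deriv_class a b f \<Longrightarrow> smooth_on f GL2"
  unfolding smooth_on_def
proof
  fix k assume "deriv_class a b f"
  then show "Ck_on k f GL2"
  proof (induction k arbitrary: f)
    case 0
    obtain f' where d: "\<And>g. g \<in> GL2 \<Longrightarrow> (f has_derivative f' g) (at g)"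
      using deriv_class_derivative[OF 0] by metis
    then show ?case
      by (auto intro!: continuous_at_imp_continuous_on has_derivative_continuous)
  next
    case (Suc k)
    obtain f' where d: "\<And>g. g \<in> GL2 \<Longrightarrow> (f has_derivative f' g) (at g)" "\<And>v. deriv_class a b (\<lambda>g. f' g v)"
      using deriv_class_derivative[OF Suc.prems] by metis
    have "f differentiable_on GL2"
      unfolding differentiable_on_def using d(1) by (meson differentiableI has_derivative_at_withinI)
    moreover have "Ck_on k (\<lambda>x. frechet_derivative f (at x) v) GL2" for v
    proof (rule Ck_on_cong[OF open_GL2 Suc.IH[OF d(2)[of v]]])
      fix x assume "x \<in> GL2"
      then show "f' x v = frechet_derivative f (at x) v"
        using frechet_derivative_at[OF d(1)] by metis
    qed
    ultimately show ?case by simp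
  qed
qed

text \<open>On a triangular matrix with diagonal a, d this is |ad|^(l1 + 1/2) |d|^(l2 - l1 - 1),
  which is |a|^(l1 + 1/2) |d|^(l2 - 1/2), the character defining \<open>I_rep\<close>.\<close>

definition spherical_vector :: "complex ^ 2 \<Rightarrow> real ^ 2 ^ 2 \<Rightarrow> complex" where
  "spherical_vector l = restrict (spherical ((l $ 1 + 1/2) / 2) ((l $ 2 - l $ 1 - 1) / 2)) GL2"

lemma row_norm2_mult_O2:
  assumes "k \<in> O2"
  shows "row_norm2 (g ** k) = row_norm2 g"
proof -
  obtain a c e where k: "k = mat22 a (- e * c) c (e * a)" "a\<^sup>2 + c\<^sup>2 = 1" "e \<in> K_H"
    using O2_cases[OF assms] by metis
  have e: "e\<^sup>2 = 1" using k(3) by (auto simp: K_H_def)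
  have "row_norm2 (mat22 p q r s ** k) = r\<^sup>2 + s\<^sup>2" for p q r s
  proof -
    have "row_norm2 (mat22 p q r s ** k) = (r * a + s * c)\<^sup>2 + e\<^sup>2 * (s * a - r * c)\<^sup>2"
      unfolding k(1) mat22_mult row_norm2_def mat22_nth by (simp add: power2_eq_square algebra_simps)
    also have "\<dots> = (r\<^sup>2 + s\<^sup>2) * (a\<^sup>2 + c\<^sup>2)"
      unfolding e by (simp add: power2_eq_square algebra_simps)
    finally show ?thesis by (simp add: k(2))
  qed
  from this[of "g $ 1 $ 1" "g $ 1 $ 2" "g $ 2 $ 1" "g $ 2 $ 2"] show ?thesis
    unfolding mat22_eta row_norm2_def .
qed

lemma det_O2: "k \<in> O2 \<Longrightarrow> det k = 1 \<or> det k = -1"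
  using det_orthogonal_matrix by (auto simp: O2_def)

lemma det_mult_sq_O2: "k \<in> O2 \<Longrightarrow> (det (g ** k))\<^sup>2 = (det g)\<^sup>2"
  using det_O2[of k] by (auto simp: det_mul)

lemma O2_subset_GL2: "k \<in> O2 \<Longrightarrow> k \<in> GL2"
  using det_O2[of k] by (auto simp: GL2_iff)

lemma spherical_vector_right_invariant:
  assumes "g \<in> GL2" "k \<in> O2"
  shows "spherical_vector l (g ** k) = spherical_vector l g"
proof -
  have "g ** k \<in> GL2" using assms O2_subset_GL2[OF assms(2)] by (simp add: GL2_iff det_mul)
  then show ?thesis
    using assms by (simp add: spherical_vector_def spherical_def row_norm2_mult_O2 det_mult_sq_O2 del: det_mul)
qed

lemma spherical_vector_one: "spherical_vector l (mat 1) = 1"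
  by (simp add: spherical_vector_def spherical_def GL2_iff row_norm2_def mat_eq_mat22 det_mat22)

lemma spherical_vector_in_I_rep: "spherical_vector l \<in> I_rep l"
  unfolding I_rep_def
proof (safe; (intro allI ballI impI)?)
  let ?a = "(l $ 1 + 1/2) / 2" and ?b = "(l $ 2 - l $ 1 - 1) / 2"
  show "spherical_vector l \<in> extensional GL2" by (simp add: spherical_vector_def)
  show "smooth_on (spherical_vector l) GL2"
    using smooth_on_deriv_class[OF deriv_class.spherical, of ?a ?b]
    unfolding smooth_on_def
    using Ck_on_cong[OF open_GL2, of _ "spherical ?a ?b" "spherical_vector l"]
    by (simp add: spherical_vector_def)
  fix a b d :: real and g :: "real ^ 2 ^ 2" assume g: "g \<in> GL2" and nz: "a \<noteq> 0" "d \<noteq> 0"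
  have det: "det (mat22 a b 0 d ** g) = a * d * det g" by (simp add: det_mul det_mat22)
  have row: "row_norm2 (mat22 a b 0 d ** g) = d\<^sup>2 * row_norm2 g"
    by (simp add: row_norm2_def matrix_matrix_mult_def sum_2 power_mult_distrib algebra_simps)
  have gnz: "det g \<noteq> 0" "row_norm2 g > 0" using g by (auto simp: GL2_iff row_norm2_pos)
  have g': "mat22 a b 0 d ** g \<in> GL2" using gnz nz by (simp add: GL2_iff det)
  have ld: "ln ((a * d * det g)\<^sup>2) = 2 * ln \<bar>a\<bar> + 2 * ln \<bar>d\<bar> + ln ((det g)\<^sup>2)"
    and lr: "ln (d\<^sup>2 * row_norm2 g) = 2 * ln \<bar>d\<bar> + ln (row_norm2 g)"
  proof -
    have sq: "ln (t\<^sup>2) = 2 * ln \<bar>t\<bar>" if "t \<noteq> 0" for t :: real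
      using that ln_realpow[of "\<bar>t\<bar>" 2] by simp
    show "ln ((a * d * det g)\<^sup>2) = 2 * ln \<bar>a\<bar> + 2 * ln \<bar>d\<bar> + ln ((det g)\<^sup>2)"
      using nz gnz by (simp add: sq abs_mult ln_mult)
    show "ln (d\<^sup>2 * row_norm2 g) = 2 * ln \<bar>d\<bar> + ln (row_norm2 g)"
      using nz gnz by (simp add: sq ln_mult)
  qed
  have "spherical_vector l (mat22 a b 0 d ** g) = exp (?a * of_real (2 * ln \<bar>a\<bar> + 2 * ln \<bar>d\<bar> + ln ((det g)\<^sup>2)) + ?b * of_real (2 * ln \<bar>d\<bar> + ln (row_norm2 g)))"
    using g' by (simp only: spherical_vector_def restrict_apply' spherical_def det row ld lr)
  also have "?a * of_real (2 * ln \<bar>a\<bar> + 2 * ln \<bar>d\<bar> + ln ((det g)\<^sup>2)) + ?b * of_real (2 * ln \<bar>d\<bar> + ln (row_norm2 g))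
     = (l $ 1 + 1/2) * of_real (ln \<bar>a\<bar>) + (l $ 2 - 1/2) * of_real (ln \<bar>d\<bar>) + (?a * of_real (ln ((det g)\<^sup>2)) + ?b * of_real (ln (row_norm2 g)))"
    by (simp add: field_simps)
  also have "exp \<dots> = of_real \<bar>a\<bar> powr (l $ 1 + 1/2) * of_real \<bar>d\<bar> powr (l $ 2 - 1/2) * spherical_vector l g"
    unfolding exp_add spherical_vector_def restrict_apply'[OF g] spherical_def
    using nz by (simp add: of_real_powr_eq_exp)
  finally show "spherical_vector l (mat22 a b 0 d ** g) = of_real \<bar>a\<bar> powr (l $ 1 + 1/2) * of_real \<bar>d\<bar> powr (l $ 2 - 1/2) * spherical_vector l g" .
qed

text \<open>The rotation is chosen with the normalised second row of \<open>g\<close> as its own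
  second row; multiplying \<open>g\<close> by its transpose then clears the lower left entry and
  gives the triangular factor.\<close>

lemma iwasawa_GL2:
  assumes "g \<in> GL2"
  obtains a b d k where "a \<noteq> 0" "d \<noteq> 0" "k \<in> O2" "g = mat22 a b 0 d ** k"
proof -
  obtain p q r s where g: "g = mat22 p q r s" by (metis mat22_eta)
  let ?n = "sqrt (r\<^sup>2 + s\<^sup>2)"
  have n: "?n > 0" using row_norm2_pos[OF assms] by (simp add: row_norm2_def g)
  then have n2: "?n * ?n = r\<^sup>2 + s\<^sup>2" by simp
  have dt: "p * s - q * r \<noteq> 0" using assms by (simp add: GL2_iff g det_mat22)
  have 1: "mat22 (s / ?n) (- r / ?n) (r / ?n) (s / ?n) \<in> O2"
  proof -
    have "mat22 u (- v) v u \<in> O2" if "u\<^sup>2 + v\<^sup>2 = 1" for u v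
      using that unfolding mat22_in_O2_iff by (simp add: add.commute)
    moreover have "(s / ?n)\<^sup>2 + (r / ?n)\<^sup>2 = (s\<^sup>2 + r\<^sup>2) / (?n * ?n)"
      by (simp only: power_divide add_divide_distrib power2_eq_square[of ?n])
    then have "(s / ?n)\<^sup>2 + (r / ?n)\<^sup>2 = 1"
    proof -
      have "r\<^sup>2 + s\<^sup>2 \<noteq> 0" using n by (simp only: real_sqrt_gt_0_iff less_imp_neq[symmetric] not_False_eq_True)
      then show ?thesis using \<open>_ = (s\<^sup>2 + r\<^sup>2) / (?n * ?n)\<close> unfolding n2 add.commute[of "s\<^sup>2"] by simp
    qed
    ultimately show ?thesis unfolding minus_divide_left[symmetric] by blast
  qed
  have 2: "g = mat22 ((p * s - q * r) / ?n) ((p * r + q * s) / ?n) 0 ?n ** mat22 (s / ?n) (- r / ?n) (r / ?n) (s / ?n)"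
  proof -
    have nn: "?n \<noteq> 0" by (rule less_imp_neq[OF n, symmetric])
    have "(p * s - q * r) / m * (s / m) + (p * r + q * s) / m * (r / m) = p * ((r\<^sup>2 + s\<^sup>2) / (m * m))"
      "(p * s - q * r) / m * (- r / m) + (p * r + q * s) / m * (s / m) = q * ((r\<^sup>2 + s\<^sup>2) / (m * m))"
      if "m \<noteq> 0" for m
      using that by (simp_all add: field_simps power2_eq_square)
    from this[OF nn] show ?thesis
      using nn unfolding g mat22_mult by (auto simp: n2 simp del: real_sqrt_mult_self)
  qed
  have nz: "?n \<noteq> 0" by (rule less_imp_neq[OF n, symmetric])
  show thesis by (rule that[OF _ nz 1 2]) (use nz dt in \<open>metis divide_eq_0_iff\<close>)
qed

lemma phi_eq: "phi l = spherical_vector l"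
  unfolding phi_def
proof (rule the_equality)
  show "spherical_vector l \<in> I_rep l \<and> (\<forall>g\<in>GL2. \<forall>k\<in>O2. spherical_vector l (g ** k) = spherical_vector l g) \<and> spherical_vector l (mat 1) = 1"
    using spherical_vector_in_I_rep spherical_vector_right_invariant spherical_vector_one by blast
  fix u assume u: "u \<in> I_rep l \<and> (\<forall>g\<in>GL2. \<forall>k\<in>O2. u (g ** k) = u g) \<and> u (mat 1) = 1"
  \<comment> \<open>Left equivariance, right invariance and the value at the identity fix a function
    on every Iwasawa product, hence on all of \<open>GL2\<close>.\<close>
  have val: "w (mat22 a b 0 d ** k) = of_real \<bar>a\<bar> powr (l $ 1 + 1/2) * of_real \<bar>d\<bar> powr (l $ 2 - 1/2)"
    if w: "w \<in> I_rep l" "\<And>g k. g \<in> GL2 \<Longrightarrow> k \<in> O2 \<Longrightarrow> w (g ** k) = w g" "w (mat 1) = 1"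
      and "a \<noteq> 0" "d \<noteq> 0" "k \<in> O2" for w a b d k
  proof -
    have "mat22 a b 0 d \<in> GL2" using that by (simp add: GL2_iff det_mat22)
    then have "w (mat22 a b 0 d ** k) = w (mat22 a b 0 d ** mat 1)" using that by simp
    also have "\<dots> = of_real \<bar>a\<bar> powr (l $ 1 + 1/2) * of_real \<bar>d\<bar> powr (l $ 2 - 1/2) * w (mat 1)"
    proof -
      have "mat 1 \<in> GL2" by (simp add: GL2_iff)
      then show ?thesis using w(1) that(4,5) unfolding I_rep_def by blast
    qed
    finally show ?thesis by (simp add: w(3))
  qed
  show "u = spherical_vector l"
  proof (rule extensionalityI[of _ GL2])
    show "u \<in> extensional GL2" using u by (simp add: I_rep_def)
    show "spherical_vector l \<in> extensional GL2" by (simp add: spherical_vector_def)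
    fix g assume "g \<in> GL2"
    then obtain a b d k where g: "a \<noteq> 0" "d \<noteq> 0" "k \<in> O2" "g = mat22 a b 0 d ** k" by (rule iwasawa_GL2)
    show "u g = spherical_vector l g"
      unfolding g(4) using val[of u, OF _ _ _ g(1-3)] u
        val[of "spherical_vector l", OF spherical_vector_in_I_rep spherical_vector_right_invariant spherical_vector_one g(1-3)]
      by simp
  qed
qed

lemma phi_O2: "k \<in> O2 \<Longrightarrow> phi l k = 1"
  using spherical_vector_right_invariant[of "mat 1" k l] spherical_vector_one
  by (simp add: phi_eq GL2_iff)

section \<open>Uniqueness of meromorphic continuation\<close>

lemma norm_vector_scalar_mult: "norm (c *s (v :: complex ^ 'n)) = norm c * norm v"
  by (simp add: norm_vec_def norm_mult L2_set_right_distrib)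

lemma bounded_linear_vector_scalar_mult: "bounded_linear (\<lambda>c. c *s (v :: complex ^ 'n))"
proof
  show "\<exists>K. \<forall>x. norm (x *s v) \<le> norm x * K"
    by (intro exI[of _ "norm v"]) (simp add: norm_vector_scalar_mult)
qed (simp_all add: vec_eq_iff algebra_simps)

lemma holomorphic_Cn_imp_continuous_on: "holomorphic_Cn f U \<Longrightarrow> continuous_on U f"
  unfolding holomorphic_Cn_def
  by (intro continuous_at_imp_continuous_on ballI) (meson has_derivative_continuous)

lemma holomorphic_Cn_subset: "holomorphic_Cn f U \<Longrightarrow> V \<subseteq> U \<Longrightarrow> holomorphic_Cn f V"
  unfolding holomorphic_Cn_def by blast

lemma holomorphic_Cn_mult:
  assumes "holomorphic_Cn f U" "holomorphic_Cn g U"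
  shows "holomorphic_Cn (\<lambda>p. f p * g p) U"
  unfolding holomorphic_Cn_def
proof
  fix p assume "p \<in> U"
  with assms obtain D E where "(f has_derivative D) (at p)" "\<And>c v. D (c *s v) = c * D v"
    "(g has_derivative E) (at p)" "\<And>c v. E (c *s v) = c * E v"
    unfolding holomorphic_Cn_def by metis
  then show "\<exists>D. ((\<lambda>p. f p * g p) has_derivative D) (at p) \<and> (\<forall>c v. D (c *s v) = c * D v)"
    by (intro exI[of _ "\<lambda>v. f p * E v + D v * g p"] conjI has_derivative_mult) (auto simp: algebra_simps)
qed

lemma holomorphic_Cn_diff:
  assumes "holomorphic_Cn f U" "holomorphic_Cn g U"
  shows "holomorphic_Cn (\<lambda>p. f p - g p) U"
  unfolding holomorphic_Cn_def
proof
  fix p assume "p \<in> U"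
  with assms obtain D E where "(f has_derivative D) (at p)" "\<And>c v. D (c *s v) = c * D v"
    "(g has_derivative E) (at p)" "\<And>c v. E (c *s v) = c * E v"
    unfolding holomorphic_Cn_def by metis
  then show "\<exists>D. ((\<lambda>p. f p - g p) has_derivative D) (at p) \<and> (\<forall>c v. D (c *s v) = c * D v)"
    by (intro exI[of _ "\<lambda>v. D v - E v"]) (auto intro!: has_derivative_diff simp: algebra_simps)
qed

lemma holomorphic_Cn_compose:
  assumes "(\<phi> has_field_derivative d) (at (f p))" "(f has_derivative D) (at p)" "\<And>c v. D (c *s v) = c * D v"
  shows "\<exists>D. ((\<lambda>p. \<phi> (f p)) has_derivative D) (at p) \<and> (\<forall>c v. D (c *s v) = c * D v)"
proof -
  have "(\<phi> has_derivative (*) d) (at (f p))" using assms(1) by (simp add: has_field_derivative_def)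
  from has_derivative_compose[OF assms(2) this] show ?thesis
    using assms(3) by (intro exI[of _ "\<lambda>v. d * D v"]) auto
qed

text \<open>Restriction to the complex line through \<open>q\<close> and a point of
  \<open>V\<close>. It meets the ball in a convex, hence connected, set of parameters, so the
  one-variable identity theorem applies; complex linearity of the derivative makes the restriction
  holomorphic.\<close>

lemma holomorphic_Cn_identity_ball:
  fixes f :: "complex ^ 'n \<Rightarrow> complex"
  assumes f: "holomorphic_Cn f (ball p r)" and V: "open V" "V \<noteq> {}" "V \<subseteq> ball p r"
    and zero: "\<And>q. q \<in> V \<Longrightarrow> f q = 0" and q: "q \<in> ball p r"
  shows "f q = 0"
proof -
  obtain v where v: "v \<in> V" using V by blast
  let ?L = "\<lambda>z. v + z *s (q - v)"
  have cont: "continuous_on UNIV ?L"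
    by (intro continuous_intros linear_continuous_on bounded_linear_vector_scalar_mult)
  define S where "S = ?L -` ball p r"
  have S: "open S" unfolding S_def by (intro open_vimage cont) auto
  have cS: "connected S"
  proof -
    have "convex S"
      unfolding convex_def S_def
    proof (intro ballI allI impI, goal_cases)
      case (1 x y s t)
      have eq: "?L (s *\<^sub>R x + t *\<^sub>R y) = s *\<^sub>R ?L x + t *\<^sub>R ?L y"
      proof -
        have "v = s *\<^sub>R v + t *\<^sub>R v" using 1 by (simp flip: scaleR_add_left)
        then show ?thesis by (simp add: vec_eq_iff algebra_simps)
      qed
      have "s *\<^sub>R ?L x + t *\<^sub>R ?L y \<in> ball p r"
        using 1 convex_ball[of p r] unfolding convex_def by simp
      then show ?case by (simp only: vimage_eq eq)
    qed
    then show ?thesis by (rule convex_connected)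
  qed
  have hol: "(\<lambda>z. f (?L z)) holomorphic_on S"
  proof (rule holomorphic_onI)
    fix z assume "z \<in> S"
    then obtain D where D: "(f has_derivative D) (at (?L z))" "\<And>c v. D (c *s v) = c * D v"
      using f unfolding holomorphic_Cn_def S_def by blast
    have "(?L has_derivative (\<lambda>c. c *s (q - v))) (at z)"
      using has_derivative_add[OF has_derivative_const[of v] bounded_linear_imp_has_derivative[OF bounded_linear_vector_scalar_mult[of "q - v"]]]
      by simp
    from has_derivative_compose[OF this D(1)]
    have "((\<lambda>z. f (?L z)) has_field_derivative D (q - v)) (at z)"
      unfolding has_field_derivative_def by (simp only: D(2) mult_commute_abs)
    then show "(\<lambda>z. f (?L z)) field_differentiable at z within S"
      using field_differentiable_at_within field_differentiable_def by blast
  qed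
  have "f (?L 1) = 0"
  proof (rule analytic_continuation_open[where s="?L -` V \<inter> S" and s'=S and f="\<lambda>z. f (?L z)" and g="\<lambda>_. 0"])
    show "open (?L -` V \<inter> S)" using S V(1) cont by (intro open_Int open_vimage) auto
    have "(0::complex) \<in> ?L -` V \<inter> S" using v V(3) by (auto simp: S_def)
    then show "?L -` V \<inter> S \<noteq> {}" by blast
    show "1 \<in> S" using q by (simp add: S_def vec_eq_iff)
  qed (use S cS hol zero in auto)
  then show ?thesis by simp
qed

text \<open>The set where two representatives agree need not be closed, as values at zeros of
  denominators are free. Instead the closure of its interior is shown to be open, hence everything;
  at \<open>p\<close>, where both functions are holomorphic, continuity turns density into
  equality.\<close>

lemma meromorphic_Cn_eqI:
  fixes F G :: "complex ^ 'n \<Rightarrow> complex"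
  assumes F: "meromorphic_Cn F" and G: "meromorphic_Cn G"
    and W: "open W" "W \<noteq> {}" "\<And>q. q \<in> W \<Longrightarrow> F q = G q"
    and U: "open U" "p \<in> U" "holomorphic_Cn F U" and U': "open U'" "p \<in> U'" "holomorphic_Cn G U'"
  shows "F p = G p"
proof -
  define X where "X = interior {q. F q = G q}"
  have "open (closure X)"
    unfolding open_contains_ball
  proof
    fix x assume x: "x \<in> closure X"
    obtain A P Q where A: "open A" "x \<in> A" "holomorphic_Cn P A" "holomorphic_Cn Q A"
      "\<And>V. open V \<Longrightarrow> V \<noteq> {} \<Longrightarrow> V \<subseteq> A \<Longrightarrow> \<exists>q\<in>V. Q q \<noteq> 0" "\<And>q. q \<in> A \<Longrightarrow> Q q \<noteq> 0 \<Longrightarrow> F q = P q / Q q"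
      using F unfolding meromorphic_Cn_def by metis
    obtain B R S where B: "open B" "x \<in> B" "holomorphic_Cn R B" "holomorphic_Cn S B"
      "\<And>V. open V \<Longrightarrow> V \<noteq> {} \<Longrightarrow> V \<subseteq> B \<Longrightarrow> \<exists>q\<in>V. S q \<noteq> 0" "\<And>q. q \<in> B \<Longrightarrow> S q \<noteq> 0 \<Longrightarrow> G q = R q / S q"
      using G unfolding meromorphic_Cn_def by metis
    obtain r where r: "r > 0" "ball x r \<subseteq> A \<inter> B"
      using A B by (meson IntI open_Int open_contains_ball)
    have rA: "ball x r \<subseteq> A" and rB: "ball x r \<subseteq> B" using r by auto
    have hP: "holomorphic_Cn P (ball x r)" "holomorphic_Cn Q (ball x r)"
      "holomorphic_Cn R (ball x r)" "holomorphic_Cn S (ball x r)"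
      using A B rA rB by (auto intro: holomorphic_Cn_subset)
    \<comment> \<open>Both denominators are nonzero together on some open part of every nonempty
      open subset: first shrink to avoid zeros of \<open>Q\<close>, then use that \<open>S\<close>
      is not identically zero on what is left.\<close>
    have dense: "\<exists>V'. open V' \<and> V' \<noteq> {} \<and> V' \<subseteq> V \<and> (\<forall>q\<in>V'. Q q \<noteq> 0 \<and> S q \<noteq> 0)"
      if V: "open V" "V \<noteq> {}" "V \<subseteq> ball x r" for V
    proof -
      let ?V1 = "V \<inter> Q -` (- {0})" and ?V2 = "V \<inter> S -` (- {0})"
      have 1: "open ?V1"
        using continuous_on_subset[OF holomorphic_Cn_imp_continuous_on[OF hP(2)] V(3)]
        by (rule continuous_open_preimage) (use V in auto)
      have 2: "open ?V2"
        using continuous_on_subset[OF holomorphic_Cn_imp_continuous_on[OF hP(4)] V(3)]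
        by (rule continuous_open_preimage) (use V in auto)
      have "?V1 \<noteq> {}" using A(5)[OF V(1,2)] V(3) rA by blast
      then have "\<exists>q\<in>?V1. S q \<noteq> 0" using B(5)[OF 1] V(3) rB by blast
      then show ?thesis using 1 2 by (intro exI[of _ "?V1 \<inter> ?V2"]) auto
    qed
    have "X \<inter> ball x r \<noteq> {}" using x r(1) by (metis closure_iff_nhds_not_empty centre_in_ball open_ball subset_refl inf_commute)
    moreover have "open (X \<inter> ball x r)" by (intro open_Int) (simp_all add: X_def)
    ultimately obtain V where V: "open V" "V \<noteq> {}" "V \<subseteq> X \<inter> ball x r" "\<And>q. q \<in> V \<Longrightarrow> Q q \<noteq> 0 \<and> S q \<noteq> 0"
      using dense[of "X \<inter> ball x r"] by (metis inf_le2)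
    have FG: "q \<in> X \<Longrightarrow> F q = G q" for q using interior_subset[of "{q. F q = G q}"] by (auto simp: X_def)
    \<comment> \<open>Cross-multiplying gives a holomorphic function on the ball, to which the
      identity theorem applies although \<open>F\<close> and \<open>G\<close> may have poles
      there.\<close>
    have h: "holomorphic_Cn (\<lambda>q. P q * S q - R q * Q q) (ball x r)"
      using hP by (intro holomorphic_Cn_diff holomorphic_Cn_mult)
    have z: "P q * S q - R q * Q q = 0" if "q \<in> ball x r" for q
    proof (rule holomorphic_Cn_identity_ball[OF h V(1,2) _ _ that])
      fix q assume q: "q \<in> V"
      then have "P q / Q q = R q / S q" using V(3,4) FG A(6) B(6) rA rB by (metis IntD1 IntD2 subsetD)
      then show "P q * S q - R q * Q q = 0" using V(4)[OF q] by (simp add: field_simps)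
    qed (use V in auto)
    have "ball x r \<subseteq> closure X"
    proof
      fix y assume y: "y \<in> ball x r"
      show "y \<in> closure X"
        unfolding closure_iff_nhds_not_empty
      proof (intro allI impI notI)
        fix N Y assume N: "Y \<subseteq> N" "y \<in> Y" "open Y" "X \<inter> N = {}"
        have "open (Y \<inter> ball x r)" "Y \<inter> ball x r \<noteq> {}" using N y by auto
        then obtain V' where V': "open V'" "V' \<noteq> {}" "V' \<subseteq> Y \<inter> ball x r" "\<And>q. q \<in> V' \<Longrightarrow> Q q \<noteq> 0 \<and> S q \<noteq> 0"
          using dense[of "Y \<inter> ball x r"] by (metis inf_le2)
        have "F q = G q" if q: "q \<in> V'" for q
        proof -
          have "q \<in> ball x r" using q V' by blast
          then have "F q = P q / Q q" "G q = R q / S q" using A(6) B(6) rA rB V'(4)[OF q] by blast+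
          then show ?thesis using z[OF \<open>q \<in> ball x r\<close>] V'(4)[OF q] by (simp add: frac_eq_eq)
        qed
        then have "V' \<subseteq> X" unfolding X_def using V'(1) by (intro interior_maximal) auto
        then show False using V' N by blast
      qed
    qed
    then show "\<exists>e>0. ball x e \<subseteq> closure X" using r(1) by blast
  qed
  moreover have "W \<subseteq> X" unfolding X_def using W by (intro interior_maximal) auto
  then have "closure X \<noteq> {}" using W(2) closure_subset by blast
  ultimately have "closure X = UNIV" using clopen[of "closure X"] by auto
  then have pX: "p \<in> closure X" by simp
  \<comment> \<open>Near \<open>p\<close> both functions are continuous, so their coincidence set is
    relatively closed there and contains the limit point \<open>p\<close> of
    \<open>X\<close>.\<close>
  have "closedin (top_of_set (U \<inter> U')) ((U \<inter> U') \<inter> (\<lambda>q. F q - G q) -` {0})"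
    using U U' by (intro continuous_closedin_preimage continuous_intros)
      (auto intro!: continuous_on_subset[OF holomorphic_Cn_imp_continuous_on])
  then obtain C where C: "closed C" "(U \<inter> U') \<inter> (\<lambda>q. F q - G q) -` {0} = (U \<inter> U') \<inter> C"
    by (auto simp: closedin_closed)
  have "p \<in> closure (X \<inter> (U \<inter> U'))"
    using open_Int_closure_subset[of "U \<inter> U'" X] U U' pX by (auto simp: inf_commute open_Int)
  moreover have "X \<inter> (U \<inter> U') \<subseteq> C"
    using C(2) interior_subset[of "{q. F q = G q}"] unfolding X_def by fastforce
  ultimately have "p \<in> C" using closure_minimal[OF _ C(1)] by blast
  then show ?thesis using C(2) U U' by auto
qed

lemma meromorphic_continuation_eqI:
  assumes F: "meromorphic_Cn F" "\<And>q. q \<in> R \<Longrightarrow> F q = f q"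
    and U: "open U" "p \<in> U" "holomorphic_Cn F U" and R: "interior R \<noteq> {}"
  shows "meromorphic_continuation f R p = F p"
  unfolding meromorphic_continuation_def
proof (rule the_equality)
  show "\<exists>F' U. meromorphic_Cn F' \<and> (\<forall>q\<in>R. F' q = f q) \<and> open U \<and> p \<in> U \<and> holomorphic_Cn F' U \<and> F p = F' p"
    using assms by blast
  fix c assume "\<exists>F' U. meromorphic_Cn F' \<and> (\<forall>q\<in>R. F' q = f q) \<and> open U \<and> p \<in> U \<and> holomorphic_Cn F' U \<and> c = F' p"
  then obtain F' U' where F': "meromorphic_Cn F'" "\<And>q. q \<in> R \<Longrightarrow> F' q = f q" "open U'" "p \<in> U'"
    "holomorphic_Cn F' U'" "c = F' p" by blast
  have "F' p = F p"
    by (rule meromorphic_Cn_eqI[OF F'(1) F(1) open_interior R _ F'(3-5) U])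
      (use F(2) F'(2) interior_subset in \<open>metis subsetD\<close>)
  then show "c = F p" using F' by simp
qed

section \<open>The model period\<close>

text \<open>The period is a Beta function of these two parameters, with \<open>p = (l $ 1, l $ 2, n, s)\<close>.\<close>

definition model_A :: "complex ^ 4 \<Rightarrow> complex" where
  "model_A p = (p $ 1 + p $ 3 + p $ 4) / 2"

definition model_B :: "complex ^ 4 \<Rightarrow> complex" where
  "model_B p = (1 - p $ 2 - p $ 3 - p $ 4) / 2"

definition model_period :: "complex ^ 4 \<Rightarrow> complex" where
  "model_period p = Gamma (model_A p) * Gamma (model_B p) * rGamma (model_A p + model_B p) / of_real pi"

lemma vector_4 [simp]:
  "(vector [a, b, c, d] :: 'a::zero ^ 4) $ 1 = a" "(vector [a, b, c, d] :: 'a ^ 4) $ 2 = b"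
  "(vector [a, b, c, d] :: 'a ^ 4) $ 3 = c" "(vector [a, b, c, d] :: 'a ^ 4) $ 4 = d"
  unfolding vector_def by simp_all

lemma has_derivative_model:
  fixes p :: "complex ^ 4"
  shows "(model_A has_derivative (\<lambda>v. (v $ 1 + v $ 3 + v $ 4) / 2)) (at p)"
    and "(model_B has_derivative (\<lambda>v. (- v $ 2 - v $ 3 - v $ 4) / 2)) (at p)"
proof -
  have n: "((\<lambda>p. p $ i) has_derivative (\<lambda>v. v $ i)) (at p)" for i
    by (rule bounded_linear_imp_has_derivative[OF bounded_linear_vec_nth])
  show "(model_A has_derivative (\<lambda>v. (v $ 1 + v $ 3 + v $ 4) / 2)) (at p)"
    unfolding model_A_def[abs_def] by (auto intro!: n derivative_eq_intros)
  show "(model_B has_derivative (\<lambda>v. (- v $ 2 - v $ 3 - v $ 4) / 2)) (at p)"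
    unfolding model_B_def[abs_def] by (auto intro!: n derivative_eq_intros)
qed

lemma holomorphic_Cn_rGamma_model:
  "holomorphic_Cn (\<lambda>p. rGamma (model_A p)) U" "holomorphic_Cn (\<lambda>p. rGamma (model_B p)) U"
  "holomorphic_Cn (\<lambda>p. rGamma (model_A p + model_B p) / of_real pi) U"
proof -
  have d: "(rGamma has_field_derivative deriv rGamma z) (at z)" for z :: complex
    using holomorphic_derivI[OF holomorphic_rGamma[of UNIV], of z] by simp
  show "holomorphic_Cn (\<lambda>p. rGamma (model_A p)) U"
    unfolding holomorphic_Cn_def
    by (intro ballI holomorphic_Cn_compose[OF d has_derivative_model(1)]) (simp add: field_simps)
  show "holomorphic_Cn (\<lambda>p. rGamma (model_B p)) U"
    unfolding holomorphic_Cn_def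
    by (intro ballI holomorphic_Cn_compose[OF d has_derivative_model(2)]) (simp add: field_simps)
  have d': "((\<lambda>z. rGamma z / of_real pi) has_field_derivative deriv rGamma z / of_real pi) (at z)" for z :: complex
    by (rule DERIV_cdivide[OF d])
  show "holomorphic_Cn (\<lambda>p. rGamma (model_A p + model_B p) / of_real pi) U"
    unfolding holomorphic_Cn_def
    by (intro ballI holomorphic_Cn_compose[OF d' has_derivative_add[OF has_derivative_model]]) (simp add: field_simps)
qed

lemma model_period_quotient:
  "rGamma (model_A p) * rGamma (model_B p) \<noteq> 0 \<Longrightarrow>
   model_period p = (rGamma (model_A p + model_B p) / of_real pi) / (rGamma (model_A p) * rGamma (model_B p))"
  unfolding model_period_def Gamma_def by (simp add: field_simps)

text \<open>Zeros of \<open>rGamma\<close> are real, and an imaginary shift of the fourth coordinate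
  moves the imaginary parts of both \<open>model_A\<close> and \<open>model_B\<close>.\<close>

lemma rGamma_model_not_locally_zero:
  assumes "open V" "V \<noteq> {}"
  shows "\<exists>q\<in>V. rGamma (model_A q) * rGamma (model_B q) \<noteq> 0"
proof -
  obtain p where p: "p \<in> V" using assms by blast
  let ?e = "axis 4 \<i> :: complex ^ 4"
  obtain r where r: "r > 0" "ball p r \<subseteq> V" using assms(1) p open_contains_ball by blast
  have "infinite {0<..<r}" using r by (simp add: infinite_Ioo)
  \<comment> \<open>The two excluded values are those that make \<open>model_A\<close> or
    \<open>model_B\<close> real.\<close>
  then obtain t where t: "t \<in> {0<..<r}" "t \<notin> {- Im (p $ 1 + p $ 3 + p $ 4), - Im (p $ 2 + p $ 3 + p $ 4)}"
    by (metis finite.emptyI finite.insertI finite_subset subsetI)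
  let ?q = "p + t *\<^sub>R ?e"
  have "norm ?e = 1"
    by (simp add: norm_vec_def L2_set_def axis_def if_distrib[of norm] if_distrib[of "\<lambda>x. x\<^sup>2"] cong: if_cong)
  then have "?q \<in> ball p r" using t(1) by (simp add: dist_norm)
  moreover have "Im (model_A ?q) \<noteq> 0" "Im (model_B ?q) \<noteq> 0"
    using t(2) by (auto simp: model_A_def model_B_def axis_def)
  then have "model_A ?q \<notin> \<int>\<^sub>\<le>\<^sub>0" "model_B ?q \<notin> \<int>\<^sub>\<le>\<^sub>0"
    by (metis complex_is_Int_iff nonpos_Ints_Int)+
  ultimately show ?thesis using r(2) by (intro bexI[of _ ?q]) (auto simp: rGamma_eq_zero_iff)
qed

lemma meromorphic_model_period: "meromorphic_Cn model_period"
  unfolding meromorphic_Cn_def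
proof
  fix p
  let ?P = "\<lambda>p. rGamma (model_A p + model_B p) / of_real pi" and ?Q = "\<lambda>p. rGamma (model_A p) * rGamma (model_B p)"
  show "\<exists>U P Q. open U \<and> p \<in> U \<and> holomorphic_Cn P U \<and> holomorphic_Cn Q U \<and>
    (\<forall>V. open V \<and> V \<noteq> {} \<and> V \<subseteq> U \<longrightarrow> (\<exists>q\<in>V. Q q \<noteq> 0)) \<and> (\<forall>q\<in>U. Q q \<noteq> 0 \<longrightarrow> model_period q = P q / Q q)"
  proof (intro exI conjI)
    show "holomorphic_Cn ?P UNIV" "holomorphic_Cn ?Q UNIV"
      by (intro holomorphic_Cn_rGamma_model holomorphic_Cn_mult)+
    show "\<forall>V. open V \<and> V \<noteq> {} \<and> V \<subseteq> UNIV \<longrightarrow> (\<exists>q\<in>V. ?Q q \<noteq> 0)"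
      using rGamma_model_not_locally_zero by blast
    show "\<forall>q\<in>UNIV. ?Q q \<noteq> 0 \<longrightarrow> model_period q = ?P q / ?Q q"
      using model_period_quotient by blast
  qed auto
qed

text \<open>Supplies the neighbourhood of holomorphy demanded by
  \<open>meromorphic_continuation\<close>. On the critical line with imaginary \<open>l\<close> and
  \<open>n = 0\<close>, both real parts equal 1/4.\<close>

lemma holomorphic_Cn_model_period:
  "holomorphic_Cn model_period {p. Re (model_A p) > 0 \<and> Re (model_B p) > 0}" (is "holomorphic_Cn _ ?U")
proof -
  have d: "(Gamma has_field_derivative Gamma z * Digamma z) (at z)" if "Re z > 0" for z :: complex
    using that Re_nonpos_Ints[of z] by (intro has_field_derivative_Gamma) auto
  have "holomorphic_Cn (\<lambda>p. Gamma (model_A p)) ?U"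
    unfolding holomorphic_Cn_def
    by (intro ballI holomorphic_Cn_compose[OF d has_derivative_model(1)]) (auto simp: field_simps)
  moreover have "holomorphic_Cn (\<lambda>p. Gamma (model_B p)) ?U"
    unfolding holomorphic_Cn_def
    by (intro ballI holomorphic_Cn_compose[OF d has_derivative_model(2)]) (auto simp: field_simps)
  ultimately have "holomorphic_Cn (\<lambda>p. Gamma (model_A p) * Gamma (model_B p) * (rGamma (model_A p + model_B p) / of_real pi)) ?U"
    by (intro holomorphic_Cn_mult holomorphic_Cn_rGamma_model)
  then show ?thesis by (simp add: model_period_def[abs_def])
qed

lemma continuous_on_model: "continuous_on UNIV model_A" "continuous_on UNIV model_B"
  using has_derivative_model by (auto intro!: continuous_at_imp_continuous_on has_derivative_continuous)

lemma O2_row_le_1: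
  assumes "g \<in> O2"
  shows "\<bar>g $ 2 $ 1\<bar> \<le> 1" "\<bar>g $ 2 $ 2\<bar> \<le> 1"
proof -
  have "row_norm2 (mat 1 ** g) = 1" using assms by (subst row_norm2_mult_O2) (auto simp: row_norm2_def mat_eq_mat22)
  then have "(g $ 2 $ 1)\<^sup>2 + (g $ 2 $ 2)\<^sup>2 = 1" by (simp add: row_norm2_def)
  then have "(g $ 2 $ 1)\<^sup>2 \<le> 1\<^sup>2" "(g $ 2 $ 2)\<^sup>2 \<le> 1\<^sup>2" by (simp_all) (metis zero_le_power2 le_add_same_cancel1 le_add_same_cancel2)+
  then show "\<bar>g $ 2 $ 1\<bar> \<le> 1" "\<bar>g $ 2 $ 2\<bar> \<le> 1" by (simp_all only: abs_square_le_1 power_one)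
qed

lemma space_O2_haar: "space O2_haar = O2"
  by (simp add: O2_haar_def space_restrict_space)

lemma prob_space_O2_haar: "prob_space O2_haar"
proof -
  interpret E: prob_space "uniform_count_measure K_H" by (rule prob_space_K_H)
  interpret G: prob_space gauss2 by (rule prob_space_gauss2)
  interpret P: pair_prob_space "uniform_count_measure K_H" gauss2 ..
  show ?thesis unfolding O2_haar_def by (rule P.prob_space_distr[OF measurable_O2_of])
qed

text \<open>The parameters \<open>m\<close> and \<open>k\<close> of the vectors are independent of
  \<open>l\<close> and \<open>n\<close>, because the continuation varies the kernel with the vectors
  held fixed. On the compact groups the vectors and the determinant factor are all 1, so only the
  two entries of the second row remain.\<close>

lemma period_integral_spherical:
  assumes a: "Re (l $ 1 + n + s - 1) \<ge> 0" and b: "Re (- l $ 2 - n - s) \<ge> 0"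
  shows "period_integral l n s (phi m) (psi k) = model_period (vector [l $ 1, l $ 2, n, s])"
proof -
  let ?E = "uniform_count_measure K_H"
  let ?a = "l $ 1 + n + s - 1" and ?b = "- l $ 2 - n - s"
  interpret E: prob_space ?E by (rule prob_space_K_H)
  interpret O: prob_space O2_haar by (rule prob_space_O2_haar)
  interpret P: pair_prob_space O2_haar ?E ..
  define f where "f = (\<lambda>g :: real ^ 2 ^ 2. complex_of_real \<bar>g $ 2 $ 1\<bar> powr ?a * of_real \<bar>g $ 2 $ 2\<bar> powr ?b)"
  have fm: "f \<in> borel_measurable O2_haar"
  proof -
    have "f \<in> borel_measurable borel" unfolding f_def by measurable
    then have "f \<in> borel_measurable (restrict_space borel O2)" by (rule measurable_restrict_space1)
    then show ?thesis by (simp add: O2_haar_def)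
  qed
  have f1: "norm (f g) \<le> 1" if "g \<in> O2" for g
    unfolding f_def norm_mult using a b O2_row_le_1[OF that]
    by (intro mult_le_one norm_of_real_powr_le_1) auto
  have eq: "period_kernel l n s g h * phi m g * psi k h = f g" if g: "g \<in> O2" and h: "h \<in> K_H" for g h
  proof -
    have h1: "\<bar>h\<bar> = 1" "inverse h = h" using h by (auto simp: K_H_def)
    have g': "g = mat22 (g $ 1 $ 1) (g $ 1 $ 2) (g $ 2 $ 1) (g $ 2 $ 2)" by (simp add: mat22_eta)
    have x: "g ** GL1_embed (inverse h) = mat22 (g $ 1 $ 1 * h) (g $ 1 $ 2) (g $ 2 $ 1 * h) (g $ 2 $ 2)"
      by (subst g') (simp add: GL1_embed_def h1(2) mat22_mult)
    have "\<bar>det (g ** GL1_embed (inverse h))\<bar> = 1"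
      using det_O2[OF g] h1 by (auto simp: det_mul GL1_embed_def det_mat22 abs_mult)
    then have d: "complex_of_real \<bar>det (g ** GL1_embed (inverse h))\<bar> powr z = 1" for z by simp
    have "psi k h = 1" by (simp add: psi_def h1)
    then show ?thesis
      unfolding period_kernel_def Let_def f_def phi_O2[OF g] x by (simp add: abs_mult h1 d[unfolded x])
  qed
  have "period_integral l n s (phi m) (psi k) = (\<integral>(g, h). f g \<partial>(O2_haar \<Otimes>\<^sub>M ?E))"
    unfolding period_integral_def haar_measure_O2 haar_measure_K_H
    by (intro Bochner_Integration.integral_cong refl)
      (auto simp: space_pair_measure space_O2_haar space_uniform_count_measure eq)
  also have "\<dots> = (\<integral>g. (\<integral>h. f g \<partial>?E) \<partial>O2_haar)"
  proof -
    have "integrable (O2_haar \<Otimes>\<^sub>M ?E) (\<lambda>(g, h). f g)"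
    proof (rule P.integrable_const_bound[where B=1])
      show "AE p in O2_haar \<Otimes>\<^sub>M ?E. norm (case p of (g, h) \<Rightarrow> f g) \<le> 1"
        using f1 by (intro AE_I2) (auto simp: space_pair_measure space_O2_haar)
      show "(\<lambda>(g, h). f g) \<in> borel_measurable (O2_haar \<Otimes>\<^sub>M ?E)"
        unfolding case_prod_beta using measurable_fst fm by (rule measurable_compose)
    qed
    from P.integral_fst[OF this] show ?thesis by simp
  qed
  also have "\<dots> = (\<integral>g. f g \<partial>O2_haar)" by (simp add: E.prob_space)
  also have "\<dots> = Gamma ((?a + 1) / 2) * Gamma ((?b + 1) / 2) * rGamma ((?a + ?b + 2) / 2) / of_real pi"
    unfolding f_def by (rule O2_beta_integral[OF a b])
  also have "\<dots> = model_period (vector [l $ 1, l $ 2, n, s])"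
  proof -
    have "(?a + 1) / 2 = model_A (vector [l $ 1, l $ 2, n, s])" "(?b + 1) / 2 = model_B (vector [l $ 1, l $ 2, n, s])"
      "(?a + ?b + 2) / 2 = model_A (vector [l $ 1, l $ 2, n, s]) + model_B (vector [l $ 1, l $ 2, n, s])"
      by (simp_all add: model_A_def model_B_def field_simps)
    then show ?thesis by (simp only: model_period_def)
  qed
  finally show ?thesis .
qed

lemma interior_convergence_region: "interior convergence_region \<noteq> {}"
proof -
  let ?S = "{p :: complex ^ 4. Re (p $ 1 + p $ 3 + p $ 4 - 1) > 0 \<and> Re (- p $ 2 - p $ 3 - p $ 4) > 0}"
  have "open ?S" by (intro open_Collect_conj open_Collect_less continuous_intros)
  moreover have "?S \<subseteq> convergence_region" by (auto simp: convergence_region_def)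
  ultimately have "?S \<subseteq> interior convergence_region" by (simp add: interior_maximal)
  \<comment> \<open>The two strict inequalities force Re (l1 - l2) > 1, so the witness has
    non-imaginary \<open>l\<close>.\<close>
  moreover have "vector [2, -1, 0, 0] \<in> ?S" by simp
  ultimately show ?thesis by blast
qed

lemma ell_mod_spherical:
  assumes "Re (l $ 1 + n + s) > 0" "Re (1 - l $ 2 - n - s) > 0"
  shows "ell_mod l n s (phi l) (psi n) = model_period (vector [l $ 1, l $ 2, n, s])"
  unfolding ell_mod_def
proof (rule meromorphic_continuation_eqI[OF meromorphic_model_period _ _ _ holomorphic_Cn_model_period interior_convergence_region])
  fix q :: "complex ^ 4" assume "q \<in> convergence_region"
  then have "period_integral (vector [q $ 1, q $ 2]) (q $ 3) (q $ 4) (phi l) (psi n) = model_period (vector [q $ 1, q $ 2, q $ 3, q $ 4])"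
    by (subst period_integral_spherical) (auto simp: convergence_region_def)
  moreover have "vector [q $ 1, q $ 2, q $ 3, q $ 4] = q" by (simp add: vec_eq_iff forall_4)
  ultimately show "model_period q = period_integral (vector [q $ 1, q $ 2]) (q $ 3) (q $ 4) (phi l) (psi n)" by simp
next
  show "open {p. Re (model_A p) > 0 \<and> Re (model_B p) > 0}"
    by (intro open_Collect_conj open_Collect_less continuous_intros continuous_on_model)
  show "vector [l $ 1, l $ 2, n, s] \<in> {p. Re (model_A p) > 0 \<and> Re (model_B p) > 0}"
    using assms by (simp add: model_A_def model_B_def)
qed

section \<open>The Whittaker function\<close>

text \<open>In these coordinates |det| is y c^2 and \<open>row_norm2\<close> is c^2, so their
  quotient is the only possible value.\<close>

lemma iwasawa_y_eq:
  assumes "g \<in> GL2"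
  shows "iwasawa_y g = \<bar>det g\<bar> / row_norm2 g"
  unfolding iwasawa_y_def
proof (rule the_equality)
  have dec: "mat22 1 x 0 1 ** mat22 y 0 0 1 ** mat c = mat22 (y * c) (x * c) 0 c" for x y c
    by (simp add: mat_eq_mat22 mat22_mult)
  have val: "y = \<bar>det g\<bar> / row_norm2 g"
    if "y > 0" "k \<in> O2" "c \<noteq> 0" "g = mat22 1 x 0 1 ** mat22 y 0 0 1 ** mat c ** k" for y x c k
  proof -
    have "\<bar>det g\<bar> = y * c\<^sup>2"
      using that(1) det_O2[OF that(2)] unfolding that(4) dec
      by (auto simp: det_mul det_mat22 abs_mult power2_eq_square)
    moreover have "row_norm2 g = c\<^sup>2"
      unfolding that(4) dec by (simp add: row_norm2_mult_O2[OF that(2)]) (simp add: row_norm2_def)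
    ultimately show ?thesis using that(3) by simp
  qed
  then show "y = \<bar>det g\<bar> / row_norm2 g"
    if "y > 0 \<and> (\<exists>x c. \<exists>k\<in>O2. c \<noteq> 0 \<and> g = mat22 1 x 0 1 ** mat22 y 0 0 1 ** mat c ** k)" for y
    using that by blast
  obtain a b d k where g: "a \<noteq> 0" "d \<noteq> 0" "k \<in> O2" "g = mat22 a b 0 d ** k"
    using iwasawa_GL2[OF assms] by metis
  \<comment> \<open>The coordinate y has to be positive; a negative sign of a/d is moved into the
    orthogonal factor through diag(e, 1).\<close>
  define e :: real where "e = (if a / d > 0 then 1 else -1)"
  have "a / d \<noteq> 0" using g(1,2) by simp
  then have e: "e * e = 1" "a / d * e > 0" unfolding e_def by (auto simp: not_less le_less)
  have k': "mat22 e 0 0 1 ** k \<in> O2"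
  proof -
    have "mat22 e 0 0 1 \<in> O2" using e by (simp add: mat22_in_O2_iff power2_eq_square)
    then show ?thesis using g(3) by (simp add: O2_def orthogonal_matrix_mul)
  qed
  have "g = mat22 (a * e) b 0 d ** (mat22 e 0 0 1 ** k)"
    unfolding g(4) matrix_mul_assoc mat22_mult using e(1) by (simp add: mult.assoc)
  also have "mat22 (a * e) b 0 d = mat22 1 (b / d) 0 1 ** mat22 (a / d * e) 0 0 1 ** mat d"
    unfolding dec using g(2) by simp
  finally have g2: "g = mat22 1 (b / d) 0 1 ** mat22 (a / d * e) 0 0 1 ** mat d ** (mat22 e 0 0 1 ** k)" .
  then show "\<bar>det g\<bar> / row_norm2 g > 0 \<and> (\<exists>x c. \<exists>k\<in>O2. c \<noteq> 0 \<and> g = mat22 1 x 0 1 ** mat22 (\<bar>det g\<bar> / row_norm2 g) 0 0 1 ** mat c ** k)"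
    using val[OF e(2) k' g(2) g2] e(2) k' g(2) by metis
qed

lemma jacquet_integral_diag:
  assumes "y > 0"
  shows "jacquet_integral (mat22 y 0 0 1) \<alpha> =
    (\<integral>t. of_real (y / (y\<^sup>2 + t\<^sup>2)) powr \<alpha> * exp (- 2 * of_real pi * \<i> * of_real t) \<partial>lborel)"
proof -
  have "I_fun \<alpha> (mat22 0 1 1 0 ** mat22 1 t 0 1 ** mat22 y 0 0 1) = of_real (y / (y\<^sup>2 + t\<^sup>2)) powr \<alpha>" for t
  proof -
    have m: "mat22 0 1 1 0 ** mat22 1 t 0 1 ** mat22 y 0 0 1 = mat22 0 1 y t" by (simp add: mat22_mult)
    have "iwasawa_y (mat22 0 1 y t) = y / (y\<^sup>2 + t\<^sup>2)"
      using assms by (subst iwasawa_y_eq) (auto simp: GL2_iff det_mat22 row_norm2_def)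
    then show ?thesis by (simp only: I_fun_def m)
  qed
  then show ?thesis unfolding jacquet_integral_def by simp
qed

text \<open>Rescaling by the standard deviation \<open>d\<close> turns the integral into the
  characteristic function of the standard normal distribution at -2 pi d.\<close>

lemma gaussian_fourier:
  assumes "c > 0"
  shows "integrable lborel (\<lambda>t. complex_of_real (exp (- c * t\<^sup>2)) * exp (- 2 * of_real pi * \<i> * of_real t))"
    and "(\<integral>t. complex_of_real (exp (- c * t\<^sup>2)) * exp (- 2 * of_real pi * \<i> * of_real t) \<partial>lborel) =
      of_real (sqrt (pi / c) * exp (- pi\<^sup>2 / c))"
proof -
  define d where "d = 1 / sqrt (2 * c)"
  have d: "d > 0" "d\<^sup>2 = 1 / (2 * c)" using assms by (auto simp: d_def power_divide)
  let ?g = "\<lambda>t. complex_of_real (exp (- c * t\<^sup>2)) * exp (- 2 * of_real pi * \<i> * of_real t)"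
  have g: "?g (0 + d * u) = of_real (sqrt (2 * pi)) * (std_normal_density u *\<^sub>R iexp ((- 2 * pi * d) * u))" for u
  proof -
    have 1: "- c * (0 + d * u)\<^sup>2 = - u\<^sup>2 / 2" using assms by (simp add: power_mult_distrib d(2))
    have 2: "- 2 * of_real pi * \<i> * of_real (0 + d * u) = \<i> * complex_of_real ((- 2 * pi * d) * u)" by simp
    have 3: "exp (- u\<^sup>2 / 2) = sqrt (2 * pi) * std_normal_density u" by (simp add: std_normal_density_def)
    show ?thesis unfolding 1 2 3 by (simp add: scaleR_conv_of_real)
  qed
  have gm: "?g \<in> borel_measurable borel" by measurable
  have int: "integrable lborel (\<lambda>u. std_normal_density u *\<^sub>R iexp ((- 2 * pi * d) * u))"
  proof (rule Bochner_Integration.integrable_bound[of _ std_normal_density])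
    show "integrable lborel std_normal_density" by (rule integrable_normal_density) simp
  qed (simp_all add: norm_mult)
  have "integrable lborel (\<lambda>u. ?g (0 + d * u))" unfolding g by (intro integrable_mult_right int)
  then show "integrable lborel ?g" using d(1) by (subst (asm) lborel_integrable_real_affine_iff) auto
  have "(\<integral>t. ?g t \<partial>lborel) = \<bar>d\<bar> *\<^sub>R (\<integral>u. ?g (0 + d * u) \<partial>lborel)"
    using d by (intro lborel_integral_real_affine) auto
  also have "(\<integral>u. ?g (0 + d * u) \<partial>lborel) = of_real (sqrt (2 * pi)) * (\<integral>u. std_normal_density u *\<^sub>R iexp ((- 2 * pi * d) * u) \<partial>lborel)"
    unfolding g by (rule integral_mult_right_zero)
  also have "(\<integral>u. std_normal_density u *\<^sub>R iexp ((- 2 * pi * d) * u) \<partial>lborel) = char std_normal_distribution (- 2 * pi * d)"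
    unfolding char_def by (subst integral_density) auto
  also have "\<dots> = of_real (exp (- ((- 2 * pi * d)\<^sup>2) / 2))"
    by (simp add: char_std_normal_distribution)
  also have "- ((- 2 * pi * d)\<^sup>2) / 2 = - pi\<^sup>2 / c"
    using assms by (simp add: power_mult_distrib d(2))
  also have "\<bar>d\<bar> *\<^sub>R (complex_of_real (sqrt (2 * pi)) * of_real (exp (- pi\<^sup>2 / c))) = of_real (d * sqrt (2 * pi) * exp (- pi\<^sup>2 / c))"
    using d(1) by (simp add: scaleR_conv_of_real)
  also have "d * sqrt (2 * pi) = sqrt (pi / c)"
    using assms by (simp add: d_def real_sqrt_divide real_sqrt_mult)
  finally show "(\<integral>t. ?g t \<partial>lborel) = of_real (sqrt (pi / c) * exp (- pi\<^sup>2 / c))" .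
qed

text \<open>Expand the exponential in powers of \<open>\<alpha>\<close> and integrate term by term;
  the integrability assumption for all \<open>R\<close> dominates the series at every
  \<open>\<alpha>\<close>, so the power series converges everywhere.\<close>

lemma holomorphic_integral_exp:
  fixes w :: "'a \<Rightarrow> complex" and g :: "'a \<Rightarrow> real"
  assumes [measurable]: "w \<in> borel_measurable M" "g \<in> borel_measurable M"
    and int: "\<And>R. integrable M (\<lambda>x. norm (w x) * exp (R * \<bar>g x\<bar>))"
  shows "(\<lambda>\<alpha>. \<integral>x. w x * exp (\<alpha> * of_real (g x)) \<partial>M) holomorphic_on UNIV"
proof -
  define c where "c = (\<lambda>n. (\<integral>x. w x * of_real (g x) ^ n /\<^sub>R fact n \<partial>M))"
  have sums: "(\<lambda>n. c n * \<alpha> ^ n) sums (\<integral>x. w x * exp (\<alpha> * of_real (g x)) \<partial>M)" for \<alpha>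
  proof -
    define f where "f = (\<lambda>n x. w x * ((\<alpha> * of_real (g x)) ^ n /\<^sub>R fact n))"
    have [measurable]: "f n \<in> borel_measurable M" for n unfolding f_def by measurable
    have nf: "norm (f n x) = norm (w x) * ((norm \<alpha> * \<bar>g x\<bar>) ^ n /\<^sub>R fact n)" for n x
      by (simp add: f_def norm_mult norm_power)
    have es: "(\<lambda>n. norm (f n x)) sums (norm (w x) * exp (norm \<alpha> * \<bar>g x\<bar>))" for x
      unfolding nf by (intro sums_mult exp_converges)
    have part: "(\<Sum>i<n. norm (f i x)) \<le> norm (w x) * exp (norm \<alpha> * \<bar>g x\<bar>)" for n x
      using sum_le_suminf[OF sums_summable[OF es[of x]], of "{..<n}"] sums_unique[OF es[of x]] by simp
    have fi: "integrable M (f n)" for n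
    proof (rule Bochner_Integration.integrable_bound[OF int[of "norm \<alpha>"]])
      show "AE x in M. norm (f n x) \<le> norm (norm (w x) * exp (norm \<alpha> * \<bar>g x\<bar>))"
      proof (rule AE_I2)
        fix x
        have "norm (f n x) \<le> (\<Sum>i<Suc n. norm (f i x))" by (rule member_le_sum) auto
        then show "norm (f n x) \<le> norm (norm (w x) * exp (norm \<alpha> * \<bar>g x\<bar>))" using part[of x "Suc n"] by simp
      qed
    qed measurable
    have "(\<lambda>n. integral\<^sup>L M (f n)) sums (\<integral>x. (\<Sum>n. f n x) \<partial>M)"
    proof (rule sums_integral[OF fi])
      show "AE x in M. summable (\<lambda>n. norm (f n x))" using es by (auto simp: sums_iff)
      show "summable (\<lambda>n. \<integral>x. norm (f n x) \<partial>M)"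
      proof (rule summableI_nonneg_bounded)
        fix n
        have "(\<Sum>i<n. \<integral>x. norm (f i x) \<partial>M) = (\<integral>x. (\<Sum>i<n. norm (f i x)) \<partial>M)"
          using fi by (intro Bochner_Integration.integral_sum[symmetric]) auto
        also have "\<dots> \<le> (\<integral>x. norm (w x) * exp (norm \<alpha> * \<bar>g x\<bar>) \<partial>M)"
          using fi int part by (intro integral_mono) auto
        finally show "(\<Sum>i<n. \<integral>x. norm (f i x) \<partial>M) \<le> (\<integral>x. norm (w x) * exp (norm \<alpha> * \<bar>g x\<bar>) \<partial>M)" .
      qed simp
    qed
    moreover have "(\<Sum>n. f n x) = w x * exp (\<alpha> * of_real (g x))" for x
      unfolding f_def by (intro sums_unique[symmetric] sums_mult exp_converges)
    moreover have "integral\<^sup>L M (f n) = c n * \<alpha> ^ n" for n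
    proof -
      have "f n = (\<lambda>x. w x * of_real (g x) ^ n /\<^sub>R fact n * \<alpha> ^ n)"
        by (auto simp: f_def power_mult_distrib scaleR_conv_of_real field_simps)
      then show ?thesis unfolding c_def by (simp only: integral_mult_left_zero)
    qed
    ultimately show ?thesis by simp
  qed
  let ?F = "\<lambda>\<alpha>. \<integral>x. w x * exp (\<alpha> * of_real (g x)) \<partial>M"
  have hol: "?F holomorphic_on ball 0 r" for r
    by (rule power_series_holomorphic[of _ _ c]) (use sums in simp)
  show ?thesis
  proof (rule holomorphic_onI)
    fix z
    have "?F field_differentiable at z"
      by (rule holomorphic_on_imp_differentiable_at[OF hol[of "norm z + 1"] open_ball]) simp
    then show "?F field_differentiable at z within UNIV" by simp
  qed
qed

text \<open>Beyond 1 the factor exp(-a x) suffices, below 1 the factor exp(-b/x). The exponents |c|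
  and -|c| - 2 dominate x^c on their halves for either sign of \<open>c\<close> and satisfy the
  convergence conditions.\<close>

lemma integrable_powr_exp_both:
  fixes c a b :: real
  assumes a: "a > 0" and b: "b > 0"
  shows "integrable pos_lborel (\<lambda>x. x powr c * exp (- a * x - b / x))"
proof -
  have 1: "integrable pos_lborel (\<lambda>x. x powr (\<bar>c\<bar> + 1 - 1) * exp (- a * x powr 1))"
    using has_bochner_integral_powr_exp_real[of a 1 "\<bar>c\<bar> + 1"] a by (auto simp: has_bochner_integral_iff)
  have 2: "integrable pos_lborel (\<lambda>x. x powr (- \<bar>c\<bar> - 1 - 1) * exp (- b * x powr (- 1)))"
    using has_bochner_integral_powr_exp_real[of b "-1" "- \<bar>c\<bar> - 1"] b by (auto simp: has_bochner_integral_iff)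
  show ?thesis
  proof (rule Bochner_Integration.integrable_bound[OF Bochner_Integration.integrable_add[OF 1 2]])
    show "(\<lambda>x. x powr c * exp (- a * x - b / x)) \<in> borel_measurable pos_lborel"
      by (rule measurable_pos_lborel) measurable
    show "AE x in pos_lborel. norm (x powr c * exp (- a * x - b / x)) \<le>
      norm (x powr (\<bar>c\<bar> + 1 - 1) * exp (- a * x powr 1) + x powr (- \<bar>c\<bar> - 1 - 1) * exp (- b * x powr (- 1)))"
    proof (rule AE_I2)
      fix x assume "x \<in> space pos_lborel"
      then have x: "x > 0" by simp
      let ?u = "x powr (\<bar>c\<bar> + 1 - 1) * exp (- a * x powr 1)" and ?v = "x powr (- \<bar>c\<bar> - 1 - 1) * exp (- b * x powr (- 1))"
      have "x powr c * exp (- a * x - b / x) \<le> ?u + ?v"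
      proof (cases "x \<ge> 1")
        case True
        have "x powr c \<le> x powr (\<bar>c\<bar> + 1 - 1)" using True by (intro powr_mono) auto
        moreover have "exp (- a * x - b / x) \<le> exp (- a * x powr 1)" using x b by simp
        ultimately have "x powr c * exp (- a * x - b / x) \<le> ?u" by (intro mult_mono) auto
        then show ?thesis by (simp add: add_increasing2)
      next
        case False
        have "x powr c \<le> x powr (- \<bar>c\<bar> - 1 - 1)" using False x by (intro powr_mono') auto
        moreover have "exp (- a * x - b / x) \<le> exp (- b * x powr (- 1))" using x a by (simp add: powr_minus divide_inverse)
        ultimately have "x powr c * exp (- a * x - b / x) \<le> ?v" by (intro mult_mono) auto
        then show ?thesis by (simp add: add_increasing)
      qed
      then show "norm (x powr c * exp (- a * x - b / x)) \<le> norm (?u + ?v)" by simp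
    qed
  qed
qed

text \<open>A Macdonald function: for y > 0 it equals 2 (pi/y)^(\<alpha> - 1/2) K_{\<alpha> - 1/2}(2
  pi y). In this form it converges for every \<open>\<alpha>\<close>.\<close>

definition bessel_integral :: "real \<Rightarrow> complex \<Rightarrow> complex" where
  "bessel_integral y \<alpha> = (\<integral>x. of_real x powr (\<alpha> - 3/2) * of_real (exp (- y\<^sup>2 * x - pi\<^sup>2 / x)) \<partial>pos_lborel)"

text \<open>From \<open>Gamma \<alpha> * (y\<^sup>2 + t\<^sup>2) powr (- \<alpha>) = (\<integral>x. x powr (\<alpha> - 1) * exp (- x * (y\<^sup>2 + t\<^sup>2)))\<close>
  and the Fourier transform of the Gaussian in \<open>t\<close>.\<close>

definition whittaker :: "real \<Rightarrow> complex \<Rightarrow> complex" where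
  "whittaker y \<alpha> = rGamma \<alpha> * of_real y powr \<alpha> * of_real (sqrt pi) * bessel_integral y \<alpha>"

lemma holomorphic_bessel_integral:
  assumes "y > 0"
  shows "bessel_integral y holomorphic_on UNIV"
proof -
  let ?w = "\<lambda>x. of_real x powr (- 3/2) * complex_of_real (exp (- y\<^sup>2 * x - pi\<^sup>2 / x))"
  have y2: "y\<^sup>2 > 0" "pi\<^sup>2 > 0" using assms by auto
  have "(\<lambda>\<alpha>. \<integral>x. ?w x * exp (\<alpha> * of_real (ln x)) \<partial>pos_lborel) holomorphic_on UNIV"
  proof (rule holomorphic_integral_exp)
    show "?w \<in> borel_measurable pos_lborel"
      by (rule measurable_pos_lborel) measurable
    have "(\<lambda>x::real. ln x) \<in> borel_measurable borel" by measurable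
    then show "ln \<in> borel_measurable pos_lborel" by (rule measurable_pos_lborel)
    fix R :: real
    have "integrable pos_lborel (\<lambda>x. x powr (- 3/2 + R) * exp (- y\<^sup>2 * x - pi\<^sup>2 / x) + x powr (- 3/2 - R) * exp (- y\<^sup>2 * x - pi\<^sup>2 / x))"
      by (intro Bochner_Integration.integrable_add integrable_powr_exp_both y2)
    then show "integrable pos_lborel (\<lambda>x. norm (?w x) * exp (R * \<bar>ln x\<bar>))"
    proof (rule Bochner_Integration.integrable_bound)
      show "(\<lambda>x. norm (?w x) * exp (R * \<bar>ln x\<bar>)) \<in> borel_measurable pos_lborel"
        by (rule measurable_pos_lborel) measurable
      show "AE x in pos_lborel. norm (norm (?w x) * exp (R * \<bar>ln x\<bar>)) \<le>
        norm (x powr (- 3/2 + R) * exp (- y\<^sup>2 * x - pi\<^sup>2 / x) + x powr (- 3/2 - R) * exp (- y\<^sup>2 * x - pi\<^sup>2 / x))"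
      proof (rule AE_I2)
        fix x assume "x \<in> space pos_lborel"
        then have x: "x > 0" by simp
        \<comment> \<open>The left side is one of the two powers on the right, according to the sign
          of \<open>ln x\<close>.\<close>
        have "exp (R * \<bar>ln x\<bar>) \<le> x powr R + x powr (- R)"
          using x by (cases "ln x \<ge> 0") (auto simp: powr_def)
        then have "norm (?w x) * exp (R * \<bar>ln x\<bar>) \<le> (x powr (- 3/2) * exp (- y\<^sup>2 * x - pi\<^sup>2 / x)) * (x powr R + x powr (- R))"
          using x by (subst norm_mult, subst norm_of_real_powr) (auto intro!: mult_left_mono)
        also have "\<dots> = x powr (- 3/2 + R) * exp (- y\<^sup>2 * x - pi\<^sup>2 / x) + x powr (- 3/2 - R) * exp (- y\<^sup>2 * x - pi\<^sup>2 / x)"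
          by (simp only: diff_conv_add_uminus[of "- 3/2" R] powr_add distrib_left distrib_right mult_ac)
        finally show "norm (norm (?w x) * exp (R * \<bar>ln x\<bar>)) \<le>
          norm (x powr (- 3/2 + R) * exp (- y\<^sup>2 * x - pi\<^sup>2 / x) + x powr (- 3/2 - R) * exp (- y\<^sup>2 * x - pi\<^sup>2 / x))"
          by simp
      qed
    qed
  qed
  also have "(\<lambda>\<alpha>. \<integral>x. ?w x * exp (\<alpha> * of_real (ln x)) \<partial>pos_lborel) = bessel_integral y"
  proof
    fix \<alpha>
    have "?w x * exp (\<alpha> * of_real (ln x)) = of_real x powr (\<alpha> - 3/2) * of_real (exp (- y\<^sup>2 * x - pi\<^sup>2 / x))" if "x > 0" for x
    proof -
      have eq: "of_real x powr (- 3/2) * exp (\<alpha> * of_real (ln x)) = complex_of_real x powr (\<alpha> - 3/2)"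
        unfolding of_real_powr_eq_exp[OF that] exp_add[symmetric] by (simp add: algebra_simps)
      show ?thesis unfolding eq[symmetric] by (simp only: mult_ac)
    qed
    then show "(\<integral>x. ?w x * exp (\<alpha> * of_real (ln x)) \<partial>pos_lborel) = bessel_integral y \<alpha>"
      unfolding bessel_integral_def by (intro Bochner_Integration.integral_cong) auto
  qed
  finally show ?thesis .
qed

lemma holomorphic_whittaker:
  assumes "y > 0"
  shows "whittaker y holomorphic_on UNIV"
proof -
  have "(\<lambda>\<alpha>. rGamma \<alpha> * exp (\<alpha> * of_real (ln y)) * of_real (sqrt pi) * bessel_integral y \<alpha>) holomorphic_on UNIV"
    by (intro holomorphic_intros holomorphic_rGamma holomorphic_bessel_integral[OF assms])
  then show ?thesis
    unfolding whittaker_def[abs_def] of_real_powr_eq_exp[OF assms] .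
qed

lemma measurable_pos_lborel_pair:
  assumes "f \<in> borel \<Otimes>\<^sub>M borel \<rightarrow>\<^sub>M borel"
  shows "f \<in> pos_lborel \<Otimes>\<^sub>M lborel \<rightarrow>\<^sub>M borel" "f \<in> pos_lborel \<Otimes>\<^sub>M pos_lborel \<rightarrow>\<^sub>M borel"
proof -
  have "(\<lambda>p. (fst p, snd p)) \<in> pos_lborel \<Otimes>\<^sub>M lborel \<rightarrow>\<^sub>M borel \<Otimes>\<^sub>M borel"
    by (intro measurable_Pair measurable_compose[OF measurable_fst id_measurable_pos_lborel]) measurable
  from measurable_compose[OF this assms] show "f \<in> pos_lborel \<Otimes>\<^sub>M lborel \<rightarrow>\<^sub>M borel" by simp
  have "(\<lambda>p. (fst p, snd p)) \<in> pos_lborel \<Otimes>\<^sub>M pos_lborel \<rightarrow>\<^sub>M borel \<Otimes>\<^sub>M borel"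
    by (intro measurable_Pair measurable_compose[OF measurable_fst id_measurable_pos_lborel]
      measurable_compose[OF measurable_snd id_measurable_pos_lborel])
  from measurable_compose[OF this assms] show "f \<in> pos_lborel \<Otimes>\<^sub>M pos_lborel \<rightarrow>\<^sub>M borel" by simp
qed

lemma powr_neg_half: "(x::real) > 0 \<Longrightarrow> x powr (- 1/2) = 1 / sqrt x"
  using powr_minus_divide[of x "1/2"] powr_half_sqrt[of x] by simp

text \<open>Exchanging the Gamma integral with the Fourier integral needs absolute convergence:
  integrating the norm over \<open>t\<close> leaves x^(Re \<alpha> - 3/2) exp(-y^2 x), and
  integrability at 0 is exactly the condition Re \<alpha> > 1/2.\<close>

lemma jacquet_integral_eq_whittaker:
  assumes y: "y > 0" and \<alpha>: "Re \<alpha> > 1/2"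
  shows "jacquet_integral (mat22 y 0 0 1) \<alpha> = whittaker y \<alpha>"
proof -
  interpret P: pair_sigma_finite pos_lborel "lborel :: real measure"
    by (intro pair_sigma_finite.intro sigma_finite_pos_lborel sigma_finite_lborel)
  define e where "e = (\<lambda>t. exp (- 2 * of_real pi * \<i> * complex_of_real t))"
  have e1: "norm (e t) = 1" for t by (simp add: e_def)
  have em [measurable]: "e \<in> borel_measurable borel" unfolding e_def by measurable
  define f where "f = (\<lambda>x t. of_real x powr (\<alpha> - 1) * complex_of_real (exp (- (y\<^sup>2 + t\<^sup>2) * x)) * e t)"
  have f2: "f x t = (of_real x powr (\<alpha> - 1) * complex_of_real (exp (- y\<^sup>2 * x))) * (of_real (exp (- x * t\<^sup>2)) * e t)" for x t
  proof -
    have "complex_of_real (exp (- (y\<^sup>2 + t\<^sup>2) * x)) = of_real (exp (- y\<^sup>2 * x)) * of_real (exp (- x * t\<^sup>2))"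
      unfolding of_real_mult[symmetric] exp_add[symmetric] by (simp add: algebra_simps)
    then show ?thesis by (simp only: f_def mult_ac)
  qed
  have "case_prod f \<in> borel \<Otimes>\<^sub>M borel \<rightarrow>\<^sub>M borel" unfolding f_def case_prod_beta by measurable
  then have fm: "case_prod f \<in> borel_measurable (pos_lborel \<Otimes>\<^sub>M lborel)" by (rule measurable_pos_lborel_pair)
  have pos: "y\<^sup>2 + t\<^sup>2 > 0" for t using y by (simp add: add_pos_nonneg)
  have dx: "has_bochner_integral pos_lborel (\<lambda>x. f x t) (Gamma \<alpha> * (of_real (y\<^sup>2 + t\<^sup>2) powr (- \<alpha>) * e t))" for t
  proof -
    have "has_bochner_integral pos_lborel (\<lambda>x. of_real x powr (\<alpha> - 1) * of_real (exp (- (y\<^sup>2 + t\<^sup>2) * x powr 1)) * e t)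
      ((Gamma (\<alpha> / of_real 1) * of_real (y\<^sup>2 + t\<^sup>2) powr (- \<alpha> / of_real 1) / of_real \<bar>1\<bar>) * e t)"
      using \<alpha> pos[of t] by (intro has_bochner_integral_mult_left has_bochner_integral_powr_exp) auto
    then show ?thesis
      by (subst (asm) has_bochner_integral_cong[OF refl _ refl, where g="\<lambda>x. f x t"]) (simp_all add: f_def mult.assoc)
  qed
  have dt: "integrable lborel (f x)"
      "(\<integral>t. f x t \<partial>lborel) = of_real (sqrt pi) * (of_real x powr (\<alpha> - 3/2) * of_real (exp (- y\<^sup>2 * x - pi\<^sup>2 / x)))"
    if x: "x > 0" for x
  proof -
    have g: "integrable lborel (\<lambda>t. complex_of_real (exp (- x * t\<^sup>2)) * e t)"
      "(\<integral>t. complex_of_real (exp (- x * t\<^sup>2)) * e t \<partial>lborel) = of_real (sqrt (pi / x) * exp (- pi\<^sup>2 / x))"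
      unfolding e_def by (rule gaussian_fourier[OF x])+
    show "integrable lborel (f x)" unfolding f2[abs_def] by (intro integrable_mult_right g(1))
    have "(\<integral>t. f x t \<partial>lborel) = (of_real x powr (\<alpha> - 1) * complex_of_real (exp (- y\<^sup>2 * x))) * of_real (sqrt (pi / x) * exp (- pi\<^sup>2 / x))"
      unfolding f2 integral_mult_right_zero g(2) ..
    also have "complex_of_real (sqrt (pi / x)) = of_real (sqrt pi) * of_real x powr (- 1/2)"
    proof -
      have "sqrt (pi / x) = sqrt pi * x powr (- 1/2)"
        using powr_neg_half[OF x] by (simp add: real_sqrt_divide)
      then show ?thesis using powr_of_real[of x "- 1/2"] x by simp
    qed
    then have "(of_real x powr (\<alpha> - 1) * complex_of_real (exp (- y\<^sup>2 * x))) * of_real (sqrt (pi / x) * exp (- pi\<^sup>2 / x))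
      = of_real (sqrt pi) * ((of_real x powr (\<alpha> - 1) * of_real x powr (- 1/2)) * of_real (exp (- y\<^sup>2 * x) * exp (- pi\<^sup>2 / x)))"
      by (simp add: mult_ac)
    also have "of_real x powr (\<alpha> - 1) * of_real x powr (- 1/2) = complex_of_real x powr (\<alpha> - 3/2)"
      unfolding powr_add[symmetric] by simp
    also have "exp (- y\<^sup>2 * x) * exp (- pi\<^sup>2 / x) = exp (- y\<^sup>2 * x - pi\<^sup>2 / x)"
      by (simp flip: exp_add)
    finally show "(\<integral>t. f x t \<partial>lborel) = of_real (sqrt pi) * (of_real x powr (\<alpha> - 3/2) * of_real (exp (- y\<^sup>2 * x - pi\<^sup>2 / x)))" .
  qed
  have int: "integrable (pos_lborel \<Otimes>\<^sub>M lborel) (case_prod f)"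
  proof (rule P.Fubini_integrable[OF fm])
    have n: "(\<integral>t. norm (f x t) \<partial>lborel) = sqrt pi * (x powr (Re \<alpha> - 1/2 - 1) * exp (- y\<^sup>2 * x powr 1))" if x: "x > 0" for x
    proof -
      have "has_bochner_integral lborel (\<lambda>t. \<bar>t\<bar> powr 0 * exp (- x * t\<^sup>2)) (Gamma ((0 + 1) / 2) * x powr (- (0 + 1) / 2))"
        using x by (intro has_bochner_integral_abs_powr_gaussian_real) auto
      \<comment> \<open>\<open>\<bar>t\<bar> powr 0\<close> is 0 at \<open>t = 0\<close> and 1
        elsewhere.\<close>
      moreover have "AE t in lborel. \<bar>t\<bar> powr 0 * exp (- x * t\<^sup>2) = exp (- x * t\<^sup>2)"
        using AE_lborel_singleton[of "0::real"] by eventually_elim simp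
      ultimately have g: "(\<integral>t. exp (- x * t\<^sup>2) \<partial>lborel) = sqrt pi * x powr (- 1/2)"
        by (subst integral_cong_AE[where g="\<lambda>t. \<bar>t\<bar> powr 0 * exp (- x * t\<^sup>2)"])
          (auto simp: has_bochner_integral_iff Gamma_one_half_real)
      have "norm (f x t) = (x powr (Re \<alpha> - 1) * exp (- y\<^sup>2 * x)) * exp (- x * t\<^sup>2)" for t
        using x unfolding f2 norm_mult e1 by (subst norm_of_real_powr) auto
      then have "(\<integral>t. norm (f x t) \<partial>lborel) = (x powr (Re \<alpha> - 1) * exp (- y\<^sup>2 * x)) * (sqrt pi * x powr (- 1/2))"
        by (simp only: integral_mult_right_zero g)
      also have "\<dots> = sqrt pi * ((x powr (Re \<alpha> - 1) * x powr (- 1/2)) * exp (- y\<^sup>2 * x))" by (simp add: mult_ac)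
      also have "x powr (Re \<alpha> - 1) * x powr (- 1/2) = x powr (Re \<alpha> - 1/2 - 1)"
        unfolding powr_add[symmetric] by (simp add: algebra_simps)
      finally show ?thesis using x by simp
    qed
    have "integrable pos_lborel (\<lambda>x. sqrt pi * (x powr (Re \<alpha> - 1/2 - 1) * exp (- y\<^sup>2 * x powr 1)))"
      using has_bochner_integral_powr_exp_real[of "y\<^sup>2" 1 "Re \<alpha> - 1/2"] \<alpha> y
      by (intro integrable_mult_right) (auto simp: has_bochner_integral_iff)
    then show "integrable pos_lborel (\<lambda>x. \<integral>t. norm (case (x, t) of (x, t) \<Rightarrow> f x t) \<partial>lborel)"
      by (subst Bochner_Integration.integrable_cong[OF refl, where g="\<lambda>x. sqrt pi * (x powr (Re \<alpha> - 1/2 - 1) * exp (- y\<^sup>2 * x powr 1))"])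
        (simp_all only: space_pos_lborel greaterThan_iff n case_prod_conv)
    show "AE x in pos_lborel. integrable lborel (\<lambda>t. case (x, t) of (x, t) \<Rightarrow> f x t)"
      by (intro AE_I2) (auto intro: dt(1))
  qed
  have "Gamma \<alpha> * (\<integral>t. of_real (y\<^sup>2 + t\<^sup>2) powr (- \<alpha>) * e t \<partial>lborel) = (\<integral>t. (\<integral>x. f x t \<partial>pos_lborel) \<partial>lborel)"
    using dx by (simp add: has_bochner_integral_iff)
  also have "\<dots> = (\<integral>x. (\<integral>t. f x t \<partial>lborel) \<partial>pos_lborel)"
    by (rule P.Fubini_integral[OF int])
  also have "\<dots> = (\<integral>x. of_real (sqrt pi) * (of_real x powr (\<alpha> - 3/2) * of_real (exp (- y\<^sup>2 * x - pi\<^sup>2 / x))) \<partial>pos_lborel)"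
    by (rule Bochner_Integration.integral_cong) (auto simp: dt(2))
  also have "\<dots> = of_real (sqrt pi) * bessel_integral y \<alpha>"
    unfolding bessel_integral_def by (rule integral_mult_right_zero)
  finally have main: "Gamma \<alpha> * (\<integral>t. of_real (y\<^sup>2 + t\<^sup>2) powr (- \<alpha>) * e t \<partial>lborel) = of_real (sqrt pi) * bessel_integral y \<alpha>" .
  have G: "rGamma \<alpha> * Gamma \<alpha> = 1"
  proof -
    have "\<alpha> \<notin> \<int>\<^sub>\<le>\<^sub>0" using Re_nonpos_Ints[of \<alpha>] \<alpha> by auto
    then show ?thesis by (simp add: rGamma_inverse_Gamma Gamma_eq_zero_iff)
  qed
  have "jacquet_integral (mat22 y 0 0 1) \<alpha> = (\<integral>t. of_real y powr \<alpha> * (of_real (y\<^sup>2 + t\<^sup>2) powr (- \<alpha>) * e t) \<partial>lborel)"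
  proof -
    have "of_real (y / (y\<^sup>2 + t\<^sup>2)) powr \<alpha> = of_real y powr \<alpha> * complex_of_real (y\<^sup>2 + t\<^sup>2) powr (- \<alpha>)" for t
    proof -
      have "y / (y\<^sup>2 + t\<^sup>2) > 0" using y pos[of t] by simp
      then show ?thesis
        using y pos[of t] unfolding of_real_powr_eq_exp[OF y] of_real_powr_eq_exp[OF pos] exp_add[symmetric]
        by (simp only: of_real_powr_eq_exp) (simp add: ln_div algebra_simps)
    qed
    then show ?thesis unfolding jacquet_integral_diag[OF y] e_def by (simp only: mult.assoc)
  qed
  also have "\<dots> = of_real y powr \<alpha> * ((rGamma \<alpha> * Gamma \<alpha>) * (\<integral>t. of_real (y\<^sup>2 + t\<^sup>2) powr (- \<alpha>) * e t \<partial>lborel))"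
    unfolding integral_mult_right_zero G by simp
  also have "\<dots> = whittaker y \<alpha>"
    unfolding mult.assoc main whittaker_def by (simp only: mult_ac)
  finally show ?thesis .
qed

lemma W_J_eq_whittaker:
  assumes "y > 0"
  shows "W_J (mat22 y 0 0 1) = whittaker y"
  unfolding W_J_def
proof (rule the_equality)
  show "whittaker y holomorphic_on UNIV \<and> (\<forall>\<alpha>. Re \<alpha> > 1/2 \<longrightarrow> whittaker y \<alpha> = jacquet_integral (mat22 y 0 0 1) \<alpha>)"
    using holomorphic_whittaker jacquet_integral_eq_whittaker assms by simp
  fix F assume F: "F holomorphic_on UNIV \<and> (\<forall>\<alpha>. Re \<alpha> > 1/2 \<longrightarrow> F \<alpha> = jacquet_integral (mat22 y 0 0 1) \<alpha>)"
  show "F = whittaker y"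
  proof
    fix \<alpha>
    show "F \<alpha> = whittaker y \<alpha>"
    proof (rule analytic_continuation_open[where s="{z. Re z > 1/2}" and s'=UNIV and f=F and g="whittaker y"])
      show "open {z. Re z > 1/2}" by (rule open_halfspace_Re_gt)
      have "1 \<in> {z. Re z > 1/2}" by simp
      then show "{z. Re z > 1/2} \<noteq> {}" by blast
    qed (use F holomorphic_whittaker jacquet_integral_eq_whittaker assms in auto)
  qed
qed

text \<open>After inserting the Bessel integral, the \<open>y\<close>-integral is done first: a
  Gaussian moment proportional to x^(-z/2), with z = \<alpha> + s - 1/2. The remaining
  \<open>x\<close>-integral is Euler's with \<open>p = -1\<close>. The two hypotheses are the
  convergence conditions of these two integrals.\<close>

lemma G_factor_eq:
  fixes l :: "complex ^ 2" and s :: complex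
  defines "\<alpha> \<equiv> (l $ 1 - l $ 2 + 1) / 2"
  assumes z: "Re (\<alpha> + s - 1/2) > 0" and v: "Re (\<alpha> - s - 1/2) < 0"
  shows "G_factor l n s = rGamma \<alpha> * of_real (sqrt pi) * (Gamma ((\<alpha> + s - 1/2) / 2) / 2) *
    (Gamma (- ((\<alpha> - s - 1/2) / 2)) * of_real (pi\<^sup>2) powr ((\<alpha> - s - 1/2) / 2))"
proof -
  interpret P: pair_sigma_finite pos_lborel pos_lborel
    by (intro pair_sigma_finite.intro sigma_finite_pos_lborel)
  let ?z = "\<alpha> + s - 1/2" and ?v = "(\<alpha> - s - 1/2) / 2"
  define f where "f = (\<lambda>x y. (of_real y powr (?z - 1) * complex_of_real (exp (- x * y\<^sup>2))) * (of_real x powr (\<alpha> - 3/2) * of_real (exp (- pi\<^sup>2 / x))))"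
  have "case_prod f \<in> borel \<Otimes>\<^sub>M borel \<rightarrow>\<^sub>M borel" unfolding f_def case_prod_beta by measurable
  then have fm: "case_prod f \<in> borel_measurable (pos_lborel \<Otimes>\<^sub>M pos_lborel)" by (rule measurable_pos_lborel_pair)
  have dy: "has_bochner_integral pos_lborel (f x) (Gamma (?z / 2) / 2 * (of_real x powr (?v - 1) * of_real (exp (- pi\<^sup>2 * x powr (- 1)))))"
    if x: "x > 0" for x
  proof -
    have pm: "- pi\<^sup>2 * x powr (- 1) = - pi\<^sup>2 / x" using powr_minus_divide[of x 1] x by simp
    have H: "has_bochner_integral pos_lborel (\<lambda>y. (of_real y powr (?z - 1) * of_real (exp (- x * y powr 2))) * (of_real x powr (\<alpha> - 3/2) * of_real (exp (- pi\<^sup>2 / x))))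
      ((Gamma (?z / of_real 2) * of_real x powr (- ?z / of_real 2) / of_real \<bar>2\<bar>) * (of_real x powr (\<alpha> - 3/2) * of_real (exp (- pi\<^sup>2 / x))))"
      using x z by (intro has_bochner_integral_mult_left has_bochner_integral_powr_exp) auto
    have E1: "(Gamma (?z / of_real 2) * of_real x powr (- ?z / of_real 2) / of_real \<bar>2\<bar>) * (of_real x powr (\<alpha> - 3/2) * of_real (exp (- pi\<^sup>2 / x)))
      = Gamma (?z / 2) / 2 * ((of_real x powr (- ?z / 2) * of_real x powr (\<alpha> - 3/2)) * of_real (exp (- pi\<^sup>2 * x powr (- 1))))"
      unfolding pm by simp
    have E2: "of_real x powr (- ?z / 2) * of_real x powr (\<alpha> - 3/2) = complex_of_real x powr (?v - 1)"
      unfolding powr_add[symmetric] by (rule arg_cong[where f="(powr) _"]) (simp add: field_simps)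
    from H show ?thesis
      unfolding E1 E2
      by (subst (asm) has_bochner_integral_cong[OF refl _ refl, where g="f x"]) (simp_all add: f_def)
  qed
  \<comment> \<open>Same evaluation with real parts of the exponents, giving the absolute
    convergence required for exchanging the integrals.\<close>
  have dyn: "(\<integral>y. norm (f x y) \<partial>pos_lborel) = Gamma (Re ?z / 2) / 2 * (x powr (Re ?v - 1) * exp (- pi\<^sup>2 * x powr (- 1)))"
    if x: "x > 0" for x
  proof -
    have pm: "- pi\<^sup>2 * x powr (- 1) = - pi\<^sup>2 / x" using powr_minus_divide[of x 1] x by simp
    have H: "has_bochner_integral pos_lborel (\<lambda>y. (y powr (Re ?z - 1) * exp (- x * y powr 2)) * (x powr (Re \<alpha> - 3/2) * exp (- pi\<^sup>2 / x)))
      ((Gamma (Re ?z / 2) * x powr (- Re ?z / 2) / \<bar>2\<bar>) * (x powr (Re \<alpha> - 3/2) * exp (- pi\<^sup>2 / x)))"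
      using x z by (intro has_bochner_integral_mult_left has_bochner_integral_powr_exp_real) auto
    have E1: "(Gamma (Re ?z / 2) * x powr (- Re ?z / 2) / \<bar>2\<bar>) * (x powr (Re \<alpha> - 3/2) * exp (- pi\<^sup>2 / x))
      = Gamma (Re ?z / 2) / 2 * ((x powr (- Re ?z / 2) * x powr (Re \<alpha> - 3/2)) * exp (- pi\<^sup>2 * x powr (- 1)))"
      unfolding pm by simp
    have E2: "x powr (- Re ?z / 2) * x powr (Re \<alpha> - 3/2) = x powr (Re ?v - 1)"
      unfolding powr_add[symmetric] by (rule arg_cong[where f="(powr) _"]) (simp add: field_simps)
    have "(\<integral>y. (y powr (Re ?z - 1) * exp (- x * y powr 2)) * (x powr (Re \<alpha> - 3/2) * exp (- pi\<^sup>2 / x)) \<partial>pos_lborel)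
      = Gamma (Re ?z / 2) / 2 * (x powr (Re ?v - 1) * exp (- pi\<^sup>2 * x powr (- 1)))"
      using has_bochner_integral_integral_eq[OF H] unfolding E1 E2 .
    moreover have "norm (f x y) = (y powr (Re ?z - 1) * exp (- x * y powr 2)) * (x powr (Re \<alpha> - 3/2) * exp (- pi\<^sup>2 / x))" if "y > 0" for y
      using x that unfolding f_def norm_mult by (subst (1 2) norm_of_real_powr) auto
    ultimately show ?thesis
      by (subst Bochner_Integration.integral_cong[OF refl, where g="\<lambda>y. (y powr (Re ?z - 1) * exp (- x * y powr 2)) * (x powr (Re \<alpha> - 3/2) * exp (- pi\<^sup>2 / x))"]) auto
  qed
  have v': "Re ?v / (-1) > 0" using v by simp
  have int: "integrable (pos_lborel \<Otimes>\<^sub>M pos_lborel) (case_prod f)"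
  proof (rule P.Fubini_integrable[OF fm])
    have "integrable pos_lborel (\<lambda>x. Gamma (Re ?z / 2) / 2 * (x powr (Re ?v - 1) * exp (- pi\<^sup>2 * x powr (- 1))))"
      using has_bochner_integral_powr_exp_real[of "pi\<^sup>2" "-1" "Re ?v"] v'
      by (intro integrable_mult_right) (auto simp: has_bochner_integral_iff)
    then show "integrable pos_lborel (\<lambda>x. \<integral>y. norm (case (x, y) of (x, y) \<Rightarrow> f x y) \<partial>pos_lborel)"
      by (subst Bochner_Integration.integrable_cong[OF refl, where g="\<lambda>x. Gamma (Re ?z / 2) / 2 * (x powr (Re ?v - 1) * exp (- pi\<^sup>2 * x powr (- 1)))"])
        (simp_all only: space_pos_lborel greaterThan_iff dyn case_prod_conv)
    show "AE x in pos_lborel. integrable pos_lborel (\<lambda>y. case (x, y) of (x, y) \<Rightarrow> f x y)"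
      using dy by (intro AE_I2) (auto simp: has_bochner_integral_iff)
  qed
  have "G_factor l n s = (\<integral>y. W_J (mat22 y 0 0 1) \<alpha> * of_real y powr (s - 1/2) / of_real y \<partial>pos_lborel)"
    unfolding G_factor_def set_lebesgue_integral_def \<alpha>_def by (subst integral_restrict_space) auto
  also have "\<dots> = (\<integral>y. (rGamma \<alpha> * of_real (sqrt pi)) * (\<integral>x. f x y \<partial>pos_lborel) \<partial>pos_lborel)"
  proof (rule Bochner_Integration.integral_cong[OF refl])
    fix y assume "y \<in> space pos_lborel"
    then have y: "y > 0" by simp
    have "(\<integral>x. f x y \<partial>pos_lborel) = (\<integral>x. of_real y powr (?z - 1) * (of_real x powr (\<alpha> - 3/2) * of_real (exp (- y\<^sup>2 * x - pi\<^sup>2 / x))) \<partial>pos_lborel)"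
    proof (rule Bochner_Integration.integral_cong[OF refl])
      fix x
      have "complex_of_real (exp (- y\<^sup>2 * x - pi\<^sup>2 / x)) = of_real (exp (- x * y\<^sup>2)) * of_real (exp (- pi\<^sup>2 / x))"
        unfolding of_real_mult[symmetric] exp_add[symmetric] by (simp add: mult.commute)
      then show "f x y = of_real y powr (?z - 1) * (of_real x powr (\<alpha> - 3/2) * of_real (exp (- y\<^sup>2 * x - pi\<^sup>2 / x)))"
        by (simp only: f_def mult_ac)
    qed
    also have "\<dots> = of_real y powr (?z - 1) * bessel_integral y \<alpha>"
      unfolding bessel_integral_def by (rule integral_mult_right_zero)
    finally have 1: "(\<integral>x. f x y \<partial>pos_lborel) = of_real y powr (?z - 1) * bessel_integral y \<alpha>" .
    have 2: "of_real y powr \<alpha> * of_real y powr (s - 1/2) / of_real y = complex_of_real y powr (?z - 1)"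
    proof -
      have "of_real y powr (?z - 1) = complex_of_real y powr (\<alpha> + (s - 1/2)) / of_real y powr 1"
        unfolding powr_diff[symmetric] by (simp add: algebra_simps)
      also have "complex_of_real y powr 1 = of_real y" using of_real_powr_eq_exp[OF y, of 1] y by (simp add: exp_of_real)
      finally show ?thesis by (simp only: powr_add)
    qed
    show "W_J (mat22 y 0 0 1) \<alpha> * of_real y powr (s - 1/2) / of_real y = (rGamma \<alpha> * of_real (sqrt pi)) * (\<integral>x. f x y \<partial>pos_lborel)"
      unfolding 1 W_J_eq_whittaker[OF y] whittaker_def 2[symmetric] by (simp only: mult_ac divide_inverse)
  qed
  also have "\<dots> = (rGamma \<alpha> * of_real (sqrt pi)) * (\<integral>y. (\<integral>x. f x y \<partial>pos_lborel) \<partial>pos_lborel)"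
    by (rule integral_mult_right_zero)
  also have "(\<integral>y. (\<integral>x. f x y \<partial>pos_lborel) \<partial>pos_lborel) = (\<integral>x. (\<integral>y. f x y \<partial>pos_lborel) \<partial>pos_lborel)"
    by (rule P.Fubini_integral[OF int])
  also have "\<dots> = (\<integral>x. Gamma (?z / 2) / 2 * (of_real x powr (?v - 1) * of_real (exp (- pi\<^sup>2 * x powr (- 1)))) \<partial>pos_lborel)"
    using dy by (intro Bochner_Integration.integral_cong refl) (auto simp: has_bochner_integral_iff)
  also have "\<dots> = Gamma (?z / 2) / 2 * (\<integral>x. of_real x powr (?v - 1) * of_real (exp (- pi\<^sup>2 * x powr (- 1))) \<partial>pos_lborel)"
    by (rule integral_mult_right_zero)
  also have "(\<integral>x. of_real x powr (?v - 1) * of_real (exp (- pi\<^sup>2 * x powr (- 1))) \<partial>pos_lborel) = Gamma (- ?v) * of_real (pi\<^sup>2) powr ?v"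
    using has_bochner_integral_powr_exp[of "pi\<^sup>2" "-1" ?v] v' by (simp add: has_bochner_integral_iff)
  finally show ?thesis by (simp only: mult.assoc)
qed

theorem mainTheorem4:
  shows "\<exists>C::real. C > 0 \<and>
    (\<forall>(l::complex ^ 2) (n::complex) (s::complex).
       (\<forall>i. Re (l $ i) = 0) \<longrightarrow> Re n = 0 \<longrightarrow> l $ 1 + l $ 2 = 0 \<longrightarrow> n = 0 \<longrightarrow> Re s = 1/2 \<longrightarrow>
       norm (G_factor l n s) = C * norm (ell_mod l n s (phi l) (psi n)))"
proof (intro exI[of _ "pi / 2"] conjI allI impI)
  \<comment> \<open>The constant is the 1/2 in \<open>G_factor_eq\<close> divided by the 1/pi in
    \<open>model_period\<close>; the Gamma factors match in absolute value.\<close>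
  fix l :: "complex ^ 2" and n s :: complex
  assume l: "\<forall>i. Re (l $ i) = 0" and n: "n = 0" and l12: "l $ 1 + l $ 2 = 0" and s: "Re s = 1/2"
  let ?\<alpha> = "(l $ 1 - l $ 2 + 1) / 2" and ?p = "vector [l $ 1, l $ 2, n, s] :: complex ^ 4"
  let ?v = "(?\<alpha> - s - 1/2) / 2"
  have l2: "l $ 2 = - l $ 1" using l12 by (simp add: add_eq_0_iff)
  have A: "(?\<alpha> + s - 1/2) / 2 = model_A ?p" by (simp add: model_A_def l2 n field_simps)
  \<comment> \<open>On the critical line \<open>s - l $ 1\<close> and \<open>1 + l $ 1 - s\<close> are complex conjugates.\<close>
  have B: "- ?v = cnj (model_B ?p)"
    using l s by (simp add: model_B_def l2 n complex_eq_iff field_simps)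
  have AB: "?\<alpha> = model_A ?p + model_B ?p" by (simp add: model_A_def model_B_def l2 n field_simps)
  \<comment> \<open>The real part of \<open>?v\<close> is -1/4 on the critical line, so this modulus
    cancels the \<open>sqrt pi\<close> in \<open>G_factor_eq\<close>.\<close>
  have "norm (complex_of_real (pi\<^sup>2) powr ?v) = (pi\<^sup>2) powr (- 1/4)"
  proof -
    have "Re ?v = - 1/4" using l s by simp
    then show ?thesis by (subst norm_of_real_powr) (simp_all only: zero_le_power2)
  qed
  also have "\<dots> = (pi powr 2) powr (- 1/4)" by simp
  also have "\<dots> = pi powr (- 1/2)" unfolding powr_powr by simp
  also have "\<dots> = 1 / sqrt pi" by (rule powr_neg_half) simp
  finally have pv: "norm (complex_of_real (pi\<^sup>2) powr ?v) = 1 / sqrt pi" .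
  have "G_factor l n s = rGamma ?\<alpha> * of_real (sqrt pi) * (Gamma ((?\<alpha> + s - 1/2) / 2) / 2) * (Gamma (- ?v) * of_real (pi\<^sup>2) powr ?v)"
    using l s by (intro G_factor_eq) simp_all
  then have "norm (G_factor l n s) = norm (rGamma ?\<alpha>) * sqrt pi * (norm (Gamma (model_A ?p)) / 2) * (norm (Gamma (model_B ?p)) * (1 / sqrt pi))"
    by (simp only: A B norm_mult norm_divide pv cnj_Gamma[symmetric] complex_mod_cnj) simp
  also have "\<dots> = pi / 2 * norm (model_period ?p)"
    unfolding model_period_def AB by (simp add: norm_mult norm_divide)
  also have "model_period ?p = ell_mod l n s (phi l) (psi n)"
    using l s n by (intro ell_mod_spherical[symmetric]) simp_all
  finally show "norm (G_factor l n s) = pi / 2 * norm (ell_mod l n s (phi l) (psi n))" .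
qed simp

end
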